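(* Let $T>0$. Let $W_n$ ($n\in\mathbb{N}$) be a sequence of graphs on $n$ nodes (identified with their step-graphons on $(0,1)^2$) and let $W$ be a graphon, all satisfying the standing graphon assumption, with $W_n,W\in L^1((0,1)^2)$ and $\|W_n-W\|_\square\to0$ as $n\to\infty$. Let $\Phi=b-d$, where $b,d:\mathbb{R}\to\mathbb{R}$ are uniformly Lipschitz continuous with $b(0)=d(0)=0$. Let $u\in C^1([0,T];L^\infty((0,1)))$ be the solution of the graphon reaction--diffusion equation $\partial_t u=\mathcal{L}^{W}u+\Phi(u)$ with initial condition $u(\cdot,0)=u_0\in L^\infty((0,1))$. Let $X^n$ be the scaled random-walk/birth--death particle process on $W_n$ with rates $b,d$ and scaling parameter $\ell=\ell(n)>0$ (defined in the context). Suppose that (I) $\|X^n(0)-u_0\|_2\to0$ in probability as $n\to\infty$, and (II) $\ell=\ell(n)\to\infty$ as $n\to\infty$. Then $$\sup_{0\le t\le T}\|X^n(t)-u(t)\|_2\to0\quad\text{in probability as }n\to\infty.$$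
   Context: Standing graphon assumption (on every graph/graphon $W$): $W\in L^1((0,1)^2)$, $W(x,y)=W(y,x)\ge 0$ for all $(x,y)\in(0,1)^2$, and the degree $d_W(x):=\int_0^1 W(x,y)\,dy\le 1$ for a.e. $x\in(0,1)$. Graphs as graphons: a graph on $n$ nodes is weighted, undirected and simple, with symmetric adjacency matrix $(A^{(n)}_{ij})_{i,j=1}^n$; it is identified with the step-graphon $W_n(x,y)=A^{(n)}_{ij}$ for $(x,y)\in I_i\times I_j$, where $I_k=((k-1)/n,k/n]$ for $k\le n-1$ and $I_n=((n-1)/n,1)$. We write $W_n(k/n,i/n):=A^{(n)}_{ki}$. Diffusion operator: $\mathcal{L}^W u(x)=\int_0^1 W(x,y)\,(u(y)-u(x))\,dy$. $\Phi(u)$ denotes the pointwise composition. Cut norm: $\|V\|_\square=\sup_{\phi,\psi}\int_0^1\int_0^1 V(x,y)\phi(x)\psi(y)\,dx\,dy$, the supremum over measurable $\phi,\psi:(0,1)\to[-1,1]$. Particle process: $\vec m(t)=(m_1(t),\dots,m_n(t))$ is a càdlàg continuous-time Markov jump process on some probability space, $m_k(t)\in\{0,1,2,\dots\}$ being the number of particles on node $k$ at time $t$. With $e_i$ the $i$th standard unit vector of $\mathbb{R}^n$, its transitions are, for all $i,k\in\{1,\dots,n\}$: - $\vec m\to\vec m+e_i-e_k$ at rate $m_k\,W_n(k/n,i/n)\,n^{-1}$; - $\vec m\to\vec m+e_k$ at rate $\ell\,b(m_k/\ell)$; - $\vec m\to\vec m-e_k$ at rate $\ell\,d(m_k/\ell)$.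 Here $b,d$ are birth and death rates (so nonnegative at the values attained by the process). The scaled process is $X^n(x,t)=m_k(t)/\ell$ for $x\in I_k$, $k=1,\dots,n$; $X^n(t)$ denotes the function $X^n(\cdot,t)$ on $(0,1)$, and $\|\cdot\|_2$ is the $L^2((0,1))$ norm. *)

theory Defs
  imports "HOL-Probability.Probability"
begin

section \<open>Function spaces on the unit interval\<close>

text \<open>Elements of \<open>L\<^sup>p((0,1))\<close> and \<open>L\<^sup>1((0,1)\<^sup>2)\<close> are represented by Borel functions, and
  equality in these spaces is almost-everywhere equality.\<close>

abbreviation I01 :: "real measure" where
  "I01 \<equiv> restrict_space lborel {0<..<1}"

definition L2_norm :: "(real \<Rightarrow> real) \<Rightarrow> real" where
  "L2_norm f = sqrt (\<integral>x. (f x)\<^sup>2 \<partial>I01)"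

definition Linf_norm :: "(real \<Rightarrow> real) \<Rightarrow> ereal" where
  "Linf_norm f = esssup I01 (\<lambda>x. ereal \<bar>f x\<bar>)"

definition Linf :: "(real \<Rightarrow> real) set" where
  "Linf = {f \<in> borel_measurable I01. Linf_norm f < \<infinity>}"

text \<open>\<open>u \<in> C\<^sup>1([0,T]; L\<^sup>\<infinity>)\<close> with derivative \<open>u'\<close>, where \<open>u t\<close> is the function \<open>u(\<cdot>,t)\<close>. Derivatives
  are limits of difference quotients in the \<open>L\<^sup>\<infinity>\<close>-norm, one-sided at the end points.\<close>

definition C1_Linf :: "real \<Rightarrow> (real \<Rightarrow> real \<Rightarrow> real) \<Rightarrow> (real \<Rightarrow> real \<Rightarrow> real) \<Rightarrow> bool" where
  "C1_Linf T u u' \<longleftrightarrow>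
     (\<forall>t\<in>{0..T}. u t \<in> Linf \<and> u' t \<in> Linf) \<and>
     (\<forall>t\<in>{0..T}. ((\<lambda>s. Linf_norm (\<lambda>x. (u s x - u t x) / (s - t) - u' t x)) \<longlongrightarrow> 0)
                    (at t within {0..T})) \<and>
     (\<forall>t\<in>{0..T}. ((\<lambda>s. Linf_norm (\<lambda>x. u' s x - u' t x)) \<longlongrightarrow> 0) (at t within {0..T}))"


section \<open>Graphons\<close>

definition graphon_degree :: "(real \<Rightarrow> real \<Rightarrow> real) \<Rightarrow> real \<Rightarrow> real" where
  "graphon_degree W x = (\<integral>y. W x y \<partial>I01)"

definition graphon :: "(real \<Rightarrow> real \<Rightarrow> real) \<Rightarrow> bool" where
  "graphon W \<longleftrightarrow>
     integrable (I01 \<Otimes>\<^sub>M I01) (\<lambda>(x, y). W x y) \<and>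
     (\<forall>x\<in>{0<..<1}. \<forall>y\<in>{0<..<1}. W x y = W y x \<and> 0 \<le> W x y) \<and>
     (AE x in I01. graphon_degree W x \<le> 1)"

definition cut_norm :: "(real \<Rightarrow> real \<Rightarrow> real) \<Rightarrow> real" where
  "cut_norm V =
     (SUP (\<phi>, \<psi>) \<in> {\<phi> \<in> borel_measurable I01. \<forall>x\<in>{0<..<1}. \<phi> x \<in> {-1..1}} \<times>
                   {\<psi> \<in> borel_measurable I01. \<forall>x\<in>{0<..<1}. \<psi> x \<in> {-1..1}}.
        \<integral>y. (\<integral>x. V x y * \<phi> x * \<psi> y \<partial>I01) \<partial>I01)"

definition diffusion :: "(real \<Rightarrow> real \<Rightarrow> real) \<Rightarrow> (real \<Rightarrow> real) \<Rightarrow> real \<Rightarrow> real" where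
  "diffusion W v x = (\<integral>y. W x y * (v y - v x) \<partial>I01)"

definition rd_solution ::
  "real \<Rightarrow> (real \<Rightarrow> real \<Rightarrow> real) \<Rightarrow> (real \<Rightarrow> real) \<Rightarrow> (real \<Rightarrow> real) \<Rightarrow> (real \<Rightarrow> real \<Rightarrow> real) \<Rightarrow> bool" where
  "rd_solution T W \<Phi> u0 u \<longleftrightarrow>
     (\<exists>u'. C1_Linf T u u' \<and>
           (\<forall>t\<in>{0..T}. AE x in I01. u' t x = diffusion W (u t) x + \<Phi> (u t x))) \<and>
     (AE x in I01. u 0 x = u0 x)"


section \<open>Graphs on \<open>n\<close> nodes\<close>

text \<open>The nodes are \<open>1, \<dots>, n\<close>; only the values \<open>A i j\<close> with \<open>i, j \<in> {1..n}\<close> matter.\<close>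

definition graph_on :: "nat \<Rightarrow> (nat \<Rightarrow> nat \<Rightarrow> real) \<Rightarrow> bool" where
  "graph_on n A \<longleftrightarrow> (\<forall>i\<in>{1..n}. A i i = 0 \<and> (\<forall>j\<in>{1..n}. A i j = A j i))"

definition cell :: "nat \<Rightarrow> nat \<Rightarrow> real set" where
  "cell n k = (if k = n then {(real n - 1) / real n <..< 1}
               else {(real k - 1) / real n <.. real k / real n})"

definition step_fun :: "nat \<Rightarrow> (nat \<Rightarrow> real) \<Rightarrow> real \<Rightarrow> real" where
  "step_fun n f x = (\<Sum>k\<in>{1..n}. f k * indicator (cell n k) x)"

definition step_graphon :: "nat \<Rightarrow> (nat \<Rightarrow> nat \<Rightarrow> real) \<Rightarrow> real \<Rightarrow> real \<Rightarrow> real" where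
  "step_graphon n A x y =
     (\<Sum>i\<in>{1..n}. \<Sum>j\<in>{1..n}. A i j * indicator (cell n i) x * indicator (cell n j) y)"


section \<open>Markov jump processes\<close>

text \<open>In the following, \<open>q x y\<close> is the rate of the transition from state \<open>x\<close> to state \<open>y \<noteq> x\<close>
  (values \<open>q x x\<close> are ignored), and \<open>S\<close> is a countable state space. A state of exit rate 0 is
  absorbing.\<close>

definition exit_rate :: "'s set \<Rightarrow> ('s \<Rightarrow> 's \<Rightarrow> real) \<Rightarrow> 's \<Rightarrow> real" where
  "exit_rate S q x = (\<Sum>\<^sub>\<infinity>y\<in>S - {x}. q x y)"

definition jump_prob :: "'s set \<Rightarrow> ('s \<Rightarrow> 's \<Rightarrow> real) \<Rightarrow> 's \<Rightarrow> 's \<Rightarrow> real" where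
  "jump_prob S q x y =
     (if exit_rate S q x = 0 then (if y = x then 1 else 0)
      else (if y = x then 0 else q x y / exit_rate S q x))"

text \<open>Right-continuity with left limits, for the discrete topology on the state space.\<close>

definition cadlag_path :: "(real \<Rightarrow> 's) \<Rightarrow> bool" where
  "cadlag_path p \<longleftrightarrow>
     (\<forall>t\<ge>0. \<forall>\<^sub>F s in at_right t. p s = p t) \<and>
     (\<forall>t>0. \<exists>y. \<forall>\<^sub>F s in at_left t. p s = y)"

text \<open>The jump chain \<open>Y\<close> is a Markov chain with transition matrix \<open>jump_prob\<close>; given \<open>Y\<close>, the
  holding times \<open>\<tau> 0, \<tau> 1, \<dots>\<close> are independent, \<open>\<tau> i\<close> being exponential with parameter the exit
  rate of \<open>Y i\<close> (a.s. infinite if that rate is 0). This is expressed through the joint law of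
  \<open>(Y 0, \<dots>, Y N, \<tau> 0, \<dots>, \<tau> N)\<close>, for an arbitrary initial distribution.\<close>

definition jump_hold ::
  "'w measure \<Rightarrow> 's set \<Rightarrow> ('s \<Rightarrow> 's \<Rightarrow> real) \<Rightarrow> (nat \<Rightarrow> 'w \<Rightarrow> 's) \<Rightarrow> (nat \<Rightarrow> 'w \<Rightarrow> ereal) \<Rightarrow> bool" where
  "jump_hold M S q Y \<tau> \<longleftrightarrow>
     (\<forall>i. Y i \<in> measurable M (count_space S) \<and> \<tau> i \<in> borel_measurable M) \<and>
     (\<forall>i. \<forall>\<omega>\<in>space M. 0 \<le> \<tau> i \<omega>) \<and>
     (\<forall>N y s. (\<forall>i\<le>N. y i \<in> S \<and> 0 \<le> s i) \<longrightarrow>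
        measure M {\<omega> \<in> space M. \<forall>i\<le>N. Y i \<omega> = y i \<and> ereal (s i) < \<tau> i \<omega>} =
        measure M {\<omega> \<in> space M. Y 0 \<omega> = y 0} *
          (\<Prod>i<N. jump_prob S q (y i) (y (Suc i))) *
          (\<Prod>i\<le>N. exp (- exit_rate S q (y i) * s i)))"

definition markov_jump_process ::
  "'w measure \<Rightarrow> 's set \<Rightarrow> ('s \<Rightarrow> 's \<Rightarrow> real) \<Rightarrow> (real \<Rightarrow> 'w \<Rightarrow> 's) \<Rightarrow> bool" where
  "markov_jump_process M S q X \<longleftrightarrow>
     prob_space M \<and>
     (\<forall>t\<ge>0. X t \<in> measurable M (count_space S)) \<and>
     (\<forall>\<omega>\<in>space M. cadlag_path (\<lambda>t. X t \<omega>)) \<and>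
     (\<exists>Y \<tau>. jump_hold M S q Y \<tau> \<and>
        (AE \<omega> in M. \<forall>t\<ge>0. \<exists>k. (\<Sum>i<k. \<tau> i \<omega>) \<le> ereal t \<and> ereal t < (\<Sum>i\<le>k. \<tau> i \<omega>) \<and>
                               X t \<omega> = Y k \<omega>))"


section \<open>The particle process\<close>

text \<open>Particle configurations on the nodes \<open>1, \<dots>, n\<close>; they are \<open>undefined\<close> off the nodes.\<close>

abbreviation configs :: "nat \<Rightarrow> (nat \<Rightarrow> nat) set" where
  "configs n \<equiv> {1..n} \<rightarrow>\<^sub>E UNIV"

abbreviation unit_vec :: "nat \<Rightarrow> nat \<Rightarrow> nat" where
  "unit_vec i \<equiv> (\<lambda>j. of_bool (j = i))"

text \<open>The subtractions are on natural numbers, but they only truncate in transitions that remove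
  a particle from an empty node, and these have rate 0 if \<open>d 0 = 0\<close>. The scaling parameter is \<open>ell\<close>.\<close>

definition particle_rate ::
  "nat \<Rightarrow> (nat \<Rightarrow> nat \<Rightarrow> real) \<Rightarrow> real \<Rightarrow> (real \<Rightarrow> real) \<Rightarrow> (real \<Rightarrow> real) \<Rightarrow>
   (nat \<Rightarrow> nat) \<Rightarrow> (nat \<Rightarrow> nat) \<Rightarrow> real" where
  "particle_rate n A ell b d x y =
     (\<Sum>k\<in>{1..n}. \<Sum>i\<in>{1..n}.
        if y = (\<lambda>j. x j + unit_vec i j - unit_vec k j) then real (x k) * A k i / real n else 0) +
     (\<Sum>k\<in>{1..n}. if y = (\<lambda>j. x j + unit_vec k j) then ell * b (real (x k) / ell) else 0) +
     (\<Sum>k\<in>{1..n}. if y = (\<lambda>j. x j - unit_vec k j) then ell * d (real (x k) / ell) else 0)"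

text \<open>The birth and death rates are required to be nonnegative only at the values attained.\<close>

definition particle_process ::
  "'w measure \<Rightarrow> nat \<Rightarrow> (nat \<Rightarrow> nat \<Rightarrow> real) \<Rightarrow> real \<Rightarrow> (real \<Rightarrow> real) \<Rightarrow> (real \<Rightarrow> real) \<Rightarrow>
   (real \<Rightarrow> 'w \<Rightarrow> nat \<Rightarrow> nat) \<Rightarrow> bool" where
  "particle_process M n A ell b d m \<longleftrightarrow>
     markov_jump_process M (configs n) (particle_rate n A ell b d) m \<and>
     (AE \<omega> in M. \<forall>t\<ge>0. \<forall>k\<in>{1..n}.
        0 \<le> b (real (m t \<omega> k) / ell) \<and> 0 \<le> d (real (m t \<omega> k) / ell))"

definition scaled_process ::
  "nat \<Rightarrow> real \<Rightarrow> (real \<Rightarrow> 'w \<Rightarrow> nat \<Rightarrow> nat) \<Rightarrow> real \<Rightarrow> 'w \<Rightarrow> real \<Rightarrow> real" where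
  "scaled_process n ell m t \<omega> = step_fun n (\<lambda>k. real (m t \<omega> k) / ell)"

text \<open>Convergence to 0 in probability of random variables on possibly different probability
  spaces. Measurability is included because \<open>measure\<close> is 0 on non-measurable sets.\<close>

definition tendsto_0_in_prob :: "(nat \<Rightarrow> 'w measure) \<Rightarrow> (nat \<Rightarrow> 'w \<Rightarrow> real) \<Rightarrow> bool" where
  "tendsto_0_in_prob M Z \<longleftrightarrow>
     (\<forall>\<^sub>F n in sequentially. Z n \<in> borel_measurable (M n)) \<and>
     (\<forall>\<epsilon>>0. (\<lambda>n. measure (M n) {\<omega> \<in> space (M n). \<epsilon> < \<bar>Z n \<omega>\<bar>}) \<longlonglongrightarrow> 0)"

end

(*
  The function F(t,x) = |x/ell - u(t)|_2^2 of time and configuration satisfies a one-sided bound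
  (d/dt + generator) F <= K F + delta_n.  Indeed 2 <L^n X + Phi(X) - u', X - u> splits into the
  Dirichlet form of W_n, which is nonpositive, the Lipschitz term 2 Lip(Phi) |X - u|^2, and the
  consistency error <(L^n - L)u, X - u>.  The latter is controlled by the cut norm: its L^1 norm
  is at most 2 |u|_infinity |W_n - W|_cut and (L^n - L)u is bounded because degrees are at most 1.
  The jumps contribute a quadratic variation of order 1/ell.  Hence delta_n -> 0, and
  exp(-K t) F + delta_n (T - t) is a nonnegative supermartingale, so that Doob's maximal inequality
  bounds the supremum over [0,T] by the initial value.  The maximal inequality is proved by
  induction on the number of jumps, conditioning on the holding times before the current one.
*)
theory Submission
  imports Defs
begin

section \<open>Jump chains and their holding times\<close>

text \<open>The process is given only through the joint law of embedded chain and holding times,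
  tested on strict tails at nonnegative levels; no Markov property for a filtration is at hand.
  Conditioning is therefore done by hand: a finite path is fixed through \<open>path_event\<close>,
  past holding times enter through the sigma-algebra \<open>history\<close>, and two Dynkin
  arguments carry the product formula from tails to all Borel sets. Two obstacles shape the rest.
  Birth and death rates may be negative in states that are never attained, where an exponential law
  may make no sense; so only crossings whose states up to then lie in \<open>good\<close> are
  counted, and \<open>embedded_chain_good\<close> transfers goodness from the process to the chain.
  And the squared distance is unbounded over configurations; being nonnegative, it is handled by
  extended nonnegative integrals, and a bound uniform in the number of jumps passes to the limit
  monotonically, without stopping or moment estimates for the particle numbers. The initial
  condition holds only in probability, which is why the maximal inequality is restricted to a set
  \<open>B\<close> of initial states.\<close>

lemma all_le_split: "(\<forall>i\<le>k::nat. P i) \<longleftrightarrow> (\<forall>i<k. P i) \<and> P k"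
  by (auto simp: le_less)

lemma all_le_Suc_split: "(\<forall>i\<le>Suc k. P i) \<longleftrightarrow> (\<forall>i<k. P i) \<and> P k \<and> P (Suc k)"
  using all_le_split[of k P] by (auto simp: le_Suc_eq)

lemma exit_rate_finite_support:
  assumes "finite {z\<in>S. q x z \<noteq> 0}"
  shows "exit_rate S q x = (\<Sum>z | z \<in> S - {x} \<and> q x z \<noteq> 0. q x z)"
proof -
  have fin: "finite {z. z \<in> S - {x} \<and> q x z \<noteq> 0}"
    by (rule finite_subset[OF _ assms]) auto
  have "exit_rate S q x = (\<Sum>\<^sub>\<infinity>z\<in>{z. z \<in> S - {x} \<and> q x z \<noteq> 0}. q x z)"
    unfolding exit_rate_def by (rule infsum_cong_neutral) auto
  with fin show ?thesis by simp
qed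

lemma jump_prob_finite_support:
  assumes "finite {z\<in>S. q x z \<noteq> 0}"
  shows "finite {z\<in>S. jump_prob S q x z \<noteq> 0}"
  by (rule finite_subset[of _ "insert x {z\<in>S. q x z \<noteq> 0}"])
     (use assms in \<open>auto simp: jump_prob_def split: if_splits\<close>)

text \<open>Division by a nonzero exit rate normalises the row whatever the signs of the rates, and
  an absorbing state has a point mass. This makes the lemma available in all states, not only the
  attained ones.\<close>

lemma sum_jump_prob:
  assumes "x \<in> S" and fin: "finite {z\<in>S. q x z \<noteq> 0}"
  shows "(\<Sum>z | z \<in> S \<and> jump_prob S q x z \<noteq> 0. jump_prob S q x z) = 1"
proof (cases "exit_rate S q x = 0")
  case True
  then have "{z. z \<in> S \<and> jump_prob S q x z \<noteq> 0} = {x}"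
    using assms by (auto simp: jump_prob_def)
  with True show ?thesis by (simp add: jump_prob_def)
next
  case False
  have "{z. z \<in> S \<and> jump_prob S q x z \<noteq> 0} = {z. z \<in> S - {x} \<and> q x z \<noteq> 0}"
    using False by (auto simp: jump_prob_def)
  moreover have "(\<Sum>z | z \<in> S - {x} \<and> q x z \<noteq> 0. jump_prob S q x z)
      = (\<Sum>z | z \<in> S - {x} \<and> q x z \<noteq> 0. q x z / exit_rate S q x)"
    using False by (intro sum.cong) (auto simp: jump_prob_def)
  ultimately show ?thesis
    using False exit_rate_finite_support[of S q x, OF fin] by (simp flip: sum_divide_distrib)
qed

text \<open>Rates carry no sign condition here, since they may be negative in unattained states;
  nonnegativity is requested lemma by lemma where a law of a holding time is formed.\<close>

locale jump_chain = prob_space M for M :: "'w measure" +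
  fixes S :: "'s set" and q :: "'s \<Rightarrow> 's \<Rightarrow> real"
    and Y :: "nat \<Rightarrow> 'w \<Rightarrow> 's" and \<tau> :: "nat \<Rightarrow> 'w \<Rightarrow> ereal"
  assumes jump_hold: "jump_hold M S q Y \<tau>"
    and countable_S: "countable S"
    and finite_support: "\<And>x. x \<in> S \<Longrightarrow> finite {z\<in>S. q x z \<noteq> 0}"
begin

definition path_event :: "nat \<Rightarrow> (nat \<Rightarrow> 's) \<Rightarrow> 'w set" where
  "path_event k y = {\<omega>\<in>space M. \<forall>i\<le>k. Y i \<omega> = y i}"

definition jump_time :: "nat \<Rightarrow> 'w \<Rightarrow> ereal" where
  "jump_time k \<omega> = (\<Sum>i<k. \<tau> i \<omega>)"

definition path_weight :: "nat \<Rightarrow> (nat \<Rightarrow> 's) \<Rightarrow> real" where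
  "path_weight N y = measure M {\<omega> \<in> space M. Y 0 \<omega> = y 0} *
     (\<Prod>i<N. jump_prob S q (y i) (y (Suc i)))"

text \<open>Only holding times generate this sigma-algebra; the states are fixed separately by
  \<open>path_event\<close>. Joint tails are chosen as generators because they are what the joint
  law evaluates, and they are closed under intersection.\<close>

definition history :: "nat \<Rightarrow> 'w measure" where
  "history k = sigma (space M) (range (\<lambda>s. {\<omega>\<in>space M. \<forall>i<k. ereal (s i) < \<tau> i \<omega>}))"

lemma Y_measurable [measurable]: "Y i \<in> measurable M (count_space S)"
  and \<tau>_measurable [measurable]: "\<tau> i \<in> borel_measurable M"
  and \<tau>_nonneg: "\<omega> \<in> space M \<Longrightarrow> 0 \<le> \<tau> i \<omega>"
  using jump_hold by (auto simp: jump_hold_def)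

lemma Y_in_S: "\<omega> \<in> space M \<Longrightarrow> Y i \<omega> \<in> S"
  using measurable_space[OF Y_measurable] by simp

lemma Y_eq_measurable [measurable]: "Measurable.pred M (\<lambda>\<omega>. Y i \<omega> = z)"
proof -
  have "{\<omega>\<in>space M. Y i \<omega> = z} = Y i -` ({z} \<inter> S) \<inter> space M"
    using Y_in_S by auto
  also have "\<dots> \<in> sets M" by measurable
  finally show ?thesis by (simp add: pred_def)
qed

lemma path_event_sets [measurable]: "path_event k y \<in> sets M"
  unfolding path_event_def by measurable

lemma jump_time_measurable [measurable]: "jump_time k \<in> borel_measurable M"
  unfolding jump_time_def[abs_def] by measurable

lemma jump_hold_formula:
  assumes "\<And>i. i \<le> N \<Longrightarrow> y i \<in> S" "\<And>i. i \<le> N \<Longrightarrow> 0 \<le> s i"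
  shows "prob {\<omega> \<in> space M. \<forall>i\<le>N. Y i \<omega> = y i \<and> ereal (s i) < \<tau> i \<omega>} =
     path_weight N y * (\<Prod>i\<le>N. exp (- exit_rate S q (y i) * s i))"
  using jump_hold assms unfolding jump_hold_def path_weight_def by blast

lemma prob_path_pos:
  assumes "\<And>i. i \<le> N \<Longrightarrow> y i \<in> S"
  shows "prob {\<omega> \<in> space M. \<forall>i\<le>N. Y i \<omega> = y i \<and> 0 < \<tau> i \<omega>} = path_weight N y"
  using jump_hold_formula[of N y "\<lambda>_. 0"] assms by (simp add: zero_ereal_def)

text \<open>Since the rows of \<open>jump_prob\<close> sum to 1, summing the joint law over the next state loses no mass,
  which leaves none for a vanishing next holding time.\<close>

lemma holding_time_pos_step:
  assumes y: "\<And>i. i \<le> N \<Longrightarrow> y i \<in> S"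
  shows "AE \<omega> in M. (\<forall>i\<le>N. Y i \<omega> = y i \<and> 0 < \<tau> i \<omega>) \<longrightarrow> 0 < \<tau> (Suc N) \<omega>"
proof -
  let ?E = "{\<omega> \<in> space M. \<forall>i\<le>N. Y i \<omega> = y i \<and> 0 < \<tau> i \<omega>}"
  let ?y = "\<lambda>z. y(Suc N := z)"
  let ?F = "\<lambda>z. {\<omega> \<in> space M. \<forall>i\<le>Suc N. Y i \<omega> = ?y z i \<and> 0 < \<tau> i \<omega>}"
  let ?Z = "{z\<in>S. jump_prob S q (y N) z \<noteq> 0}"
  have fin: "finite ?Z" using y by (intro jump_prob_finite_support finite_support) auto
  have F: "prob (?F z) = path_weight N y * jump_prob S q (y N) z" if "z \<in> S" for z
  proof -
    have "prob (?F z) = path_weight (Suc N) (?y z)"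
      using y that by (intro prob_path_pos) auto
    also have "\<dots> = path_weight N y * jump_prob S q (y N) z"
      by (auto simp: path_weight_def intro!: arg_cong2[where f="(*)"] prod.cong)
    finally show ?thesis .
  qed
  have "prob (\<Union>z\<in>?Z. ?F z) = (\<Sum>z\<in>?Z. prob (?F z))"
  proof (rule finite_measure_finite_Union)
    show "disjoint_family_on ?F ?Z" by (auto simp: disjoint_family_on_def)
    show "?F ` ?Z \<subseteq> events" by (intro image_subsetI) measurable
  qed (rule fin)
  also have "\<dots> = path_weight N y * (\<Sum>z\<in>?Z. jump_prob S q (y N) z)"
    unfolding sum_distrib_left by (intro sum.cong refl F) auto
  also have "\<dots> = prob ?E"
    using prob_path_pos[of N y] y sum_jump_prob[of "y N" S q] finite_support by simp
  finally have "prob (\<Union>z\<in>?Z. ?F z) = prob ?E" .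
  moreover have sub: "(\<Union>z\<in>?Z. ?F z) \<subseteq> ?E" by auto
  moreover have ms: "(\<Union>z\<in>?Z. ?F z) \<in> events" using fin by (intro sets.finite_UN) measurable
  ultimately have "prob (?E - (\<Union>z\<in>?Z. ?F z)) = 0"
    by (subst finite_measure_Diff) auto
  then have "AE \<omega> in M. \<omega> \<notin> ?E - (\<Union>z\<in>?Z. ?F z)"
    using ms by (intro AE_not_in) (auto simp: null_sets_def emeasure_eq_measure)
  with AE_space show ?thesis by eventually_elim auto
qed

text \<open>The joint law speaks about tails at nonnegative levels, so an atom of a holding time at
  0 has to be excluded. There are countably many finite paths, so the statements along fixed paths
  share one null set; outside it, strong induction on the index applies the step to the actual
  path.\<close>

lemma holding_times_pos: "AE \<omega> in M. \<forall>i. 0 < \<tau> i \<omega>"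
proof -
  have 0: "AE \<omega> in M. Y 0 \<omega> = y \<longrightarrow> 0 < \<tau> 0 \<omega>" if "y \<in> S" for y
  proof -
    have "prob {\<omega>\<in>space M. Y 0 \<omega> = y \<and> 0 < \<tau> 0 \<omega>} = prob {\<omega>\<in>space M. Y 0 \<omega> = y}"
      using prob_path_pos[of 0 "\<lambda>_. y"] that by (simp add: path_weight_def)
    then have "prob ({\<omega>\<in>space M. Y 0 \<omega> = y} - {\<omega>\<in>space M. Y 0 \<omega> = y \<and> 0 < \<tau> 0 \<omega>}) = 0"
      by (subst finite_measure_Diff) auto
    then have "AE \<omega> in M. \<omega> \<notin> {\<omega>\<in>space M. Y 0 \<omega> = y} - {\<omega>\<in>space M. Y 0 \<omega> = y \<and> 0 < \<tau> 0 \<omega>}"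
      by (intro AE_not_in) (auto simp: null_sets_def emeasure_eq_measure)
    with AE_space show ?thesis by eventually_elim auto
  qed
  have "AE \<omega> in M. \<forall>y\<in>S. Y 0 \<omega> = y \<longrightarrow> 0 < \<tau> 0 \<omega>"
    using 0 countable_S by (subst AE_ball_countable) auto
  moreover have "AE \<omega> in M. \<forall>N. \<forall>y\<in>{..N} \<rightarrow>\<^sub>E S.
      (\<forall>i\<le>N. Y i \<omega> = y i \<and> 0 < \<tau> i \<omega>) \<longrightarrow> 0 < \<tau> (Suc N) \<omega>"
    unfolding AE_all_countable
  proof
    fix N :: nat
    have "countable ({..N} \<rightarrow>\<^sub>E S)" using countable_S by (intro countable_PiE) auto
    then show "AE \<omega> in M. \<forall>y\<in>{..N} \<rightarrow>\<^sub>E S.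
      (\<forall>i\<le>N. Y i \<omega> = y i \<and> 0 < \<tau> i \<omega>) \<longrightarrow> 0 < \<tau> (Suc N) \<omega>"
      by (subst AE_ball_countable) (auto intro!: holding_time_pos_step)
  qed
  ultimately show ?thesis
    using AE_space
  proof eventually_elim
    case (elim \<omega>)
    show ?case
    proof
      fix i show "0 < \<tau> i \<omega>"
      proof (induction i rule: less_induct)
        case (less i)
        show ?case
        proof (cases i)
          case 0 then show ?thesis using elim Y_in_S by auto
        next
          case (Suc N)
          have "restrict (\<lambda>i. Y i \<omega>) {..N} \<in> {..N} \<rightarrow>\<^sub>E S"
            using elim Y_in_S by auto
          moreover have "\<forall>i\<le>N. Y i \<omega> = restrict (\<lambda>i. Y i \<omega>) {..N} i \<and> 0 < \<tau> i \<omega>"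
            using less Suc by auto
          ultimately show ?thesis using elim(2) Suc by blast
        qed
      qed
    qed
  qed
qed

text \<open>Extends the joint law to negative levels, which by positivity of the holding times act
  like level 0. A negative level then serves to leave one coordinate unconstrained.\<close>

lemma cylinder_prob:
  assumes "\<And>i. i \<le> N \<Longrightarrow> y i \<in> S"
  shows "prob {\<omega> \<in> space M. \<forall>i\<le>N. Y i \<omega> = y i \<and> ereal (s i) < \<tau> i \<omega>} =
     path_weight N y * (\<Prod>i\<le>N. exp (- exit_rate S q (y i) * max 0 (s i)))"
proof -
  have "prob {\<omega> \<in> space M. \<forall>i\<le>N. Y i \<omega> = y i \<and> ereal (s i) < \<tau> i \<omega>}
      = prob {\<omega> \<in> space M. \<forall>i\<le>N. Y i \<omega> = y i \<and> ereal (max 0 (s i)) < \<tau> i \<omega>}"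
  proof (rule measure_eq_AE)
    have "ereal (s i) < \<tau> i \<omega> \<longleftrightarrow> ereal (max 0 (s i)) < \<tau> i \<omega>" if "0 < \<tau> i \<omega>" for i \<omega>
      using that by (cases "\<tau> i \<omega>") (auto simp: max_def)
    then show "AE \<omega> in M. \<omega> \<in> {\<omega> \<in> space M. \<forall>i\<le>N. Y i \<omega> = y i \<and> ereal (s i) < \<tau> i \<omega>}
      \<longleftrightarrow> \<omega> \<in> {\<omega> \<in> space M. \<forall>i\<le>N. Y i \<omega> = y i \<and> ereal (max 0 (s i)) < \<tau> i \<omega>}"
      using holding_times_pos by (auto elim!: eventually_mono)
  qed measurable
  with jump_hold_formula[of N y "\<lambda>i. max 0 (s i)"] assms show ?thesis by simp
qed

section \<open>The filtration generated by the holding times\<close>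

lemma history_gen_closed:
  "range (\<lambda>s. {\<omega>\<in>space M. \<forall>i<k. ereal (s i) < \<tau> i \<omega>}) \<subseteq> Pow (space M)"
  by auto

lemma space_history [simp]: "space (history k) = space M"
  by (simp add: history_def space_measure_of_conv)

lemma sets_history: "sets (history k) =
    sigma_sets (space M) (range (\<lambda>s. {\<omega>\<in>space M. \<forall>i<k. ereal (s i) < \<tau> i \<omega>}))"
  unfolding history_def by (rule sets_measure_of[OF history_gen_closed])

lemma history_subset: "A \<in> sets (history k) \<Longrightarrow> A \<in> sets M"
  unfolding sets_history by (erule sets.sigma_sets_subset[THEN subsetD, rotated]) (auto)

lemma history_Suc:
  assumes "A \<in> sets (history k)"
  shows "A \<in> sets (history (Suc k))"
proof -
  let ?G = "\<lambda>k. range (\<lambda>s. {\<omega>\<in>space M. \<forall>i<k. ereal (s i) < \<tau> i \<omega>})"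
  have "?G k \<subseteq> ?G (Suc k)"
  proof safe
    fix s :: "nat \<Rightarrow> real"
    \<comment> \<open>Level -1 lies below every holding time, so a generator of the smaller
      sigma-algebra is one of the larger with coordinate \<open>k\<close> left free.\<close>
    have pos: "ereal (-1) < \<tau> k \<omega>" if "\<omega> \<in> space M" for \<omega>
      using \<tau>_nonneg[OF that, of k] by (rule less_le_trans[rotated]) simp
    have "{\<omega>\<in>space M. \<forall>i<k. ereal (s i) < \<tau> i \<omega>} =
        {\<omega>\<in>space M. \<forall>i<Suc k. ereal ((s(k := -1)) i) < \<tau> i \<omega>}"
      using pos by (auto simp: less_Suc_eq)
    then show "{\<omega>\<in>space M. \<forall>i<k. ereal (s i) < \<tau> i \<omega>} \<in> ?G (Suc k)" by blast
  qed
  then show ?thesis using assms unfolding sets_history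
    by (meson sigma_sets_mono' subsetD)
qed

lemma \<tau>_history: 
  assumes "i < k"
  shows "\<tau> i \<in> borel_measurable (history k)"
proof (rule borel_measurableI_greater)
  fix a :: ereal
  show "{\<omega>\<in>space (history k). a < \<tau> i \<omega>} \<in> sets (history k)"
  proof (cases a)
    case (real r)
    have pos: "ereal (-1) < \<tau> j \<omega>" if "\<omega> \<in> space M" for \<omega> j
      using \<tau>_nonneg[OF that, of j] by (rule less_le_trans[rotated]) simp
    have "{\<omega>\<in>space (history k). a < \<tau> i \<omega>} = 
       {\<omega>\<in>space M. \<forall>j<k. ereal (if j = i then r else -1) < \<tau> j \<omega>}"
      using assms pos real by auto
    then show ?thesis unfolding sets_history by (auto intro!: sigma_sets.Basic)
  next
    case MInf
    then have "{\<omega>\<in>space (history k). a < \<tau> i \<omega>} = space (history k)"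
      using \<tau>_nonneg by (force simp: less_le_trans)
    then show ?thesis by (metis sets.top)
  qed auto
qed

lemma jump_time_history: "j \<le> k \<Longrightarrow> jump_time j \<in> borel_measurable (history k)"
  unfolding jump_time_def[abs_def] 
  by (intro borel_measurable_ereal_sum \<tau>_history) auto

end

text \<open>The law of a holding time with exit rate \<open>c\<close>; it is infinite if \<open>c = 0\<close>.\<close>

definition hold_law :: "real \<Rightarrow> ereal measure" where
  "hold_law c = (if c = 0 then return borel \<infinity>
     else distr (density lborel (exponential_density c)) borel ereal)"

lemma sets_hold_law [simp, measurable_cong]: "sets (hold_law c) = sets borel"
  by (simp add: hold_law_def)

lemma space_hold_law [simp]: "space (hold_law c) = UNIV"
  by (simp add: hold_law_def)

lemma prob_space_hold_law: "0 \<le> c \<Longrightarrow> prob_space (hold_law c)"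
  unfolding hold_law_def
  by (auto intro!: prob_space_return prob_space.prob_space_distr prob_space_exponential_density)

text \<open>At \<open>c = 0\<close> the formula gives 1, the mass that the point at infinity puts on
  every tail above a real level. The truncation of \<open>s\<close> matches that in
  \<open>cylinder_prob\<close>.\<close>

lemma measure_hold_law_greater:
  assumes "0 \<le> c"
  shows "measure (hold_law c) {ereal s<..} = exp (- c * max 0 s)"
proof (cases "c = 0")
  case True
  then show ?thesis by (simp add: hold_law_def measure_return)
next
  case False
  with assms have c: "0 < c" by simp
  interpret D: prob_space "density lborel (exponential_density c)"
    by (rule prob_space_exponential_density[OF c])
  have dist: "distributed (density lborel (exponential_density c)) lborel (\<lambda>x. x) (exponential_density c)"
    by (simp add: distributed_def distr_id2 sets_eq_imp_space_eq)
  have eq: "measure (hold_law c) {ereal s<..} = D.prob {x \<in> space (density lborel (exponential_density c)). s < x}" for s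
    using False by (simp add: hold_law_def measure_distr vimage_def)
  show ?thesis
  proof (cases "0 \<le> s")
    case True
    then show ?thesis using D.exponential_distributedD_gt[OF dist True c] eq[of s]
      by (simp add: max_def mult.commute)
  next
    case False
    have "D.prob {x \<in> space (density lborel (exponential_density c)). 0 < x}
        \<le> D.prob {x \<in> space (density lborel (exponential_density c)). s < x}"
      using False by (intro D.finite_measure_mono) auto
    moreover have "D.prob {x \<in> space (density lborel (exponential_density c)). 0 < x} = 1"
      using D.exponential_distributedD_gt[OF dist _ c, of 0] by simp
    ultimately have "measure (hold_law c) {ereal s<..} = 1"
      unfolding eq by (intro antisym[OF D.prob_le_1]) simp
    with False show ?thesis by (simp add: max_def)
  qed
qed

section \<open>One-step conditioning on the path and the past holding times\<close>

context jump_chain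
begin

lemma Int_stable_history_gen: "Int_stable (range (\<lambda>s. {\<omega>\<in>space M. \<forall>i<k. ereal (s i) < \<tau> i \<omega>}))"
proof (rule Int_stableI_image)
  fix s s' :: "nat \<Rightarrow> real"
  have *: "ereal (max a b) < x \<longleftrightarrow> ereal a < x \<and> ereal b < x" for a b x
    by (cases x; cases "a \<le> b") (auto simp: max_def)
  have "{\<omega>\<in>space M. \<forall>i<k. ereal (s i) < \<tau> i \<omega>} \<inter> {\<omega>\<in>space M. \<forall>i<k. ereal (s' i) < \<tau> i \<omega>} =
     {\<omega>\<in>space M. \<forall>i<k. ereal (max (s i) (s' i)) < \<tau> i \<omega>}"
    unfolding * by blast
  then show "\<exists>t\<in>UNIV. {\<omega>\<in>space M. \<forall>i<k. ereal (s i) < \<tau> i \<omega>} \<inter> {\<omega>\<in>space M. \<forall>i<k. ereal (s' i) < \<tau> i \<omega>} =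
     {\<omega>\<in>space M. \<forall>i<k. ereal (t i) < \<tau> i \<omega>}"
    by (rule bexI[where x="\<lambda>i. max (s i) (s' i)"]) simp
qed

lemma neg_less_\<tau>:
  assumes "\<omega> \<in> space M"
  shows "ereal (-1) < \<tau> j \<omega>"
  using \<tau>_nonneg[OF assms, of j] by (rule less_le_trans[rotated]) simp

text \<open>On generating tails both sides are cylinder probabilities, and one more stage multiplies
  the joint law by the transition probability and by the tail of the holding time in state
  \<open>y k\<close>. A Dynkin argument extends this to all past events \<open>A\<close>.\<close>

lemma step_tail:
  assumes A: "A \<in> sets (history k)" and y: "\<And>i. i \<le> k \<Longrightarrow> y i \<in> S" and z: "z \<in> S"
  shows "prob (A \<inter> path_event k y \<inter> {\<omega>\<in>space M. ereal s < \<tau> k \<omega> \<and> Y (Suc k) \<omega> = z}) =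
    prob (A \<inter> path_event k y) * (jump_prob S q (y k) z * exp (- exit_rate S q (y k) * max 0 s))"
    (is "prob (_ \<inter> _ \<inter> ?E) = _ * ?c")
proof -
  have basic: "prob ({\<omega>\<in>space M. \<forall>i<k. ereal (r i) < \<tau> i \<omega>} \<inter> path_event k y \<inter> ?E)
      = prob ({\<omega>\<in>space M. \<forall>i<k. ereal (r i) < \<tau> i \<omega>} \<inter> path_event k y) * ?c" for r
  proof -
    let ?y = "y(Suc k := z)"
    \<comment> \<open>Coordinate \<open>k\<close> gets the new level. Coordinate
      \<open>Suc k\<close> appears because the joint law pairs every state with a holding time;
      level -1 leaves it free.\<close>
    let ?r = "\<lambda>i. if i < k then r i else if i = k then s else -1"
    let ?r' = "\<lambda>i. if i < k then r i else -1"
    have "{\<omega>\<in>space M. \<forall>i<k. ereal (r i) < \<tau> i \<omega>} \<inter> path_event k y \<inter> ?E =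
      {\<omega> \<in> space M. \<forall>i\<le>Suc k. Y i \<omega> = ?y i \<and> ereal (?r i) < \<tau> i \<omega>}"
      unfolding path_event_def all_le_Suc_split all_le_split using neg_less_\<tau>[of _ "Suc k"] by auto
    then have 1: "prob ({\<omega>\<in>space M. \<forall>i<k. ereal (r i) < \<tau> i \<omega>} \<inter> path_event k y \<inter> ?E) =
      path_weight (Suc k) ?y * (\<Prod>i\<le>Suc k. exp (- exit_rate S q (?y i) * max 0 (?r i)))"
      using cylinder_prob[of "Suc k" ?y ?r] y z by auto
    have "{\<omega>\<in>space M. \<forall>i<k. ereal (r i) < \<tau> i \<omega>} \<inter> path_event k y =
      {\<omega> \<in> space M. \<forall>i\<le>k. Y i \<omega> = y i \<and> ereal (?r' i) < \<tau> i \<omega>}"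
      unfolding path_event_def all_le_split using neg_less_\<tau>[of _ k] by auto
    then have 2: "prob ({\<omega>\<in>space M. \<forall>i<k. ereal (r i) < \<tau> i \<omega>} \<inter> path_event k y) =
      path_weight k y * (\<Prod>i\<le>k. exp (- exit_rate S q (y i) * max 0 (?r' i)))"
      using cylinder_prob[of k y ?r'] y by auto
    have 3: "path_weight (Suc k) ?y = path_weight k y * jump_prob S q (y k) z"
      by (auto simp: path_weight_def intro!: arg_cong2[where f="(*)"] prod.cong)
    have 4: "(\<Prod>i\<le>Suc k. exp (- exit_rate S q (?y i) * max 0 (?r i))) =
      (\<Prod>i<k. exp (- exit_rate S q (y i) * max 0 (r i))) * exp (- exit_rate S q (y k) * max 0 s)"
      by (simp add: lessThan_Suc_atMost[symmetric])
    have 5: "(\<Prod>i\<le>k. exp (- exit_rate S q (y i) * max 0 (?r' i))) =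
      (\<Prod>i<k. exp (- exit_rate S q (y i) * max 0 (r i)))"
      by (simp add: lessThan_Suc_atMost[symmetric])
    show ?thesis unfolding 1 2 3 4 5 by simp
  qed
  have E: "?E \<in> events" by measurable
  note E[measurable]
  \<comment> \<open>The total mass, from which the complement step of the induction
    subtracts.\<close>
  have whole: "prob (path_event k y \<inter> ?E) = prob (path_event k y) * ?c"
  proof -
    have "{\<omega>\<in>space M. \<forall>i<k. ereal ((\<lambda>_. -1) i) < \<tau> i \<omega>} = space M" using neg_less_\<tau> by auto
    then show ?thesis using basic[of "\<lambda>_. -1"] by (simp add: path_event_def Int_def)
  qed
  note basic_prob = basic
  from Int_stable_history_gen history_gen_closed A[unfolded sets_history] show ?thesis
  proof (induction rule: sigma_sets_induct_disjoint)
    case (basic A)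
    then obtain r where "A = {\<omega>\<in>space M. \<forall>i<k. ereal (r i) < \<tau> i \<omega>}" by blast
    then show ?case using basic_prob[of r] by simp
  next
    case empty then show ?case by simp
  next
    case (compl A)
    then have A[measurable]: "A \<in> events" using history_subset unfolding sets_history by auto
    have "(space M - A) \<inter> path_event k y \<inter> ?E = (path_event k y \<inter> ?E) - (A \<inter> path_event k y \<inter> ?E)"
      "(space M - A) \<inter> path_event k y = path_event k y - (A \<inter> path_event k y)"
      by (auto simp: path_event_def)
    moreover have "prob (path_event k y \<inter> ?E - A \<inter> path_event k y \<inter> ?E) = prob (path_event k y \<inter> ?E) - prob (A \<inter> path_event k y \<inter> ?E)"
      by (rule finite_measure_Diff) auto
    moreover have "prob (path_event k y - A \<inter> path_event k y) = prob (path_event k y) - prob (A \<inter> path_event k y)"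
      by (rule finite_measure_Diff) auto
    ultimately show ?case using compl(2) whole by (simp only: left_diff_distrib)
  next
    case (union B)
    then have B[measurable]: "B i \<in> events" for i using history_subset unfolding sets_history by auto
    have s1: "(\<lambda>i. prob (B i \<inter> path_event k y \<inter> ?E)) sums prob (\<Union>i. B i \<inter> path_event k y \<inter> ?E)"
      using union(1) by (intro finite_measure_UNION) (auto simp: disjoint_family_on_def)
    have "(\<lambda>i. prob (B i \<inter> path_event k y)) sums prob (\<Union>i. B i \<inter> path_event k y)"
      using union(1) by (intro finite_measure_UNION) (auto simp: disjoint_family_on_def)
    then have s2: "(\<lambda>i. prob (B i \<inter> path_event k y) * ?c) sums (prob (\<Union>i. B i \<inter> path_event k y) * ?c)"
      by (rule sums_mult2)
    have e1: "(\<lambda>i. prob (B i \<inter> path_event k y \<inter> ?E)) = (\<lambda>i. prob (B i \<inter> path_event k y) * ?c)"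
      by (rule ext) (rule union(3))
    have e2: "(\<Union>i. B i) \<inter> path_event k y \<inter> ?E = (\<Union>i. B i \<inter> path_event k y \<inter> ?E)"
      and e3: "(\<Union>i. B i) \<inter> path_event k y = (\<Union>i. B i \<inter> path_event k y)" by blast+
    show ?case by (subst e2, subst e3, rule sums_unique2[OF s1[unfolded e1] s2])
  qed
qed

text \<open>A second Dynkin argument, now in the set \<open>F\<close>: open upper rays generate the
  Borel sets of the extended reals, and \<open>step_tail\<close> handles the rays with real end
  point.\<close>

lemma step_prob:
  assumes A: "A \<in> sets (history k)" and y: "\<And>i. i \<le> k \<Longrightarrow> y i \<in> S" and z: "z \<in> S"
    and c: "0 \<le> exit_rate S q (y k)" and F: "F \<in> sets borel"
  shows "prob (A \<inter> path_event k y \<inter> {\<omega>\<in>space M. \<tau> k \<omega> \<in> F \<and> Y (Suc k) \<omega> = z}) =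
    prob (A \<inter> path_event k y) * jump_prob S q (y k) z * measure (hold_law (exit_rate S q (y k))) F"
    (is "prob (?B \<inter> ?E F) = ?p * measure ?H F")
proof -
  interpret H: prob_space ?H by (rule prob_space_hold_law[OF c])
  have A'[measurable]: "A \<in> events" by (rule history_subset[OF A])
  have real: "prob (?B \<inter> ?E {ereal s<..}) = ?p * measure ?H {ereal s<..}" for s
    using step_tail[of A k y z s, OF A y z] measure_hold_law_greater[OF c, of s] by simp
  have [measurable]: "?E F \<in> events" if "F \<in> sets borel" for F
    using that by measurable
  have whole: "prob (?B \<inter> ?E UNIV) = ?p"
  proof -
    have "?E {ereal (-1)<..} = ?E UNIV" using neg_less_\<tau> by auto
    then show ?thesis using real[of "-1"] measure_hold_law_greater[OF c, of "-1"] by simp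
  qed
  have "Int_stable (range greaterThan :: ereal set set)"
  proof (rule Int_stableI_image)
    fix i j :: ereal
    have "{i<..} \<inter> {j<..} = {max i j<..}" by auto
    then show "\<exists>k\<in>UNIV. {i<..} \<inter> {j<..} = {k<..}" by blast
  qed
  moreover have "range greaterThan \<subseteq> Pow (UNIV :: ereal set)" by simp
  moreover from F have "F \<in> sigma_sets UNIV (range greaterThan)" by (subst (asm) borel_Ioi) simp
  ultimately show ?thesis
  proof (induction rule: sigma_sets_induct_disjoint)
    case (basic F)
    then obtain a where F: "F = {a<..}" by auto
    show ?case
    proof (cases a)
      case (real r) then show ?thesis using \<open>\<And>s. prob (?B \<inter> ?E {ereal s<..}) = _\<close> F by simp
    next
      case PInf
      then have "F = {}" using F by auto
      then show ?thesis by simp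
    next
      \<comment> \<open>Both sides carry full mass here: holding times are nonnegative, and the law
        already puts mass 1 above level -1.\<close>
      case MInf
      then have "?E F = ?E UNIV" using F \<tau>_nonneg by (force simp: less_le_trans)
      moreover have "measure ?H {ereal (-1)<..} \<le> measure ?H F"
        using F MInf by (intro H.finite_measure_mono) auto
      then have "measure ?H F = 1" using measure_hold_law_greater[OF c, of "-1"] H.prob_le_1[of F] by simp
      ultimately show ?thesis using whole by simp
    qed
  next
    case (compl F)
    then have F[measurable]: "F \<in> sets borel" by (simp add: borel_Ioi)
    have "?B \<inter> ?E (UNIV - F) = (?B \<inter> ?E UNIV) - (?B \<inter> ?E F)" by auto
    moreover have "measure ?H (UNIV - F) = 1 - measure ?H F"
      using H.prob_compl[of F] by simp
    moreover have "prob ((?B \<inter> ?E UNIV) - (?B \<inter> ?E F)) = prob (?B \<inter> ?E UNIV) - prob (?B \<inter> ?E F)"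
      by (rule finite_measure_Diff) auto
    ultimately show ?case using compl whole by (simp add: right_diff_distrib)
  next
    case (union B)
    then have B[measurable]: "B i \<in> sets borel" for i by (auto simp: borel_Ioi)
    have s1: "(\<lambda>i. prob (?B \<inter> ?E (B i))) sums prob (\<Union>i. ?B \<inter> ?E (B i))"
      using union(1) by (intro finite_measure_UNION) (auto simp: disjoint_family_on_def)
    have e2: "?B \<inter> ?E (\<Union>i. B i) = (\<Union>i. ?B \<inter> ?E (B i))" by blast
    have "(\<lambda>i. measure ?H (B i)) sums measure ?H (\<Union>i. B i)"
      using union(1) by (intro H.finite_measure_UNION) auto
    then have s2: "(\<lambda>i. ?p * measure ?H (B i)) sums (?p * measure ?H (\<Union>i. B i))"
      by (rule sums_mult)
    have e1: "(\<lambda>i. prob (?B \<inter> ?E (B i))) = (\<lambda>i. ?p * measure ?H (B i))"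
      by (rule ext) (rule union(3))
    show ?case unfolding e2 by (rule sums_unique2[OF s1[unfolded e1] s2])
  qed simp
qed

text \<open>Given path and past, the next holding time is independent of the current jump time. The
  two joint measures agree on rectangles by \<open>step_prob\<close>, hence are equal, and Tonelli
  integrates out the holding time.\<close>

lemma step_nn_integral:
  assumes A: "A \<in> sets (history k)" and y: "\<And>i. i \<le> k \<Longrightarrow> y i \<in> S" and z: "z \<in> S"
    and c: "0 \<le> exit_rate S q (y k)" and p: "0 \<le> jump_prob S q (y k) z"
    and f[measurable]: "f \<in> borel_measurable (borel \<Otimes>\<^sub>M borel)"
  shows "(\<integral>\<^sup>+\<omega>\<in>A \<inter> path_event k y \<inter> {\<omega>\<in>space M. Y (Suc k) \<omega> = z}. f (jump_time k \<omega>, \<tau> k \<omega>) \<partial>M) =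
     (\<integral>\<^sup>+\<omega>\<in>A \<inter> path_event k y. ennreal (jump_prob S q (y k) z) *
        (\<integral>\<^sup>+r. f (jump_time k \<omega>, r) \<partial>hold_law (exit_rate S q (y k))) \<partial>M)"
proof -
  let ?H = "hold_law (exit_rate S q (y k))" and ?B = "A \<inter> path_event k y" and ?p = "jump_prob S q (y k) z"
  let ?Z = "{\<omega>\<in>space M. Y (Suc k) \<omega> = z}"
  have A'[measurable]: "A \<in> events" by (rule history_subset[OF A])
  interpret H: prob_space ?H by (rule prob_space_hold_law[OF c])
  \<comment> \<open>Both measures are unnormalised: \<open>\<mu>\<close> is the law of the jump time
    on the past event, weighted by the transition probability, and \<open>\<nu>\<close> the joint
    law with the holding time on the event that \<open>z\<close> comes next.\<close>
  define \<mu> where "\<mu> = distr (density M (\<lambda>\<omega>. ennreal ?p * indicator ?B \<omega>)) borel (jump_time k)"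
  define \<nu> where "\<nu> = distr (density M (indicator (?B \<inter> ?Z))) (borel \<Otimes>\<^sub>M borel) (\<lambda>\<omega>. (jump_time k \<omega>, \<tau> k \<omega>))"
  have em_\<mu>: "emeasure \<mu> E = ennreal ?p * emeasure M ({\<omega>\<in>space M. jump_time k \<omega> \<in> E} \<inter> ?B)" if [measurable]: "E \<in> sets borel" for E
  proof -
    have "emeasure \<mu> E = (\<integral>\<^sup>+\<omega>. ennreal ?p * indicator ?B \<omega> * indicator (jump_time k -` E \<inter> space M) \<omega> \<partial>M)"
      unfolding \<mu>_def by (subst emeasure_distr) (auto simp: emeasure_density)
    also have "\<dots> = (\<integral>\<^sup>+\<omega>. ennreal ?p * indicator ({\<omega>\<in>space M. jump_time k \<omega> \<in> E} \<inter> ?B) \<omega> \<partial>M)"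
      by (intro nn_integral_cong) (auto simp: indicator_def)
    finally show ?thesis by (simp add: nn_integral_cmult)
  qed
  interpret \<mu>: finite_measure \<mu>
    by (rule finite_measureI)
       (simp add: \<mu>_def space_distr em_\<mu>[unfolded \<mu>_def, of UNIV] ennreal_mult_eq_top_iff emeasure_eq_measure)
  have "\<mu> \<Otimes>\<^sub>M ?H = \<nu>"
  proof (rule pair_measure_eqI)
    show "sets (\<mu> \<Otimes>\<^sub>M ?H) = sets \<nu>"
      unfolding \<nu>_def \<mu>_def sets_distr by (intro sets_pair_measure_cong) auto
    fix E F assume "E \<in> sets \<mu>" "F \<in> sets ?H"
    then have EF[measurable]: "E \<in> sets borel" "F \<in> sets borel" by (auto simp: \<mu>_def)
    \<comment> \<open>The jump time depends on earlier holding times only, so its event merges with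
      \<open>A\<close> into one past event.\<close>
    have JE: "{\<omega>\<in>space M. jump_time k \<omega> \<in> E} \<in> sets (history k)"
      using measurable_sets[OF jump_time_history[of k k] EF(1)]
      by (simp add: vimage_def Int_def conj_commute)
    note s = step_prob[of "{\<omega>\<in>space M. jump_time k \<omega> \<in> E} \<inter> A" k y z F, OF sets.Int[OF JE A] y z c EF(2)]
    have "emeasure \<nu> (E \<times> F) = (\<integral>\<^sup>+\<omega>. indicator (?B \<inter> ?Z) \<omega> * indicator ((\<lambda>\<omega>. (jump_time k \<omega>, \<tau> k \<omega>)) -` (E \<times> F) \<inter> space M) \<omega> \<partial>M)"
      unfolding \<nu>_def by (subst emeasure_distr) (auto simp: emeasure_density)
    also have "\<dots> = (\<integral>\<^sup>+\<omega>. indicator ({\<omega>\<in>space M. jump_time k \<omega> \<in> E} \<inter> A \<inter> path_event k y \<inter> {\<omega>\<in>space M. \<tau> k \<omega> \<in> F \<and> Y (Suc k) \<omega> = z}) \<omega> \<partial>M)"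
      by (intro nn_integral_cong) (auto simp: indicator_def)
    also have "\<dots> = emeasure M ({\<omega>\<in>space M. jump_time k \<omega> \<in> E} \<inter> A \<inter> path_event k y \<inter> {\<omega>\<in>space M. \<tau> k \<omega> \<in> F \<and> Y (Suc k) \<omega> = z})"
      by (subst nn_integral_indicator) measurable
    also have "\<dots> = emeasure \<mu> E * emeasure ?H F"
      unfolding em_\<mu>[OF EF(1)] using s p
      by (simp add: emeasure_eq_measure H.emeasure_eq_measure ennreal_mult'' Int_assoc ac_simps)
    finally show "emeasure \<mu> E * emeasure ?H F = emeasure \<nu> (E \<times> F)" by simp
  qed (unfold_locales)
  have "(\<integral>\<^sup>+\<omega>\<in>?B \<inter> ?Z. f (jump_time k \<omega>, \<tau> k \<omega>) \<partial>M) = (\<integral>\<^sup>+x. f x \<partial>\<nu>)"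
    unfolding \<nu>_def by (subst nn_integral_distr) (auto simp: nn_integral_density mult.commute)
  also have "\<dots> = (\<integral>\<^sup>+x. f x \<partial>(\<mu> \<Otimes>\<^sub>M ?H))" using \<open>\<mu> \<Otimes>\<^sub>M ?H = \<nu>\<close> by simp
  also have "\<dots> = (\<integral>\<^sup>+s. (\<integral>\<^sup>+r. f (s, r) \<partial>?H) \<partial>\<mu>)"
    by (rule H.nn_integral_fst[symmetric]) (simp add: \<mu>_def cong: measurable_cong_sets)
  also have "\<dots> = (\<integral>\<^sup>+\<omega>. ennreal ?p * indicator ?B \<omega> * (\<integral>\<^sup>+r. f (jump_time k \<omega>, r) \<partial>?H) \<partial>M)"
    unfolding \<mu>_def by (subst nn_integral_distr) (auto simp: nn_integral_density)
  finally show ?thesis by (simp add: ac_simps)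
qed

end

section \<open>A maximal inequality for space-time supersolutions\<close>

lemma nn_integral_continuous_interval:
  assumes "continuous_on {0..R} f" "\<And>r. 0 \<le> r \<Longrightarrow> r \<le> R \<Longrightarrow> 0 \<le> f r"
  shows "(\<integral>\<^sup>+r. ennreal (indicator {0..R} r * f r) \<partial>lborel) = ennreal (integral {0..R::real} f)"
proof (rule nn_integral_has_integral_lborel)
  show "(\<lambda>r. indicator {0..R} r * f r) \<in> borel_measurable borel"
    using borel_measurable_continuous_on_indicator[OF _ assms(1)] by simp
  show "0 \<le> indicator {0..R} r * f r" for r
    using assms(2)[of r] by (auto simp: indicator_def)
  have "(f has_integral integral {0..R} f) {0..R}"
    using assms(1) by (intro integrable_integral integrable_continuous_real)
  then have "((\<lambda>r. if r \<in> {0..R} then f r else 0) has_integral integral {0..R} f) UNIV"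
    by (simp only: has_integral_restrict_UNIV)
  then show "((\<lambda>r. indicator {0..R} r * f r) has_integral integral {0..R} f) UNIV"
    by (rule has_integral_eq[rotated]) (auto simp: indicator_def)
qed

text \<open>The last inequality on \<open>G\<close> is the supermartingale property up to the first jump, that is, the
  integrated form of \<open>\<partial>\<^sub>t G + generator G \<le> 0\<close>. Rates need to be nonnegative only in good states, which are
  the ones the process attains.\<close>

locale supersolution = jump_chain M S q Y \<tau>
  for M :: "'w measure" and S :: "'s set" and q Y \<tau> +
  fixes good :: "'s set" and G :: "real \<Rightarrow> 's \<Rightarrow> real" and T :: real and D :: "real set" and lam :: real
  assumes good_subset: "good \<subseteq> S"
    and rate_nonneg: "\<And>x z. x \<in> good \<Longrightarrow> z \<in> S \<Longrightarrow> z \<noteq> x \<Longrightarrow> 0 \<le> q x z"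
    and G_nonneg: "\<And>t x. x \<in> S \<Longrightarrow> 0 \<le> G t x"
    and G_continuous: "\<And>x. x \<in> S \<Longrightarrow> continuous_on UNIV (\<lambda>t. G t x)"
    and supersolution: "\<And>x s R. x \<in> good \<Longrightarrow> 0 \<le> s \<Longrightarrow> 0 \<le> R \<Longrightarrow> s + R \<le> T \<Longrightarrow>
      exp (- exit_rate S q x * R) * G (s + R) x +
      integral {0..R} (\<lambda>r. exp (- exit_rate S q x * r) *
        (\<Sum>z | z \<in> S - {x} \<and> q x z \<noteq> 0. q x z * G (s + r) z)) \<le> G s x"
    and countable_D: "countable D" and D_subset: "D \<subseteq> {0..T}" and lam_pos: "0 < lam"
begin

text \<open>The level is tested on the half-open interval during which \<open>y\<close> is held,
  which is unbounded if \<open>r\<close> is infinite. The times are taken from the countable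
  \<open>D\<close> to keep the event measurable.\<close>

definition crosses :: "'s \<Rightarrow> ereal \<Rightarrow> ereal \<Rightarrow> bool" where
  "crosses y s r \<longleftrightarrow> (\<exists>t\<in>D. s \<le> ereal t \<and> ereal t < s + r \<and> lam < G t y)"

text \<open>The contribution of one stage to the induction: 1 if the level is crossed before the next jump, and
  otherwise the bound for a crossing after it.\<close>

definition score :: "'s \<Rightarrow> 's \<Rightarrow> ereal \<times> ereal \<Rightarrow> ennreal" where
  "score y z = (\<lambda>(s, r). indicator {x. crosses y (fst x) (snd x)} (s, r) +
     (if \<not> crosses y s r \<and> s + r \<le> ereal T then ennreal (G (real_of_ereal (s + r)) z / lam) else 0))"

lemma G_borel [measurable]: "x \<in> S \<Longrightarrow> (\<lambda>t. G t x) \<in> borel_measurable borel"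
  by (rule borel_measurable_continuous_onI[OF G_continuous])

lemma crosses_measurable [measurable]: "Measurable.pred (borel \<Otimes>\<^sub>M borel) (\<lambda>x. crosses y (fst x) (snd x))"
  unfolding crosses_def using countable_D by measurable

lemma score_measurable [measurable]: "z \<in> S \<Longrightarrow> score y z \<in> borel_measurable (borel \<Otimes>\<^sub>M borel)"
  unfolding score_def case_prod_beta' by measurable

lemma exit_rate_nonneg: "x \<in> good \<Longrightarrow> 0 \<le> exit_rate S q x"
  using good_subset finite_support[of x] rate_nonneg[of x]
  by (subst exit_rate_finite_support) (auto intro!: sum_nonneg)

lemma jump_prob_nonneg: "x \<in> good \<Longrightarrow> z \<in> S \<Longrightarrow> 0 \<le> jump_prob S q x z"
  using exit_rate_nonneg[of x] rate_nonneg[of x z] by (auto simp: jump_prob_def)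

lemma integrand_continuous:
  "x \<in> good \<Longrightarrow> continuous_on A (\<lambda>r. exp (- exit_rate S q x * r) *
        (\<Sum>z | z \<in> S - {x} \<and> q x z \<noteq> 0. q x z * G (s + r) z))"
  by (intro continuous_intros continuous_on_compose2[OF G_continuous]) auto

text \<open>While \<open>y\<close> is held, the first time at which the level is exceeded is
  deterministic. The supersolution inequality is applied up to that time: its survival term pays for
  the probability of crossing, its integral for the jumps before.\<close>

lemma stage_inequality:
  assumes y: "y \<in> good" and s: "0 \<le> s" "s \<le> T"
  shows "(\<Sum>z | z \<in> S \<and> jump_prob S q y z \<noteq> 0. ennreal (jump_prob S q y z) *
           (\<integral>\<^sup>+r. score y z (ereal s, r) \<partial>hold_law (exit_rate S q y))) \<le> ennreal (G s y / lam)"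
proof -
  define c where "c = exit_rate S q y"
  define p where "p = jump_prob S q y"
  define Z where "Z = {z. z \<in> S \<and> p z \<noteq> 0}"
  define C where "C = {t\<in>D. s \<le> t \<and> lam < G t y}"
  \<comment> \<open>Waiting time until the first crossing if no jump intervenes, or the whole
    remaining time if no crossing is possible.\<close>
  define R where "R = (if C = {} then T - s else Inf C - s)"
  define I where "I = integral {0..R} (\<lambda>r. exp (- c * r) *
        (\<Sum>z | z \<in> S - {y} \<and> q y z \<noteq> 0. q y z * G (s + r) z))"
  have yS: "y \<in> S" using y good_subset by auto
  have c0: "0 \<le> c" unfolding c_def by (rule exit_rate_nonneg[OF y])
  have finZ: "finite Z" using jump_prob_finite_support[of S q y, OF finite_support[OF yS]] by (simp add: Z_def p_def)
  have p0: "0 \<le> p z" if "z \<in> S" for z unfolding p_def by (rule jump_prob_nonneg[OF y that])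
  have sum_p: "(\<Sum>z\<in>Z. p z) = 1" using sum_jump_prob[of y S q, OF yS finite_support[OF yS]] by (simp add: Z_def p_def)
  interpret H: prob_space "hold_law c" by (rule prob_space_hold_law[OF c0])
  have bdd: "bdd_below C" by (rule bdd_belowI[of _ s]) (auto simp: C_def)
  have R: "0 \<le> R" "s + R \<le> T"
  proof -
    have "C \<noteq> {} \<Longrightarrow> s \<le> Inf C" by (rule cInf_greatest) (auto simp: C_def)
    moreover have "Inf C \<le> T" if "t \<in> C" for t
      using cInf_lower[OF that bdd] that D_subset by (auto simp: C_def)
    ultimately show "0 \<le> R" "s + R \<le> T" using s by (auto simp: R_def)
  qed
  \<comment> \<open>Both cases, infimum attained or not, give a strict inequality because the
    holding interval is open on the right.\<close>
  have cross_iff: "crosses y (ereal s) r \<longleftrightarrow> C \<noteq> {} \<and> ereal R < r" for r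
  proof (cases r)
    case (real r')
    have "crosses y (ereal s) r \<longleftrightarrow> (\<exists>t\<in>C. t < s + r')" 
      unfolding crosses_def C_def real by auto
    also have "\<dots> \<longleftrightarrow> C \<noteq> {} \<and> Inf C < s + r'" using cInf_less_iff[OF _ bdd] by auto
    also have "\<dots> \<longleftrightarrow> C \<noteq> {} \<and> ereal R < r" by (auto simp: R_def real)
    finally show ?thesis .
  qed (auto simp: crosses_def C_def)
  have I0: "0 \<le> I" unfolding I_def c_def
    using rate_nonneg[OF y] G_nonneg
    by (intro integral_nonneg integrable_continuous_real integrand_continuous[OF y])
       (auto intro!: mult_nonneg_nonneg sum_nonneg)
  have super: "exp (- c * R) * G (s + R) y + I \<le> G s y"
    unfolding I_def c_def using supersolution[OF y s(1) R] .
  define a where "a = (if C = {} then 0 else exp (- c * R))"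
  \<comment> \<open>\<open>a\<close> is the probability of holding beyond \<open>R\<close>, that is,
    of crossing in this stage. By continuity the level is reached, at least weakly, at the infimum
    itself.\<close>
  have "a * lam \<le> exp (- c * R) * G (s + R) y"
  proof (cases "C = {}")
    case False
    have "closed {t. lam \<le> G t y}"
      by (intro closed_Collect_le continuous_on_const G_continuous yS)
    moreover have "C \<subseteq> {t. lam \<le> G t y}" by (auto simp: C_def)
    ultimately have "Inf C \<in> {t. lam \<le> G t y}"
      using closure_contains_Inf[OF False bdd] closure_minimal by blast
    then show ?thesis using False by (simp add: a_def R_def)
  next
    case True then show ?thesis using G_nonneg[OF yS] by (simp add: a_def)
  qed
  with super have "a * lam + I \<le> G s y" by linarith
  then have "(a * lam + I) / lam \<le> G s y / lam"
    using lam_pos by (intro divide_right_mono) auto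
  with lam_pos have main: "a + I / lam \<le> G s y / lam"
    by (simp add: add_divide_distrib)
  define g where "g z r = (if \<not> crosses y (ereal s) r \<and> ereal s + r \<le> ereal T
     then ennreal (G (real_of_ereal (ereal s + r)) z / lam) else 0)" for z r
  have g_meas[measurable]: "g z \<in> borel_measurable borel" if [measurable]: "z \<in> S" for z
    unfolding g_def cross_iff by measurable
  have "{r. crosses y (ereal s) r} = (if C = {} then {} else {ereal R<..})"
    using cross_iff by auto
  then have em: "emeasure (hold_law c) {r. crosses y (ereal s) r} = ennreal a"
    using measure_hold_law_greater[OF c0, of R] R by (auto simp: a_def H.emeasure_eq_measure)
  have cross_set: "{r. crosses y (ereal s) r} \<in> sets borel"
    unfolding cross_iff by measurable
  have "(\<Sum>z\<in>Z. ennreal (p z) * (\<integral>\<^sup>+r. score y z (ereal s, r) \<partial>hold_law c)) =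
     (\<Sum>z\<in>Z. ennreal (p z) * (ennreal a + (\<integral>\<^sup>+r. g z r \<partial>hold_law c)))"
  proof (intro sum.cong refl arg_cong2[where f="(*)"])
    fix z assume "z \<in> Z"
    then have [measurable]: "z \<in> S" by (simp add: Z_def)
    have "(\<integral>\<^sup>+r. score y z (ereal s, r) \<partial>hold_law c) =
       (\<integral>\<^sup>+r. indicator {r. crosses y (ereal s) r} r + g z r \<partial>hold_law c)"
      by (intro nn_integral_cong) (auto simp: score_def g_def indicator_def)
    also have "\<dots> = ennreal a + (\<integral>\<^sup>+r. g z r \<partial>hold_law c)"
      using cross_set by (subst nn_integral_add) (auto simp: em)
    finally show "(\<integral>\<^sup>+r. score y z (ereal s, r) \<partial>hold_law c) = ennreal a + (\<integral>\<^sup>+r. g z r \<partial>hold_law c)" .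
  qed
  also have "\<dots> = (\<Sum>z\<in>Z. ennreal (p z)) * ennreal a + (\<Sum>z\<in>Z. ennreal (p z) * (\<integral>\<^sup>+r. g z r \<partial>hold_law c))"
    by (simp add: distrib_left sum.distrib sum_distrib_right)
  also have "(\<Sum>z\<in>Z. ennreal (p z)) = 1"
    using sum_p p0 by (subst sum_ennreal) (auto simp: Z_def)
  also have "(\<Sum>z\<in>Z. ennreal (p z) * (\<integral>\<^sup>+r. g z r \<partial>hold_law c)) \<le> ennreal (I / lam)"
  proof (cases "c = 0")
    \<comment> \<open>An absorbing state is held forever, so the next jump time exceeds
      \<open>T\<close> and no later stage contributes.\<close>
    case True
    then have "(\<integral>\<^sup>+r. g z r \<partial>hold_law c) = 0" if "z \<in> S" for z
      using g_meas[OF that] by (simp add: hold_law_def nn_integral_return) (simp add: g_def)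
    then show ?thesis by (simp add: Z_def)
  next
    case False
    with c0 have c: "0 < c" by simp
    \<comment> \<open>The factor \<open>c\<close> of the exponential density cancels the denominator
      of the jump probability, which brings back the rates of the supersolution inequality.\<close>
    have Z_eq: "Z = {z. z \<in> S - {y} \<and> q y z \<noteq> 0}" and pq: "\<And>z. z \<in> Z \<Longrightarrow> p z * c = q y z"
      using False by (auto simp: Z_def p_def jump_prob_def c_def)
    have "(\<Sum>z\<in>Z. ennreal (p z) * (\<integral>\<^sup>+r. g z r \<partial>hold_law c)) \<le>
       (\<Sum>z\<in>Z. (\<integral>\<^sup>+r. ennreal (indicator {0..R} r * (exp (- c * r) * (q y z * G (s + r) z) / lam)) \<partial>lborel))"
    proof (rule sum_mono)
      fix z assume z: "z \<in> Z"
      then have zS[measurable]: "z \<in> S" by (simp add: Z_def)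
      have "ennreal (p z) * (\<integral>\<^sup>+r. g z r \<partial>hold_law c) =
         (\<integral>\<^sup>+r. ennreal (p z) * (ennreal (exponential_density c r) * g z (ereal r)) \<partial>lborel)"
        using False by (simp add: hold_law_def nn_integral_distr nn_integral_density nn_integral_cmult)
      also have "\<dots> \<le> (\<integral>\<^sup>+r. ennreal (indicator {0..R} r * (exp (- c * r) * (q y z * G (s + r) z) / lam)) \<partial>lborel)"
      proof (rule nn_integral_mono)
        fix r :: real
        show "ennreal (p z) * (ennreal (exponential_density c r) * g z (ereal r)) \<le>
          ennreal (indicator {0..R} r * (exp (- c * r) * (q y z * G (s + r) z) / lam))"
        \<comment> \<open>A jump by time \<open>T\<close> without previous crossing happens within
          the first \<open>R\<close> units of time, so the integrand may be restricted to
          \<open>{0..R}\<close>.\<close>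
        proof (cases "0 \<le> r \<and> \<not> crosses y (ereal s) (ereal r) \<and> s + r \<le> T")
          case True
          then have "r \<le> R" by (auto simp: cross_iff R_def split: if_splits)
          moreover have e1: "ennreal (p z) * (ennreal (exponential_density c r) * g z (ereal r)) =
             ennreal (p z * (exponential_density c r * (G (s + r) z / lam)))"
          proof -
            have "g z (ereal r) = ennreal (G (s + r) z / lam)" using True by (simp add: g_def)
            moreover have "0 \<le> G (s + r) z / lam" using G_nonneg[OF zS] lam_pos by simp
            ultimately show ?thesis
              using p0[OF zS] exponential_density_nonneg[OF c, of r] by (simp only: ennreal_mult mult_nonneg_nonneg)
          qed
          moreover have e2: "p z * (exponential_density c r * (G (s + r) z / lam)) = exp (- c * r) * ((p z * c) * G (s + r) z) / lam"
            using True by (simp add: exponential_density_def mult_ac)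
          ultimately show ?thesis unfolding e1 e2 pq[OF z] using True by simp
        next
          case F: False
          then have "exponential_density c r = 0 \<or> g z (ereal r) = 0"
            by (auto simp: exponential_density_def g_def)
          then show ?thesis by auto
        qed
      qed
      finally show "ennreal (p z) * (\<integral>\<^sup>+r. g z r \<partial>hold_law c) \<le>
        (\<integral>\<^sup>+r. ennreal (indicator {0..R} r * (exp (- c * r) * (q y z * G (s + r) z) / lam)) \<partial>lborel)" .
    qed
    also have "\<dots> = (\<integral>\<^sup>+r. (\<Sum>z\<in>Z. ennreal (indicator {0..R} r * (exp (- c * r) * (q y z * G (s + r) z) / lam))) \<partial>lborel)"
      by (rule nn_integral_sum[symmetric]) (auto simp: Z_def)
    also have "\<dots> = (\<integral>\<^sup>+r. ennreal (indicator {0..R} r * (exp (- c * r) * (\<Sum>z\<in>Z. q y z * G (s + r) z) / lam)) \<partial>lborel)"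
    proof (intro nn_integral_cong)
      fix r
      have "(\<Sum>z\<in>Z. ennreal (indicator {0..R} r * (exp (- c * r) * (q y z * G (s + r) z) / lam))) =
        ennreal (\<Sum>z\<in>Z. indicator {0..R} r * (exp (- c * r) * (q y z * G (s + r) z) / lam))"
        using rate_nonneg[OF y] G_nonneg lam_pos by (intro sum_ennreal) (auto simp: Z_eq)
      also have "(\<Sum>z\<in>Z. indicator {0..R} r * (exp (- c * r) * (q y z * G (s + r) z) / lam)) =
         indicator {0..R} r * (exp (- c * r) * (\<Sum>z\<in>Z. q y z * G (s + r) z) / lam)"
        by (simp add: sum_distrib_left sum_divide_distrib)
      finally show "(\<Sum>z\<in>Z. ennreal (indicator {0..R} r * (exp (- c * r) * (q y z * G (s + r) z) / lam))) =
         ennreal (indicator {0..R} r * (exp (- c * r) * (\<Sum>z\<in>Z. q y z * G (s + r) z) / lam))" .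
    qed
    also have "\<dots> = ennreal (integral {0..R} (\<lambda>r. exp (- c * r) * (\<Sum>z\<in>Z. q y z * G (s + r) z) / lam))"
      unfolding Z_eq c_def using rate_nonneg[OF y] G_nonneg lam_pos
      by (intro nn_integral_continuous_interval continuous_on_divide integrand_continuous[OF y])
         (auto intro!: divide_nonneg_nonneg mult_nonneg_nonneg sum_nonneg)
    also have "integral {0..R} (\<lambda>r. exp (- c * r) * (\<Sum>z\<in>Z. q y z * G (s + r) z) / lam) = I / lam"
      unfolding I_def Z_eq by simp
    finally show ?thesis .
  qed
  also have "1 * ennreal a + ennreal (I / lam) = ennreal (a + I / lam)"
    using I0 lam_pos by (subst ennreal_plus) (auto simp: a_def)
  also have "\<dots> \<le> ennreal (G s y / lam)" by (rule ennreal_leI[OF main])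
  finally show ?thesis unfolding Z_def p_def c_def by (auto simp: add_left_mono)
qed

end

section \<open>Induction on the number of jumps\<close>

context supersolution
begin

text \<open>\<open>N\<close> counts the stages still examined, starting from stage \<open>k\<close>.
  Goodness is demanded up to the crossing stage so that every stage used in the induction has
  genuine holding laws.\<close>

definition crossing :: "nat \<Rightarrow> nat \<Rightarrow> 'w \<Rightarrow> bool" where
  "crossing N k \<omega> \<longleftrightarrow> (\<exists>j. k \<le> j \<and> j < k + N \<and> (\<forall>i\<in>{k..j}. Y i \<omega> \<in> good) \<and>
     crosses (Y j \<omega>) (jump_time j \<omega>) (\<tau> j \<omega>))"

lemma Y_compose_measurable [measurable]: "(\<lambda>\<omega>. f (Y j \<omega>)) \<in> measurable M (count_space UNIV)"
  by (rule measurable_compose[OF Y_measurable]) simp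

lemma Y_compose_borel [measurable]: "(\<lambda>\<omega>. f (Y j \<omega>)) \<in> borel_measurable M"
  by (rule measurable_compose[OF Y_measurable]) simp

lemma crosses_Y_measurable [measurable]: "Measurable.pred M (\<lambda>\<omega>. crosses (Y j \<omega>) (jump_time j \<omega>) (\<tau> j \<omega>))"
  unfolding crosses_def using countable_D by measurable

lemma crossing_measurable [measurable]: "Measurable.pred M (crossing N k)"
  unfolding crossing_def[abs_def] by measurable

text \<open>Level -1 in \<open>step_tail\<close> gives probability zero to each forbidden
  transition, and there are countably many. Only finitely many next states then remain in the
  induction.\<close>

lemma next_state_AE:
  assumes y: "\<And>i. i \<le> k \<Longrightarrow> y i \<in> S"
  shows "AE \<omega> in M. \<omega> \<in> path_event k y \<longrightarrow> jump_prob S q (y k) (Y (Suc k) \<omega>) \<noteq> 0"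
proof -
  have "AE \<omega> in M. \<omega> \<in> path_event k y \<longrightarrow> Y (Suc k) \<omega> = z \<longrightarrow> jump_prob S q (y k) z \<noteq> 0" if z: "z \<in> S" for z
  proof (cases "jump_prob S q (y k) z = 0")
    case True
    have "{\<omega>\<in>space M. ereal (-1) < \<tau> k \<omega> \<and> Y (Suc k) \<omega> = z} = {\<omega>\<in>space M. Y (Suc k) \<omega> = z}"
      using neg_less_\<tau> by auto
    then have "prob (path_event k y \<inter> {\<omega>\<in>space M. Y (Suc k) \<omega> = z}) = 0"
      using step_tail[of "space M" k y z "-1", OF _ y z] True sets.top[of "history k"]
      by (simp add: path_event_def Int_def)
    then have "AE \<omega> in M. \<omega> \<notin> path_event k y \<inter> {\<omega>\<in>space M. Y (Suc k) \<omega> = z}"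
      by (intro AE_not_in) (auto simp: null_sets_def emeasure_eq_measure)
    with AE_space show ?thesis by eventually_elim auto
  qed auto
  then have "AE \<omega> in M. \<forall>z\<in>S. \<omega> \<in> path_event k y \<longrightarrow> Y (Suc k) \<omega> = z \<longrightarrow> jump_prob S q (y k) z \<noteq> 0"
    using countable_S by (subst AE_ball_countable) auto
  with AE_space show ?thesis by eventually_elim (use Y_in_S in auto)
qed

text \<open>Induction on \<open>N\<close> with \<open>k\<close>, \<open>A\<close> and
  \<open>y\<close> free. A crossing occurs either in stage \<open>k\<close> or, for some next state
  \<open>z\<close>, after a jump by time \<open>T\<close>; the second case is the induction
  hypothesis with a smaller past event. Together they integrate to \<open>score\<close>; integrating
  out the holding time leaves exactly what \<open>stage_inequality\<close> bounds. The general past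
  event \<open>A\<close> is what lets the absence of earlier crossings be remembered.\<close>

lemma crossing_bound:
  assumes "A \<in> sets (history k)" "\<And>\<omega>. \<omega> \<in> A \<Longrightarrow> jump_time k \<omega> \<le> ereal T"
    "\<And>i. i \<le> k \<Longrightarrow> y i \<in> S" "y k \<in> good"
  shows "emeasure M (A \<inter> path_event k y \<inter> {\<omega>\<in>space M. crossing N k \<omega>}) \<le>
    (\<integral>\<^sup>+\<omega>\<in>A \<inter> path_event k y. ennreal (G (real_of_ereal (jump_time k \<omega>)) (y k) / lam) \<partial>M)"
  using assms
proof (induction N arbitrary: k A y)
  case 0
  have no: "{\<omega>\<in>space M. crossing 0 k \<omega>} = {}" by (auto simp: crossing_def)
  show ?case unfolding no by simp
next
  case (Suc N)
  note A = Suc.prems(1) and AT = Suc.prems(2) and y = Suc.prems(3) and yk = Suc.prems(4)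
  define p where "p = jump_prob S q (y k)"
  define Z where "Z = {z. z \<in> S \<and> p z \<noteq> 0}"
  define B where "B = A \<inter> path_event k y"
  define X where "X = {\<omega>\<in>space M. crossing (Suc N) k \<omega>}"
  define Bz where "Bz z = B \<inter> {\<omega>\<in>space M. Y (Suc k) \<omega> = z}" for z
  have A_ev[measurable]: "A \<in> events" by (rule history_subset[OF A])
  have [measurable]: "B \<in> events" "X \<in> events" "Bz z \<in> events" for z
    unfolding B_def X_def Bz_def by measurable
  have finZ: "finite Z"
    unfolding Z_def p_def using jump_prob_finite_support[of S q "y k"] finite_support y by auto
  have time_real: "\<exists>s. jump_time k \<omega> = ereal s \<and> 0 \<le> s \<and> s \<le> T" if "\<omega> \<in> A" for \<omega>
  proof -
    have "\<omega> \<in> space M" using that sets.sets_into_space[OF A_ev] by auto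
    then have "0 \<le> jump_time k \<omega>" unfolding jump_time_def by (intro sum_nonneg \<tau>_nonneg)
    then show ?thesis using AT[OF that] by (cases "jump_time k \<omega>") auto
  qed
  have each: "emeasure M (Bz z \<inter> X) \<le> (\<integral>\<^sup>+\<omega>\<in>Bz z. score (y k) z (jump_time k \<omega>, \<tau> k \<omega>) \<partial>M)"
    if zS: "z \<in> S" for z
  proof -
    define K where "K = {\<omega>\<in>space M. crosses (y k) (jump_time k \<omega>) (\<tau> k \<omega>)}"
    \<comment> \<open>No crossing in stage \<open>k\<close> and a next jump by time
      \<open>T\<close>: both are decided by the holding times up to \<open>\<tau> k\<close>, so this
      is a past event for the next stage.\<close>
    define A' where "A' = A \<inter> {\<omega>\<in>space M. \<not> crosses (y k) (jump_time k \<omega>) (\<tau> k \<omega>) \<and> jump_time (Suc k) \<omega> \<le> ereal T}"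
    define y' where "y' = y(Suc k := z)"
    have A': "A' \<in> sets (history (Suc k))"
    proof -
      note [measurable] = jump_time_history[of k "Suc k"] jump_time_history[of "Suc k" "Suc k"] \<tau>_history[of k "Suc k"]
      have "Measurable.pred (history (Suc k)) (\<lambda>\<omega>. crosses (y k) (jump_time k \<omega>) (\<tau> k \<omega>))"
        unfolding crosses_def using countable_D by measurable
      then have "{\<omega>\<in>space (history (Suc k)). \<not> crosses (y k) (jump_time k \<omega>) (\<tau> k \<omega>) \<and> jump_time (Suc k) \<omega> \<le> ereal T} \<in> sets (history (Suc k))"
        by measurable
      then show ?thesis unfolding A'_def using history_Suc[OF A] by (simp add: sets.Int)
    qed
    have A'_ev[measurable]: "A' \<in> events" by (rule history_subset[OF A'])
    have K_ev[measurable]: "K \<in> events" unfolding K_def crosses_def using countable_D by measurable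
    have path': "A' \<inter> path_event (Suc k) y' = A' \<inter> Bz z"
      by (auto simp: A'_def path_event_def y'_def Bz_def B_def le_Suc_eq)
    have next_le: "emeasure M (A' \<inter> path_event (Suc k) y' \<inter> {\<omega>\<in>space M. z \<in> good \<and> crossing N (Suc k) \<omega>}) \<le>
       (\<integral>\<^sup>+\<omega>\<in>A' \<inter> Bz z. ennreal (G (real_of_ereal (jump_time (Suc k) \<omega>)) z / lam) \<partial>M)"
    proof (cases "z \<in> good")
      case True
      have "emeasure M (A' \<inter> path_event (Suc k) y' \<inter> {\<omega>\<in>space M. crossing N (Suc k) \<omega>}) \<le>
         (\<integral>\<^sup>+\<omega>\<in>A' \<inter> path_event (Suc k) y'. ennreal (G (real_of_ereal (jump_time (Suc k) \<omega>)) (y' (Suc k)) / lam) \<partial>M)"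
        by (rule Suc.IH[OF A']) (use y zS True in \<open>auto simp: A'_def y'_def le_Suc_eq\<close>)
      then show ?thesis using True unfolding path' by (simp add: y'_def)
    qed simp
    \<comment> \<open>A crossing after stage \<open>k\<close> happens at a time of \<open>D\<close>,
      hence by \<open>T\<close>, and not before the next jump; this gives the bound on the jump time
      in \<open>A'\<close>.\<close>
    have "Bz z \<inter> X \<subseteq> (Bz z \<inter> K) \<union> (A' \<inter> path_event (Suc k) y' \<inter> {\<omega>\<in>space M. z \<in> good \<and> crossing N (Suc k) \<omega>})"
    proof
      fix \<omega> assume \<omega>: "\<omega> \<in> Bz z \<inter> X"
      then have sp: "\<omega> \<in> space M" and Yk: "Y k \<omega> = y k" and Yz: "Y (Suc k) \<omega> = z"
        by (auto simp: X_def Bz_def B_def path_event_def)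
      from \<omega> obtain j where j: "k \<le> j" "j < k + Suc N" "\<forall>i\<in>{k..j}. Y i \<omega> \<in> good"
        "crosses (Y j \<omega>) (jump_time j \<omega>) (\<tau> j \<omega>)" by (auto simp: X_def crossing_def)
      show "\<omega> \<in> (Bz z \<inter> K) \<union> (A' \<inter> path_event (Suc k) y' \<inter> {\<omega>\<in>space M. z \<in> good \<and> crossing N (Suc k) \<omega>})"
      proof (cases "\<omega> \<in> K")
        case False
        with j(4) Yk sp have "j \<noteq> k" by (auto simp: K_def)
        with j(1) have kj: "Suc k \<le> j" by simp
        have cr: "crossing N (Suc k) \<omega>" unfolding crossing_def
          using j kj by (intro exI[of _ j]) auto
        have "z \<in> good" using j(3) kj Yz by force
        obtain t where t: "t \<in> D" "jump_time j \<omega> \<le> ereal t" using j(4) by (auto simp: crosses_def)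
        have "jump_time (Suc k) \<omega> \<le> jump_time j \<omega>"
          unfolding jump_time_def using kj sp by (intro sum_mono2) (auto intro: \<tau>_nonneg)
        also have "\<dots> \<le> ereal t" by (rule t(2))
        also have "\<dots> \<le> ereal T" using t(1) D_subset by auto
        finally have "\<omega> \<in> A'" using False \<omega> sp by (auto simp: A'_def K_def Bz_def B_def)
        then show ?thesis using \<omega> \<open>z \<in> good\<close> cr sp unfolding path' by auto
      qed (use \<omega> in auto)
    qed
    then have "emeasure M (Bz z \<inter> X) \<le> emeasure M ((Bz z \<inter> K) \<union> (A' \<inter> path_event (Suc k) y' \<inter> {\<omega>\<in>space M. z \<in> good \<and> crossing N (Suc k) \<omega>}))"
      by (rule emeasure_mono) measurable
    also have "\<dots> \<le> emeasure M (Bz z \<inter> K) + emeasure M (A' \<inter> path_event (Suc k) y' \<inter> {\<omega>\<in>space M. z \<in> good \<and> crossing N (Suc k) \<omega>})"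
      by (rule emeasure_subadditive) measurable
    also have "\<dots> \<le> emeasure M (Bz z \<inter> K) + (\<integral>\<^sup>+\<omega>\<in>A' \<inter> Bz z. ennreal (G (real_of_ereal (jump_time (Suc k) \<omega>)) z / lam) \<partial>M)"
      by (intro add_left_mono next_le)
    also have "emeasure M (Bz z \<inter> K) = (\<integral>\<^sup>+\<omega>. indicator (Bz z \<inter> K) \<omega> \<partial>M)"
      by (rule nn_integral_indicator[symmetric]) measurable
    also have "\<dots> + (\<integral>\<^sup>+\<omega>\<in>A' \<inter> Bz z. ennreal (G (real_of_ereal (jump_time (Suc k) \<omega>)) z / lam) \<partial>M) =
       (\<integral>\<^sup>+\<omega>. indicator (Bz z \<inter> K) \<omega> + ennreal (G (real_of_ereal (jump_time (Suc k) \<omega>)) z / lam) * indicator (A' \<inter> Bz z) \<omega> \<partial>M)"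
      using zS by (intro nn_integral_add[symmetric]) measurable
    also have "\<dots> = (\<integral>\<^sup>+\<omega>\<in>Bz z. score (y k) z (jump_time k \<omega>, \<tau> k \<omega>) \<partial>M)"
      by (intro nn_integral_cong)
         (auto simp: score_def indicator_def K_def A'_def jump_time_def Bz_def B_def)
    finally show ?thesis .
  qed
  have next_Z: "AE \<omega> in M. \<omega> \<in> path_event k y \<longrightarrow> jump_prob S q (y k) (Y (Suc k) \<omega>) \<noteq> 0"
    by (rule next_state_AE) (rule y)
  have "emeasure M (B \<inter> X) \<le> emeasure M (\<Union>z\<in>Z. Bz z \<inter> X)"
  proof (rule emeasure_mono_AE)
    show "AE \<omega> in M. \<omega> \<in> B \<inter> X \<longrightarrow> \<omega> \<in> (\<Union>z\<in>Z. Bz z \<inter> X)"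
      using next_Z AE_space
      by eventually_elim (auto simp: B_def Bz_def Z_def p_def Y_in_S)
    show "(\<Union>z\<in>Z. Bz z \<inter> X) \<in> events" using finZ by (intro sets.finite_UN) measurable
  qed
  also have "\<dots> \<le> (\<Sum>z\<in>Z. emeasure M (Bz z \<inter> X))"
    using finZ by (intro emeasure_subadditive_finite) auto
  also have "\<dots> \<le> (\<Sum>z\<in>Z. (\<integral>\<^sup>+\<omega>\<in>Bz z. score (y k) z (jump_time k \<omega>, \<tau> k \<omega>) \<partial>M))"
    by (intro sum_mono each) (auto simp: Z_def)
  \<comment> \<open>Here the holding time of stage \<open>k\<close> is replaced by its law,
    conditionally on path and past.\<close>
  also have "\<dots> = (\<Sum>z\<in>Z. (\<integral>\<^sup>+\<omega>\<in>B. ennreal (p z) *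
        (\<integral>\<^sup>+r. score (y k) z (jump_time k \<omega>, r) \<partial>hold_law (exit_rate S q (y k))) \<partial>M))"
    unfolding Bz_def B_def p_def
    by (intro sum.cong refl step_nn_integral A y exit_rate_nonneg yk jump_prob_nonneg score_measurable)
       (auto simp: Z_def)
  also have "\<dots> = (\<integral>\<^sup>+\<omega>. (\<Sum>z\<in>Z. ennreal (p z) *
        (\<integral>\<^sup>+r. score (y k) z (jump_time k \<omega>, r) \<partial>hold_law (exit_rate S q (y k))) * indicator B \<omega>) \<partial>M)"
  proof (rule nn_integral_sum[symmetric])
    fix z assume "z \<in> Z"
    then have [measurable]: "z \<in> S" by (simp add: Z_def)
    interpret H: prob_space "hold_law (exit_rate S q (y k))"
      by (rule prob_space_hold_law[OF exit_rate_nonneg[OF yk]])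
    have "(\<lambda>s. \<integral>\<^sup>+r. score (y k) z (s, r) \<partial>hold_law (exit_rate S q (y k))) \<in> borel_measurable borel"
      by (rule H.borel_measurable_nn_integral) (simp add: cong: measurable_cong_sets)
    then have [measurable]: "(\<lambda>\<omega>. \<integral>\<^sup>+r. score (y k) z (jump_time k \<omega>, r) \<partial>hold_law (exit_rate S q (y k))) \<in> borel_measurable M"
      by (rule measurable_compose[OF jump_time_measurable])
    show "(\<lambda>\<omega>. ennreal (p z) * (\<integral>\<^sup>+r. score (y k) z (jump_time k \<omega>, r) \<partial>hold_law (exit_rate S q (y k))) * indicator B \<omega>)
       \<in> borel_measurable M" by measurable
  qed
  also have "\<dots> \<le> (\<integral>\<^sup>+\<omega>\<in>B. ennreal (G (real_of_ereal (jump_time k \<omega>)) (y k) / lam) \<partial>M)"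
  proof (rule nn_integral_mono)
    fix \<omega>
    show "(\<Sum>z\<in>Z. ennreal (p z) *
        (\<integral>\<^sup>+r. score (y k) z (jump_time k \<omega>, r) \<partial>hold_law (exit_rate S q (y k))) * indicator B \<omega>)
      \<le> ennreal (G (real_of_ereal (jump_time k \<omega>)) (y k) / lam) * indicator B \<omega>"
    proof (cases "\<omega> \<in> B")
      case True
      then obtain s where "jump_time k \<omega> = ereal s" "0 \<le> s" "s \<le> T"
        using time_real by (auto simp: B_def)
      then show ?thesis using stage_inequality[OF yk, of s] True by (simp add: Z_def p_def)
    qed simp
  qed
  finally show ?case unfolding B_def X_def .
qed

text \<open>The bound for finitely many stages is uniform in \<open>N\<close>, so continuity from
  below removes the restriction. Splitting over the countably many initial states uses the bound on
  \<open>G 0\<close> only where the start lies in \<open>B\<close>, and \<open>G 0\<close> need not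
  be integrable overall.\<close>

theorem maximal_inequality:
  assumes B: "\<And>x. x \<in> B \<Longrightarrow> G 0 x \<le> \<eta>" and T: "0 \<le> T" and \<eta>: "0 \<le> \<eta>"
  shows "prob {\<omega>\<in>space M. Y 0 \<omega> \<in> B \<and> (\<exists>j. (\<forall>i\<le>j. Y i \<omega> \<in> good) \<and>
     crosses (Y j \<omega>) (jump_time j \<omega>) (\<tau> j \<omega>))} \<le> \<eta> / lam"
proof -
  define E where "E N = {\<omega>\<in>space M. Y 0 \<omega> \<in> B \<and> crossing N 0 \<omega>}" for N
  have [measurable]: "E N \<in> events" for N unfolding E_def by measurable
  have bound: "emeasure M (E N) \<le> ennreal (\<eta> / lam)" for N
  proof -
    define P where "P x = {\<omega>\<in>space M. Y 0 \<omega> = x}" for x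
    have [measurable]: "P x \<in> events" for x unfolding P_def by measurable
    have E_eq: "E N = (\<Union>x\<in>S. P x \<inter> E N)" using Y_in_S by (auto simp: E_def P_def)
    have "emeasure M (E N) = (\<integral>\<^sup>+x. emeasure M (P x \<inter> E N) \<partial>count_space S)"
      by (subst E_eq, rule emeasure_UN_countable)
         (use countable_S in \<open>auto simp: disjoint_family_on_def P_def\<close>)
    also have "\<dots> \<le> (\<integral>\<^sup>+x. ennreal (\<eta> / lam) * emeasure M (P x) \<partial>count_space S)"
    proof (rule nn_integral_mono)
      fix x assume "x \<in> space (count_space S)"
      then have xS: "x \<in> S" by simp
      show "emeasure M (P x \<inter> E N) \<le> ennreal (\<eta> / lam) * emeasure M (P x)"
      proof (cases "x \<in> good \<and> x \<in> B")
        case True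
        have P0: "space M \<inter> path_event 0 (\<lambda>_. x) = P x" by (auto simp: path_event_def P_def)
        have "emeasure M (P x \<inter> E N) \<le> emeasure M (space M \<inter> path_event 0 (\<lambda>_. x) \<inter> {\<omega>\<in>space M. crossing N 0 \<omega>})"
          unfolding P0 by (rule emeasure_mono) (auto simp: E_def)
        also have "\<dots> \<le> (\<integral>\<^sup>+\<omega>\<in>space M \<inter> path_event 0 (\<lambda>_. x). ennreal (G (real_of_ereal (jump_time 0 \<omega>)) x / lam) \<partial>M)"
          using True xS T sets.top[of "history 0"]
          by (intro crossing_bound) (auto simp: jump_time_def)
        also have "\<dots> = (\<integral>\<^sup>+\<omega>\<in>P x. ennreal (G 0 x / lam) \<partial>M)"
          unfolding P0 by (simp add: jump_time_def)
        also have "\<dots> = ennreal (G 0 x / lam) * emeasure M (P x)"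
          by (rule nn_integral_cmult_indicator) measurable
        also have "\<dots> \<le> ennreal (\<eta> / lam) * emeasure M (P x)"
          using B True lam_pos by (intro mult_right_mono ennreal_leI divide_right_mono) auto
        finally show ?thesis .
      next
        case False
        have "P x \<inter> E N = {}" using False by (auto simp: P_def E_def crossing_def)
        then show ?thesis by simp
      qed
    qed
    also have "\<dots> = ennreal (\<eta> / lam) * (\<integral>\<^sup>+x. emeasure M (P x) \<partial>count_space S)"
      by (rule nn_integral_cmult) simp
    also have "(\<integral>\<^sup>+x. emeasure M (P x) \<partial>count_space S) = emeasure M (\<Union>x\<in>S. P x)"
      by (rule emeasure_UN_countable[symmetric])
         (use countable_S in \<open>auto simp: disjoint_family_on_def P_def\<close>)
    also have "ennreal (\<eta> / lam) * \<dots> \<le> ennreal (\<eta> / lam) * 1"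
      by (intro mult_left_mono emeasure_le_1) auto
    finally show ?thesis by simp
  qed
  have "crossing (Suc N) 0 \<omega>" if "crossing N 0 \<omega>" for N \<omega>
  proof -
    from that obtain j where "j < N" "\<forall>i\<in>{0..j}. Y i \<omega> \<in> good" "crosses (Y j \<omega>) (jump_time j \<omega>) (\<tau> j \<omega>)"
      by (auto simp: crossing_def)
    then show ?thesis unfolding crossing_def by (intro exI[of _ j]) auto
  qed
  then have "incseq E"
    by (intro incseq_SucI) (auto simp: E_def)
  moreover have "(\<Union>N. E N) = {\<omega>\<in>space M. Y 0 \<omega> \<in> B \<and> (\<exists>j. (\<forall>i\<le>j. Y i \<omega> \<in> good) \<and>
     crosses (Y j \<omega>) (jump_time j \<omega>) (\<tau> j \<omega>))}" (is "_ = ?X")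
  proof -
    have iff: "(\<exists>N. crossing N 0 \<omega>) \<longleftrightarrow> (\<exists>j. (\<forall>i\<le>j. Y i \<omega> \<in> good) \<and>
      crosses (Y j \<omega>) (jump_time j \<omega>) (\<tau> j \<omega>))" for \<omega>
      unfolding crossing_def by (auto simp: atLeast0AtMost)
    show ?thesis unfolding E_def iff[symmetric] by blast
  qed
  moreover have "range E \<subseteq> events" by auto
  ultimately have "emeasure M ?X = (SUP N. emeasure M (E N))"
    by (metis SUP_emeasure_incseq)
  also have "\<dots> \<le> ennreal (\<eta> / lam)" by (intro SUP_least bound)
  finally show ?thesis
    using \<eta> lam_pos by (simp add: emeasure_eq_measure)
qed

end

section \<open>Graphons as Dirichlet forms\<close>

lemma prob_space_I01: "prob_space I01"
  by (rule prob_space_restrict_space) auto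

interpretation I01: prob_space I01 by (rule prob_space_I01)

interpretation I01_pair: pair_sigma_finite I01 I01 ..

lemma space_I01 [simp]: "space I01 = {0<..<1}"
  by (simp add: space_restrict_space)

abbreviation I01_sq :: "(real \<times> real) measure" where
  "I01_sq \<equiv> I01 \<Otimes>\<^sub>M I01"

text \<open>The bound holds everywhere and not just almost everywhere, because the test functions in
  \<open>cut_norm\<close> are bounded everywhere. Essentially bounded profiles are truncated
  later.\<close>

definition bounded_fun :: "real \<Rightarrow> (real \<Rightarrow> real) \<Rightarrow> bool" where
  "bounded_fun U f \<longleftrightarrow> f \<in> borel_measurable I01 \<and> (\<forall>x\<in>{0<..<1}. \<bar>f x\<bar> \<le> U)"

lemma bounded_funD [measurable_dest]: "bounded_fun U f \<Longrightarrow> f \<in> borel_measurable I01"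
  by (simp add: bounded_fun_def)

lemma bounded_fun_abs_le: "bounded_fun U f \<Longrightarrow> x \<in> {0<..<1} \<Longrightarrow> \<bar>f x\<bar> \<le> U"
  by (simp add: bounded_fun_def)

lemma bounded_fun_diff: "bounded_fun a f \<Longrightarrow> bounded_fun b g \<Longrightarrow> bounded_fun (a + b) (\<lambda>x. f x - g x)"
  unfolding bounded_fun_def by (auto intro: order_trans[OF abs_triangle_ineq4] add_mono)

lemma bounded_fun_mult:
  assumes "bounded_fun a f" "bounded_fun b g"
  shows "bounded_fun (a * b) (\<lambda>x. f x * g x)"
  using assms unfolding bounded_fun_def by (auto simp: abs_mult intro!: mult_mono order_trans[OF abs_ge_zero])

lemma integrable_bounded_fun:
  assumes "bounded_fun U f"
  shows "integrable I01 f"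
  using assms by (intro I01.integrable_const_bound[where B=U]) (auto simp: bounded_fun_def)

lemma integrable_weighted:
  assumes W: "integrable I01_sq (\<lambda>(x, y). W x y)"
    and f: "bounded_fun a f" and g: "bounded_fun b g"
  shows "integrable I01_sq (\<lambda>(x, y). W x y * f x * g y)"
proof (rule Bochner_Integration.integrable_bound)
  show "integrable I01_sq (\<lambda>p. (a * b) * (case p of (x, y) \<Rightarrow> W x y))"
    by (intro integrable_mult_right W)
  have [measurable]: "(\<lambda>(x, y). W x y) \<in> borel_measurable I01_sq" using W by auto
  have [measurable]: "(\<lambda>p. W (fst p) (snd p)) \<in> borel_measurable I01_sq"
    using W by (auto simp: case_prod_beta')
  note [measurable] = f[THEN bounded_funD] g[THEN bounded_funD]
  show "(\<lambda>(x, y). W x y * f x * g y) \<in> borel_measurable I01_sq"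
    unfolding case_prod_beta' by measurable
  show "AE p in I01 \<Otimes>\<^sub>M I01. norm (case p of (x, y) \<Rightarrow> W x y * f x * g y) \<le> norm ((a * b) * (case p of (x, y) \<Rightarrow> W x y))"
  proof (intro AE_I2)
    fix p assume "p \<in> space I01_sq"
    then obtain x y where p: "p = (x, y)" and x: "x \<in> {0<..<1}" and y: "y \<in> {0<..<1}"
      by (auto simp: space_pair_measure)
    have "\<bar>f x\<bar> * \<bar>g y\<bar> \<le> a * b"
      using bounded_fun_abs_le[OF f x] bounded_fun_abs_le[OF g y] by (intro mult_mono) auto
    also have "\<dots> \<le> \<bar>a * b\<bar>" by simp
    finally have "\<bar>W x y\<bar> * (\<bar>f x\<bar> * \<bar>g y\<bar>) \<le> \<bar>W x y\<bar> * \<bar>a * b\<bar>"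
      by (rule mult_left_mono) simp
    then show "norm (case p of (x, y) \<Rightarrow> W x y * f x * g y) \<le> norm ((a * b) * (case p of (x, y) \<Rightarrow> W x y))"
      by (simp add: p abs_mult mult_ac)
  qed
qed

lemma graphon_integrable: "graphon W \<Longrightarrow> integrable I01_sq (\<lambda>(x, y). W x y)"
  and graphon_sym: "graphon W \<Longrightarrow> x \<in> {0<..<1} \<Longrightarrow> y \<in> {0<..<1} \<Longrightarrow> W x y = W y x"
  and graphon_nonneg: "graphon W \<Longrightarrow> x \<in> {0<..<1} \<Longrightarrow> y \<in> {0<..<1} \<Longrightarrow> 0 \<le> W x y"
  and graphon_degree_le: "graphon W \<Longrightarrow> AE x in I01. graphon_degree W x \<le> 1"
  by (auto simp: graphon_def)

definition weighted :: "(real \<Rightarrow> real \<Rightarrow> real) \<Rightarrow> (real \<Rightarrow> real) \<Rightarrow> (real \<Rightarrow> real) \<Rightarrow> real" where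
  "weighted W f g = (\<integral>(x, y). W x y * f x * g y \<partial>I01_sq)"

text \<open>The pairing of \<open>f\<close> with the diffusion of \<open>g\<close>, hence minus the
  usual Dirichlet form. Splitting it into two bilinear terms prepares the comparison of two graphons
  in cut norm.\<close>

definition dirichlet :: "(real \<Rightarrow> real \<Rightarrow> real) \<Rightarrow> (real \<Rightarrow> real) \<Rightarrow> (real \<Rightarrow> real) \<Rightarrow> real" where
  "dirichlet W f g = weighted W f g - weighted W (\<lambda>x. f x * g x) (\<lambda>_. 1)"

lemma bounded_fun_1: "bounded_fun 1 (\<lambda>_. 1)"
  by (simp add: bounded_fun_def)

lemma weighted_sym:
  assumes "graphon W" and f: "bounded_fun a f" and g: "bounded_fun b g"
  shows "weighted W f g = weighted W g f"
proof -
  have "weighted W f g = (\<integral>(y, x). W x y * f x * g y \<partial>I01_sq)"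
    unfolding weighted_def
    using integrable_weighted[OF graphon_integrable[OF assms(1)] f g]
    by (subst I01_pair.integral_product_swap[symmetric]) (auto simp: case_prod_beta')
  also have "\<dots> = weighted W g f"
    unfolding weighted_def
    by (intro Bochner_Integration.integral_cong)
       (auto simp: space_pair_measure graphon_sym[OF assms(1)])
  finally show ?thesis .
qed

lemma weighted_add:
  assumes "integrable I01_sq (\<lambda>(x, y). W x y)" "bounded_fun a f" "bounded_fun b g" "bounded_fun c h"
  shows "weighted W (\<lambda>x. f x + g x) h = weighted W f h + weighted W g h"
  unfolding weighted_def
  using integrable_weighted[OF assms(1) assms(2) assms(4)] integrable_weighted[OF assms(1) assms(3) assms(4)]
  by (subst Bochner_Integration.integral_add[symmetric])
     (auto simp: case_prod_beta' algebra_simps intro!: Bochner_Integration.integral_cong)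

lemma weighted_mult_left: "weighted W (\<lambda>x. c * f x) g = c * weighted W f g"
  unfolding weighted_def
  by (subst Bochner_Integration.integral_mult_right_zero[symmetric])
     (auto simp: case_prod_beta' mult_ac intro!: Bochner_Integration.integral_cong)

lemma weighted_mult_right: "weighted W f (\<lambda>x. c * g x) = c * weighted W f g"
  unfolding weighted_def
  by (subst Bochner_Integration.integral_mult_right_zero[symmetric])
     (auto simp: case_prod_beta' mult_ac intro!: Bochner_Integration.integral_cong)

lemma dirichlet_sym:
  assumes "graphon W" "bounded_fun a f" "bounded_fun b g"
  shows "dirichlet W f g = dirichlet W g f"
  unfolding dirichlet_def using weighted_sym[OF assms] by (simp add: mult.commute)

lemma dirichlet_add:
  assumes "graphon W" "bounded_fun a f" "bounded_fun b g" "bounded_fun c h"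
  shows "dirichlet W (\<lambda>x. f x + g x) h = dirichlet W f h + dirichlet W g h"
proof -
  note W = graphon_integrable[OF assms(1)]
  have "(\<lambda>x. (f x + g x) * h x) = (\<lambda>x. f x * h x + g x * h x)" by (simp add: algebra_simps)
  then show ?thesis unfolding dirichlet_def
    using weighted_add[OF W assms(2-4)]
      weighted_add[OF W bounded_fun_mult[OF assms(2,4)] bounded_fun_mult[OF assms(3,4)] bounded_fun_1]
    by simp
qed

lemma integral_combination:
  fixes f g h :: "'a \<Rightarrow> real"
  assumes "integrable M f" "integrable M g" "integrable M h"
  shows "2 * (\<integral>x. f x \<partial>M) - (\<integral>x. g x \<partial>M) - (\<integral>x. h x \<partial>M) = (\<integral>x. 2 * f x - g x - h x \<partial>M)"
  using assms by simp

text \<open>Symmetrising the diagonal term turns twice the form into minus the integral of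
  \<open>W x y\<close> times the square of \<open>f x - f y\<close>.\<close>

lemma dirichlet_nonpos:
  assumes W: "graphon W" and f: "bounded_fun a f"
  shows "dirichlet W f f \<le> 0"
proof -
  note ff = bounded_fun_mult[OF f f]
  note int = integrable_weighted[OF graphon_integrable[OF W]]
  have "2 * dirichlet W f f = 2 * weighted W f f - weighted W (\<lambda>x. f x * f x) (\<lambda>_. 1) - weighted W (\<lambda>_. 1) (\<lambda>x. f x * f x)"
    using weighted_sym[OF W ff bounded_fun_1] by (simp add: dirichlet_def)
  also have "\<dots> = (\<integral>p. 2 * (case p of (x, y) \<Rightarrow> W x y * f x * f y) - (case p of (x, y) \<Rightarrow> W x y * (f x * f x) * 1)
      - (case p of (x, y) \<Rightarrow> W x y * 1 * (f y * f y)) \<partial>I01_sq)"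
    unfolding weighted_def
    using int[OF f f] int[OF ff bounded_fun_1] int[OF bounded_fun_1 ff]
    by (rule integral_combination)
  also have "\<dots> \<le> 0"
  proof -
    have "0 \<le> (\<integral>p. - (2 * (case p of (x, y) \<Rightarrow> W x y * f x * f y) - (case p of (x, y) \<Rightarrow> W x y * (f x * f x) * 1)
      - (case p of (x, y) \<Rightarrow> W x y * 1 * (f y * f y))) \<partial>I01_sq)"
    proof (rule Bochner_Integration.integral_nonneg_AE, rule AE_I2)
      fix p assume "p \<in> space I01_sq"
      then obtain x y where p: "p = (x, y)" and x: "x \<in> {0<..<1}" and y: "y \<in> {0<..<1}"
        by (auto simp: space_pair_measure)
      have "0 \<le> W x y * (f x - f y)\<^sup>2" using graphon_nonneg[OF W x y] by simp
      then show "0 \<le> - (2 * (case p of (x, y) \<Rightarrow> W x y * f x * f y) - (case p of (x, y) \<Rightarrow> W x y * (f x * f x) * 1)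
      - (case p of (x, y) \<Rightarrow> W x y * 1 * (f y * f y)))"
        by (simp add: p power2_eq_square algebra_simps)
    qed
    then show ?thesis by (simp only: Bochner_Integration.integral_minus)
  qed
  finally show ?thesis by simp
qed

lemma dirichlet_eq_diffusion:
  assumes W: "integrable I01_sq (\<lambda>(x, y). W x y)" and f: "bounded_fun a f" and g: "bounded_fun b g"
  shows "dirichlet W f g = (\<integral>x. f x * diffusion W g x \<partial>I01)"
    and "integrable I01 (\<lambda>x. f x * diffusion W g x)"
proof -
  have fg: "bounded_fun (a * b) (\<lambda>x. f x * g x)" by (rule bounded_fun_mult[OF f g])
  have int: "integrable I01_sq (\<lambda>(x, y). W x y * f x * g y - W x y * (f x * g x) * 1)"
    using Bochner_Integration.integrable_diff[OF integrable_weighted[OF W f g] integrable_weighted[OF W fg bounded_fun_1]]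
    by (simp add: case_prod_beta')
  have eq: "(\<integral>y. W x y * f x * g y - W x y * (f x * g x) * 1 \<partial>I01) = f x * diffusion W g x" for x
    unfolding diffusion_def
    by (subst Bochner_Integration.integral_mult_right_zero[symmetric])
       (auto simp: algebra_simps intro!: Bochner_Integration.integral_cong)
  have "dirichlet W f g = (\<integral>(x, y). W x y * f x * g y - W x y * (f x * g x) * 1 \<partial>I01_sq)"
    unfolding dirichlet_def weighted_def
    using integrable_weighted[OF W f g] integrable_weighted[OF W fg bounded_fun_1]
    by (subst Bochner_Integration.integral_diff[symmetric]) (auto simp: case_prod_beta')
  also have "\<dots> = (\<integral>x. f x * diffusion W g x \<partial>I01)"
    unfolding eq[symmetric] by (rule I01_pair.integral_fst'[OF int, symmetric, unfolded case_prod_conv])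
  finally show "dirichlet W f g = (\<integral>x. f x * diffusion W g x \<partial>I01)" .
  show "integrable I01 (\<lambda>x. f x * diffusion W g x)"
    unfolding eq[symmetric] using I01_pair.integrable_fst'[OF int] by simp
qed

text \<open>A real supremum dominates its members only if the set is bounded above; the L1 norm of
  \<open>V\<close> provides the bound. Fubini identifies the iterated integrals with
  \<open>weighted\<close>.\<close>

lemma weighted_le_cut_norm:
  assumes V: "integrable I01_sq (\<lambda>(x, y). V x y)" and f: "bounded_fun 1 f" and g: "bounded_fun 1 g"
  shows "weighted V f g \<le> cut_norm V"
proof -
  let ?A = "{\<phi> \<in> borel_measurable I01. \<forall>x\<in>{0<..<1}. \<phi> x \<in> {-1..1}} :: (real \<Rightarrow> real) set"
  have A_iff: "\<phi> \<in> ?A \<longleftrightarrow> bounded_fun 1 \<phi>" for \<phi>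
    by (auto simp: bounded_fun_def abs_le_iff)
  have eq: "(\<integral>y. (\<integral>x. V x y * \<phi> x * \<psi> y \<partial>I01) \<partial>I01) = weighted V \<phi> \<psi>"
    if "bounded_fun 1 \<phi>" "bounded_fun 1 \<psi>" for \<phi> \<psi>
    unfolding weighted_def
    by (rule I01_pair.integral_snd[OF integrable_weighted[OF V that]])
  have le: "weighted V \<phi> \<psi> \<le> (\<integral>(x, y). \<bar>V x y\<bar> \<partial>I01_sq)" 
    if "bounded_fun 1 \<phi>" "bounded_fun 1 \<psi>" for \<phi> \<psi>
    unfolding weighted_def
  proof (rule integral_mono)
    show "integrable I01_sq (\<lambda>(x, y). V x y * \<phi> x * \<psi> y)" by (rule integrable_weighted[OF V that])
    show "integrable I01_sq (\<lambda>(x, y). \<bar>V x y\<bar>)"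
      using integrable_abs[OF V] by (simp add: case_prod_beta')
    fix p assume "p \<in> space I01_sq"
    then obtain x y where p: "p = (x, y)" and x: "x \<in> {0<..<1}" and y: "y \<in> {0<..<1}"
      by (auto simp: space_pair_measure)
    have "\<bar>\<phi> x\<bar> * \<bar>\<psi> y\<bar> \<le> 1 * 1"
      using bounded_fun_abs_le[OF that(1) x] bounded_fun_abs_le[OF that(2) y] by (intro mult_mono) auto
    then have "\<bar>V x y\<bar> * (\<bar>\<phi> x\<bar> * \<bar>\<psi> y\<bar>) \<le> \<bar>V x y\<bar> * 1"
      by (intro mult_left_mono) auto
    then have "\<bar>V x y * \<phi> x * \<psi> y\<bar> \<le> \<bar>V x y\<bar>" by (simp add: abs_mult mult.assoc)
    then show "(case p of (x, y) \<Rightarrow> V x y * \<phi> x * \<psi> y) \<le> (case p of (x, y) \<Rightarrow> \<bar>V x y\<bar>)"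
      by (simp add: p)
  qed
  have bdd: "bdd_above ((\<lambda>(\<phi>, \<psi>). \<integral>y. (\<integral>x. V x y * \<phi> x * \<psi> y \<partial>I01) \<partial>I01) ` (?A \<times> ?A))"
  proof (intro bdd_aboveI2)
    fix p assume "p \<in> ?A \<times> ?A"
    then obtain \<phi> \<psi> where p: "p = (\<phi>, \<psi>)" and "\<phi> \<in> ?A" "\<psi> \<in> ?A" by blast
    then have "bounded_fun 1 \<phi>" "bounded_fun 1 \<psi>" by (simp_all only: A_iff)
    from le[OF this] eq[OF this]
    show "(case p of (\<phi>, \<psi>) \<Rightarrow> \<integral>y. (\<integral>x. V x y * \<phi> x * \<psi> y \<partial>I01) \<partial>I01) \<le> (\<integral>(x, y). \<bar>V x y\<bar> \<partial>I01_sq)"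
      by (simp add: p)
  qed
  have "(case (f, g) of (\<phi>, \<psi>) \<Rightarrow> \<integral>y. (\<integral>x. V x y * \<phi> x * \<psi> y \<partial>I01) \<partial>I01) \<le> cut_norm V"
    unfolding cut_norm_def
  proof (rule cSUP_upper[OF _ bdd])
    show "(f, g) \<in> ?A \<times> ?A" unfolding mem_Sigma_iff A_iff using f g by blast
  qed
  then show ?thesis using eq[OF f g] by simp
qed

text \<open>The increments of \<open>v\<close> are at most \<open>2 * U\<close> and the degree is at
  most 1 almost everywhere.\<close>

lemma diffusion_abs_le:
  assumes W: "graphon W" and v: "bounded_fun U v"
  shows "AE x in I01. \<bar>diffusion W v x\<bar> \<le> 2 * U"
proof -
  have "AE x in I01. integrable I01 (W x)"
    using I01_pair.AE_integrable_fst'[OF graphon_integrable[OF W]] by simp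
  with graphon_degree_le[OF W] AE_space show ?thesis
  proof eventually_elim
    case (elim x)
    then have x: "x \<in> {0<..<1}" by simp
    have U: "0 \<le> U" using bounded_fun_abs_le[OF v x] by linarith
    have "\<bar>diffusion W v x\<bar> \<le> (\<integral>y. \<bar>W x y * (v y - v x)\<bar> \<partial>I01)"
      unfolding diffusion_def by (rule integral_abs_bound)
    also have "\<dots> \<le> (\<integral>y. W x y * (2 * U) \<partial>I01)"
    proof (rule integral_mono')
      show "integrable I01 (\<lambda>y. W x y * (2 * U))" using elim by auto
      fix y assume "y \<in> space I01"
      then have y: "y \<in> {0<..<1}" by simp
      have "\<bar>v y - v x\<bar> \<le> 2 * U" using bounded_fun_abs_le[OF v x] bounded_fun_abs_le[OF v y] by linarith
      then show "\<bar>W x y * (v y - v x)\<bar> \<le> W x y * (2 * U)"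
        using graphon_nonneg[OF W x y] by (simp add: abs_mult mult_left_mono)
      show "0 \<le> W x y * (2 * U)" using graphon_nonneg[OF W x y] U by simp
    qed
    also have "\<dots> = graphon_degree W x * (2 * U)"
      unfolding graphon_degree_def by simp
    also have "\<dots> \<le> 1 * (2 * U)" using elim U by (intro mult_right_mono) auto
    finally show ?case by simp
  qed
qed

lemma diffusion_measurable:
  assumes W: "graphon W" and v: "bounded_fun U v"
  shows "diffusion W v \<in> borel_measurable I01"
  using dirichlet_eq_diffusion(2)[OF graphon_integrable[OF W] bounded_fun_1 v] by auto

text \<open>The cut norm sees only L1 quantities, and the sup bound \<open>4 * U\<close> upgrades to
  L2. The L1 norm costs \<open>2 * U\<close> cut norms, one \<open>U\<close> for each bilinear term
  of the form; the product of the two factors is the constant 8.\<close>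

lemma diffusion_diff_L2:
  assumes W': "graphon W'" and W: "graphon W" and v: "bounded_fun U v" and U: "0 < U"
  shows "(\<integral>x. (diffusion W' v x - diffusion W v x)\<^sup>2 \<partial>I01) \<le> 8 * U\<^sup>2 * cut_norm (\<lambda>x y. W' x y - W x y)"
    and "integrable I01 (\<lambda>x. (diffusion W' v x - diffusion W v x)\<^sup>2)"
proof -
  let ?V = "\<lambda>x y. W' x y - W x y"
  define g where "g x = diffusion W' v x - diffusion W v x" for x
  \<comment> \<open>The sign of the difference, as a test function: pairing with it yields the L1
    norm.\<close>
  define \<sigma> where "\<sigma> x = (if 0 \<le> g x then 1 else - 1 :: real)" for x
  note W'i = graphon_integrable[OF W'] and Wi = graphon_integrable[OF W]
  have V: "integrable I01_sq (\<lambda>(x, y). ?V x y)"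
    using Bochner_Integration.integrable_diff[OF W'i Wi] by (simp add: case_prod_beta')
  note [measurable] = diffusion_measurable[OF W' v] diffusion_measurable[OF W v]
  have [measurable]: "g \<in> borel_measurable I01"
    unfolding g_def[abs_def] by measurable
  have g_le: "AE x in I01. \<bar>g x\<bar> \<le> 4 * U"
    using diffusion_abs_le[OF W' v] diffusion_abs_le[OF W v]
    by eventually_elim (auto simp: g_def)
  show "integrable I01 (\<lambda>x. (diffusion W' v x - diffusion W v x)\<^sup>2)"
  proof (rule I01.integrable_const_bound[where B="(4 * U)\<^sup>2"])
    show "AE x in I01. norm ((diffusion W' v x - diffusion W v x)\<^sup>2) \<le> (4 * U)\<^sup>2"
      using g_le
    proof eventually_elim
      case (elim x)
      then have "\<bar>g x\<bar>\<^sup>2 \<le> (4 * U)\<^sup>2" by (rule power_mono) simp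
      then show ?case by (simp add: g_def)
    qed
  qed (unfold g_def[symmetric], measurable)
  have g_int: "integrable I01 (\<lambda>x. \<bar>g x\<bar>)"
  proof (rule I01.integrable_const_bound[where B="4 * U"])
    show "AE x in I01. norm \<bar>g x\<bar> \<le> 4 * U" using g_le by simp
  qed measurable
  have \<sigma>: "bounded_fun 1 \<sigma>"
  proof -
    have "{x\<in>space I01. 0 \<le> g x} \<in> sets I01" by (rule borel_measurable_le) auto
    then have "(\<lambda>x. if 0 \<le> g x then 1 else - 1 :: real) \<in> borel_measurable I01"
      by (intro measurable_If) (auto simp: pred_def)
    then show ?thesis by (simp add: bounded_fun_def \<sigma>_def[abs_def])
  qed
  have "(\<integral>x. \<bar>g x\<bar> \<partial>I01) = (\<integral>x. \<sigma> x * diffusion W' v x - \<sigma> x * diffusion W v x \<partial>I01)"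
    by (intro Bochner_Integration.integral_cong refl)
       (simp add: \<sigma>_def g_def)
  also have "\<dots> = dirichlet W' \<sigma> v - dirichlet W \<sigma> v"
    using dirichlet_eq_diffusion[OF W'i \<sigma> v] dirichlet_eq_diffusion[OF Wi \<sigma> v] by simp
  also have "\<dots> = weighted ?V \<sigma> v - weighted ?V (\<lambda>x. \<sigma> x * v x) (\<lambda>_. 1)"
  proof -
    have *: "weighted ?V f h = weighted W' f h - weighted W f h" if "bounded_fun a f" "bounded_fun b h" for a b f h
      unfolding weighted_def
      using integrable_weighted[OF W'i that] integrable_weighted[OF Wi that]
      by (subst Bochner_Integration.integral_diff[symmetric])
         (auto simp: case_prod_beta' algebra_simps intro!: Bochner_Integration.integral_cong)
    show ?thesis
      using *[OF \<sigma> v] *[OF bounded_fun_mult[OF \<sigma> v] bounded_fun_1] by (simp add: dirichlet_def)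
  qed
  also have "weighted ?V \<sigma> v = U * weighted ?V \<sigma> (\<lambda>x. v x / U)"
    using U by (subst weighted_mult_right[symmetric]) simp
  \<comment> \<open>\<open>cut_norm\<close> is a supremum without absolute values, so the minus sign
    is moved into the test function, which is also scaled to size 1.\<close>
  also have "weighted ?V (\<lambda>x. \<sigma> x * v x) (\<lambda>_. 1) = - U * weighted ?V (\<lambda>x. - (\<sigma> x * v x) / U) (\<lambda>_. 1)"
    using U by (subst weighted_mult_left[symmetric]) simp
  also have "U * weighted ?V \<sigma> (\<lambda>x. v x / U) - (- U * weighted ?V (\<lambda>x. - (\<sigma> x * v x) / U) (\<lambda>_. 1))
     \<le> U * cut_norm ?V + U * cut_norm ?V"
  proof -
    have "bounded_fun 1 (\<lambda>x. v x / U)"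
      using v U by (auto simp: bounded_fun_def divide_le_eq)
    moreover have "bounded_fun 1 (\<lambda>x. - (\<sigma> x * v x) / U)"
      using bounded_fun_mult[OF \<sigma> v] U by (auto simp: bounded_fun_def divide_le_eq)
    ultimately have "weighted ?V \<sigma> (\<lambda>x. v x / U) \<le> cut_norm ?V"
      "weighted ?V (\<lambda>x. - (\<sigma> x * v x) / U) (\<lambda>_. 1) \<le> cut_norm ?V"
      using weighted_le_cut_norm[OF V] \<sigma> bounded_fun_1 by blast+
    then have "U * weighted ?V \<sigma> (\<lambda>x. v x / U) \<le> U * cut_norm ?V"
      "U * weighted ?V (\<lambda>x. - (\<sigma> x * v x) / U) (\<lambda>_. 1) \<le> U * cut_norm ?V"
      using U by (auto intro: mult_left_mono)
    then show ?thesis by simp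
  qed
  finally have L1: "(\<integral>x. \<bar>g x\<bar> \<partial>I01) \<le> 2 * U * cut_norm ?V" by simp
  have "(\<integral>x. (g x)\<^sup>2 \<partial>I01) \<le> (\<integral>x. 4 * U * \<bar>g x\<bar> \<partial>I01)"
  proof (rule integral_mono_AE')
    show "integrable I01 (\<lambda>x. 4 * U * \<bar>g x\<bar>)" using g_int by simp
    show "AE x in I01. (g x)\<^sup>2 \<le> 4 * U * \<bar>g x\<bar>"
      using g_le
    proof eventually_elim
      case (elim x)
      then have "\<bar>g x\<bar> * \<bar>g x\<bar> \<le> 4 * U * \<bar>g x\<bar>" by (rule mult_right_mono) simp
      then show ?case by (simp add: power2_eq_square)
    qed
    show "AE x in I01. 0 \<le> 4 * U * \<bar>g x\<bar>" using U by simp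
  qed
  also have "\<dots> = 4 * U * (\<integral>x. \<bar>g x\<bar> \<partial>I01)" by simp
  also have "\<dots> \<le> 4 * U * (2 * U * cut_norm ?V)" using L1 U by (intro mult_left_mono) auto
  finally show "(\<integral>x. (diffusion W' v x - diffusion W v x)\<^sup>2 \<partial>I01) \<le> 8 * U\<^sup>2 * cut_norm ?V"
    by (simp add: g_def power2_eq_square)
qed

text \<open>With \<open>e + v\<close> in the role of the particle density, the form of
  \<open>e\<close> with itself is dropped and symmetry moves the operator onto the fixed profile
  \<open>v\<close>, so operators are compared only on a bounded function. Young's inequality then
  costs one copy of the squared norm of \<open>e\<close>.\<close>

lemma drift_estimate:
  assumes W': "graphon W'" and W: "graphon W" and v: "bounded_fun U v" and U: "0 < U" and e: "bounded_fun a e"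
  shows "2 * dirichlet W' (\<lambda>x. e x + v x) e - 2 * (\<integral>x. e x * diffusion W v x \<partial>I01) \<le>
     (\<integral>x. (e x)\<^sup>2 \<partial>I01) + 8 * U\<^sup>2 * cut_norm (\<lambda>x y. W' x y - W x y)"
proof -
  let ?g = "\<lambda>x. diffusion W' v x - diffusion W v x"
  note i1 = dirichlet_eq_diffusion[OF graphon_integrable[OF W'] e v]
    and i2 = dirichlet_eq_diffusion[OF graphon_integrable[OF W] e v]
  have e2: "integrable I01 (\<lambda>x. (e x)\<^sup>2)"
    using integrable_bounded_fun[OF bounded_fun_mult[OF e e]] by (simp add: power2_eq_square)
  have "dirichlet W' (\<lambda>x. e x + v x) e = dirichlet W' e e + dirichlet W' e v"
    using dirichlet_add[OF W' e v e] dirichlet_sym[OF W' v e] by simp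
  also have "\<dots> \<le> (\<integral>x. e x * diffusion W' v x \<partial>I01)"
    using dirichlet_nonpos[OF W' e] i1 by simp
  finally have "2 * dirichlet W' (\<lambda>x. e x + v x) e - 2 * (\<integral>x. e x * diffusion W v x \<partial>I01) \<le>
     2 * ((\<integral>x. e x * diffusion W' v x \<partial>I01) - (\<integral>x. e x * diffusion W v x \<partial>I01))" by simp
  also have "\<dots> = (\<integral>x. 2 * (e x * diffusion W' v x - e x * diffusion W v x) \<partial>I01)"
    using i1(2) i2(2) by simp
  also have "\<dots> \<le> (\<integral>x. (e x)\<^sup>2 + (?g x)\<^sup>2 \<partial>I01)"
  proof (rule integral_mono)
    show "integrable I01 (\<lambda>x. 2 * (e x * diffusion W' v x - e x * diffusion W v x))" using i1(2) i2(2) by simp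
    show "integrable I01 (\<lambda>x. (e x)\<^sup>2 + (?g x)\<^sup>2)"
      using e2 diffusion_diff_L2(2)[OF W' W v U] by simp
    fix x
    show "2 * (e x * diffusion W' v x - e x * diffusion W v x) \<le> (e x)\<^sup>2 + (?g x)\<^sup>2"
      using sum_squares_bound[of "e x" "?g x"] by (simp add: algebra_simps)
  qed
  also have "\<dots> = (\<integral>x. (e x)\<^sup>2 \<partial>I01) + (\<integral>x. (?g x)\<^sup>2 \<partial>I01)"
    using e2 diffusion_diff_L2(2)[OF W' W v U] by simp
  also have "\<dots> \<le> (\<integral>x. (e x)\<^sup>2 \<partial>I01) + 8 * U\<^sup>2 * cut_norm (\<lambda>x y. W' x y - W x y)"
    using diffusion_diff_L2(1)[OF W' W v U] by simp
  finally show ?thesis .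
qed

section \<open>Step functions\<close>

declare Bochner_Integration.sum_mult_indicator [simp del] Bochner_Integration.sum_indicator_mult [simp del]
  Indicator_Function.sum_mult_indicator [simp del] Indicator_Function.sum_indicator_mult [simp del]

lemma cell_bounds:
  assumes "k \<in> {1..n}" "x \<in> cell n k"
  shows "real k - 1 < real n * x" "real n * x \<le> real k" "0 < x" "x < 1"
proof -
  have n: "0 < real n" using assms by auto
  show 1: "real k - 1 < real n * x" "real n * x \<le> real k"
    using assms n by (auto simp: cell_def field_simps split: if_splits)
  have "0 < real n * x" using 1 assms by auto
  then show "0 < x" using n by (simp add: zero_less_mult_iff)
  show "x < 1"
  proof (cases "k = n")
    case False
    then have "real k < real n" using assms by auto
    then have "real n * x < real n * 1" using 1 by linarith
    then show ?thesis using mult_less_cancel_left_pos[OF n] by blast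
  qed (use assms in \<open>simp add: cell_def\<close>)
qed

lemma cell_unique: "k \<in> {1..n} \<Longrightarrow> j \<in> {1..n} \<Longrightarrow> x \<in> cell n k \<Longrightarrow> x \<in> cell n j \<Longrightarrow> k = j"
  using cell_bounds[of k n x] cell_bounds[of j n x] by linarith

lemma cell_borel [measurable]: "cell n k \<in> sets borel"
  by (simp add: cell_def)

lemma indicator_cell_measurable [measurable]: "indicator (cell n k) \<in> borel_measurable I01"
  by (intro measurable_restrict_space1) simp

lemma integral_indicator_cell:
  assumes k: "k \<in> {1..n}"
  shows "(\<integral>x. indicat_real (cell n k) x \<partial>I01) = 1 / real n"
proof -
  have "(\<integral>x. indicat_real (cell n k) x \<partial>I01) = (\<integral>x. indicat_real {0<..<1} x * indicat_real (cell n k) x \<partial>lborel)"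
    by (subst integral_restrict_space) auto
  also have "\<dots> = (\<integral>x. indicat_real (cell n k) x \<partial>lborel)"
    using cell_bounds[OF k] by (intro Bochner_Integration.integral_cong) (auto simp: indicator_def)
  also have "\<dots> = measure lborel (cell n k)" by simp
  also have "\<dots> = 1 / real n"
    using k by (auto simp: cell_def field_simps)
  finally show ?thesis .
qed

text \<open>Positive measure yields a point, also in the last cell, which lacks its right end
  point.\<close>

lemma cell_ex: "k \<in> {1..n} \<Longrightarrow> \<exists>x. x \<in> cell n k"
  using integral_indicator_cell[of k n] by (cases "cell n k = {}") auto

lemma bounded_fun_indicator_cell: "bounded_fun 1 (indicator (cell n k))"
  by (auto simp: bounded_fun_def)

lemma step_fun_eq: "k \<in> {1..n} \<Longrightarrow> x \<in> cell n k \<Longrightarrow> step_fun n f x = f k"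
proof -
  assume k: "k \<in> {1..n}" "x \<in> cell n k"
  have "f j * indicator (cell n j) x = (if j = k then f k else 0)" if "j \<in> {1..n}" for j
  proof (cases "j = k")
    case False
    then have "x \<notin> cell n j" using cell_unique[OF that k(1) _ k(2)] by blast
    then show ?thesis using False by simp
  qed (use k in simp)
  then have "step_fun n f x = (\<Sum>j\<in>{1..n}. if j = k then f k else 0)"
    unfolding step_fun_def by (intro sum.cong refl)
  then show ?thesis using k by simp
qed

lemma step_fun_outside: "(\<And>k. k \<in> {1..n} \<Longrightarrow> x \<notin> cell n k) \<Longrightarrow> step_fun n f x = 0"
  unfolding step_fun_def by (intro sum.neutral) (auto simp: indicator_def)

text \<open>Outside the cells a step function is 0, so the identity at every real \<open>x\<close>
  rests on \<open>g 0 = 0\<close>; this holds for the reaction term.\<close>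

lemma step_fun_compose:
  assumes "g 0 = 0"
  shows "step_fun n (\<lambda>k. g (f k)) x = g (step_fun n f x)"
proof (cases "\<exists>k\<in>{1..n}. x \<in> cell n k")
  case True then show ?thesis by (auto simp: step_fun_eq)
next
  case False
  then have "step_fun n h x = 0" for h by (intro step_fun_outside) auto
  then show ?thesis using assms by simp
qed

lemma step_fun_add: "step_fun n (\<lambda>k. f k + g k) x = step_fun n f x + step_fun n g x"
  by (simp add: step_fun_def distrib_right sum.distrib)

lemma bounded_fun_step: "bounded_fun (\<Sum>k\<in>{1..n}. \<bar>f k\<bar>) (step_fun n f)"
proof -
  have "step_fun n f \<in> borel_measurable I01"
    unfolding step_fun_def[abs_def] by measurable
  moreover have "\<bar>step_fun n f x\<bar> \<le> (\<Sum>k\<in>{1..n}. \<bar>f k\<bar>)" for x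
  proof -
    have "\<bar>step_fun n f x\<bar> \<le> (\<Sum>k\<in>{1..n}. \<bar>f k * indicator (cell n k) x\<bar>)"
      unfolding step_fun_def by (rule sum_abs)
    also have "\<dots> \<le> (\<Sum>k\<in>{1..n}. \<bar>f k\<bar>)"
      by (rule sum_mono) (simp add: indicator_def)
    finally show ?thesis .
  qed
  ultimately show ?thesis by (simp add: bounded_fun_def)
qed

definition cell_integral :: "nat \<Rightarrow> (real \<Rightarrow> real) \<Rightarrow> nat \<Rightarrow> real" where
  "cell_integral n g k = (\<integral>x. indicator (cell n k) x * g x \<partial>I01)"

lemma integrable_indicator_cell:
  "bounded_fun U g \<Longrightarrow> integrable I01 (\<lambda>x. indicator (cell n k) x * g x)"
  by (rule integrable_bounded_fun[OF bounded_fun_mult[OF bounded_fun_indicator_cell]])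

lemma integral_step_mult:
  assumes g: "bounded_fun U g"
  shows "(\<integral>x. step_fun n f x * g x \<partial>I01) = (\<Sum>k\<in>{1..n}. f k * cell_integral n g k)"
proof -
  have "(\<integral>x. step_fun n f x * g x \<partial>I01) = (\<integral>x. (\<Sum>k\<in>{1..n}. f k * (indicator (cell n k) x * g x)) \<partial>I01)"
    by (simp add: step_fun_def sum_distrib_right mult.assoc)
  also have "\<dots> = (\<Sum>k\<in>{1..n}. (\<integral>x. f k * (indicator (cell n k) x * g x) \<partial>I01))"
    using integrable_indicator_cell[OF g] by (intro Bochner_Integration.integral_sum) simp
  finally show ?thesis by (simp add: cell_integral_def)
qed

lemma cell_integral_step:
  assumes "k \<in> {1..n}"
  shows "cell_integral n (step_fun n f) k = f k / real n"
proof -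
  have "cell_integral n (step_fun n f) k = (\<integral>x. f k * indicator (cell n k) x \<partial>I01)"
    unfolding cell_integral_def using step_fun_eq[OF assms]
    by (intro Bochner_Integration.integral_cong) (auto simp: indicator_def)
  then show ?thesis using integral_indicator_cell[OF assms] by simp
qed

lemma cell_integral_step_mult:
  assumes "k \<in> {1..n}"
  shows "cell_integral n (\<lambda>x. step_fun n f x * g x) k = f k * cell_integral n g k"
proof -
  have "cell_integral n (\<lambda>x. step_fun n f x * g x) k = (\<integral>x. f k * (indicator (cell n k) x * g x) \<partial>I01)"
    unfolding cell_integral_def using step_fun_eq[OF assms]
    by (intro Bochner_Integration.integral_cong) (auto simp: indicator_def)
  then show ?thesis by (simp add: cell_integral_def)
qed

lemma cell_integral_1: "k \<in> {1..n} \<Longrightarrow> cell_integral n (\<lambda>_. 1) k = 1 / real n"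
  unfolding cell_integral_def mult_1_right by (rule integral_indicator_cell)

lemma integral_step:
  "(\<integral>x. step_fun n f x \<partial>I01) = (\<Sum>k\<in>{1..n}. f k) / real n"
  using integral_step_mult[OF bounded_fun_1, of n f]
  by (simp add: cell_integral_1 sum_divide_distrib)

lemma step_graphon_eq: "step_graphon n A x y = step_fun n (\<lambda>i. step_fun n (A i) y) x"
  by (simp add: step_graphon_def step_fun_def sum_distrib_right sum_distrib_left mult_ac)

text \<open>The bridge between integrals and the sums over nodes that the generator
  produces.\<close>

lemma weighted_step_graphon:
  assumes W: "integrable I01_sq (\<lambda>(x, y). step_graphon n A x y)"
    and f: "bounded_fun a f" and g: "bounded_fun b g"
  shows "weighted (step_graphon n A) f g =
    (\<Sum>i\<in>{1..n}. \<Sum>j\<in>{1..n}. A i j * cell_integral n f i * cell_integral n g j)"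
proof -
  define h where "h i = (\<Sum>j\<in>{1..n}. A i j * cell_integral n g j)" for i
  have inner: "(\<integral>y. step_graphon n A x y * f x * g y \<partial>I01) = step_fun n h x * f x" for x
  proof -
    have "(\<integral>y. step_graphon n A x y * f x * g y \<partial>I01) =
       (\<integral>y. (\<Sum>i\<in>{1..n}. indicator (cell n i) x * f x * (step_fun n (A i) y * g y)) \<partial>I01)"
      by (intro Bochner_Integration.integral_cong refl)
         (simp add: step_graphon_eq step_fun_def[of n "\<lambda>i. step_fun n (A i) _"] sum_distrib_right sum_distrib_left mult_ac)
    also have "\<dots> = (\<Sum>i\<in>{1..n}. (\<integral>y. indicator (cell n i) x * f x * (step_fun n (A i) y * g y) \<partial>I01))"
      using integrable_bounded_fun[OF bounded_fun_mult[OF bounded_fun_step g]]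
      by (intro Bochner_Integration.integral_sum) simp
    also have "\<dots> = (\<Sum>i\<in>{1..n}. indicator (cell n i) x * f x * h i)"
      unfolding h_def integral_step_mult[OF g, symmetric] by simp
    also have "\<dots> = step_fun n h x * f x"
      by (simp add: step_fun_def sum_distrib_right sum_distrib_left mult_ac)
    finally show ?thesis .
  qed
  have "weighted (step_graphon n A) f g = (\<integral>x. (\<integral>y. step_graphon n A x y * f x * g y \<partial>I01) \<partial>I01)"
    unfolding weighted_def
    using I01_pair.integral_fst'[OF integrable_weighted[OF W f g]] by simp
  also have "\<dots> = (\<Sum>i\<in>{1..n}. h i * cell_integral n f i)"
    unfolding inner by (rule integral_step_mult[OF f])
  finally show ?thesis by (simp add: h_def sum_distrib_right sum_distrib_left mult_ac)
qed

definition energy :: "nat \<Rightarrow> (real \<Rightarrow> real) \<Rightarrow> (nat \<Rightarrow> real) \<Rightarrow> real" where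
  "energy n v f = (\<integral>x. (step_fun n f x - v x)\<^sup>2 \<partial>I01)"

text \<open>The energy is quadratic, so the second-order expansion is exact. For a jump of size
  \<open>1 / ell\<close> the linear part becomes drift and the quadratic part becomes noise.\<close>

lemma energy_add:
  assumes v: "bounded_fun U v"
  shows "energy n v (\<lambda>k. f k + w k) - energy n v f =
    2 * (\<Sum>k\<in>{1..n}. w k * cell_integral n (\<lambda>x. step_fun n f x - v x) k) + (\<Sum>k\<in>{1..n}. (w k)\<^sup>2) / real n"
proof -
  let ?e = "\<lambda>x. step_fun n f x - v x"
  note e = bounded_fun_diff[OF bounded_fun_step[where n=n and f=f] v]
  note w = bounded_fun_step[where n=n and f=w]
  have 1: "integrable I01 (\<lambda>x. (?e x)\<^sup>2)" "integrable I01 (\<lambda>x. step_fun n w x * ?e x)"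
    "integrable I01 (\<lambda>x. step_fun n w x * step_fun n w x)"
    using integrable_bounded_fun[OF bounded_fun_mult[OF e e]] integrable_bounded_fun[OF bounded_fun_mult[OF w e]]
     integrable_bounded_fun[OF bounded_fun_mult[OF w w]] by (auto simp: power2_eq_square)
  have "energy n v (\<lambda>k. f k + w k) = (\<integral>x. (?e x)\<^sup>2 + 2 * (step_fun n w x * ?e x) + step_fun n w x * step_fun n w x \<partial>I01)"
    unfolding energy_def step_fun_add
    by (intro Bochner_Integration.integral_cong) (auto simp: power2_eq_square algebra_simps)
  also have "\<dots> = energy n v f + 2 * (\<integral>x. step_fun n w x * ?e x \<partial>I01) + (\<integral>x. step_fun n w x * step_fun n w x \<partial>I01)"
    using 1 by (simp add: energy_def)
  finally show ?thesis
    unfolding integral_step_mult[OF e] integral_step_mult[OF w]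
    by (simp add: cell_integral_step sum_divide_distrib power2_eq_square)
qed

lemma energy_cong: "(\<And>k. k \<in> {1..n} \<Longrightarrow> f k = g k) \<Longrightarrow> energy n v f = energy n v g"
  unfolding energy_def step_fun_def by simp

section \<open>The generator of the particle process\<close>

lemma step_graphon_nonneg:
  assumes "graphon (step_graphon n A)" "i \<in> {1..n}" "j \<in> {1..n}"
  shows "0 \<le> A i j"
proof -
  obtain x y where x: "x \<in> cell n i" and y: "y \<in> cell n j" using cell_ex assms by metis
  have "step_graphon n A x y = A i j" using assms x y by (simp add: step_graphon_eq step_fun_eq)
  moreover have "0 \<le> step_graphon n A x y"
    using cell_bounds[OF assms(2) x] cell_bounds[OF assms(3) y] by (intro graphon_nonneg[OF assms(1)]) auto
  ultimately show ?thesis by simp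
qed

text \<open>The degree is constant on each cell and cells have positive measure, so the bound valid
  almost everywhere holds at every node.\<close>

lemma step_graphon_degree:
  assumes W: "graphon (step_graphon n A)" and i: "i \<in> {1..n}"
  shows "(\<Sum>j\<in>{1..n}. A i j) / real n \<le> 1"
proof (rule ccontr)
  assume gt: "\<not> ?thesis"
  have "graphon_degree (step_graphon n A) x = (\<Sum>j\<in>{1..n}. A i j) / real n" if "x \<in> cell n i" for x
    unfolding graphon_degree_def step_graphon_eq using step_fun_eq[OF i that] by (simp add: integral_step)
  with gt have "AE x in I01. indicat_real (cell n i) x = 0"
    using graphon_degree_le[OF W] by (auto elim!: eventually_mono simp: indicator_def)
  then have "(\<integral>x. indicat_real (cell n i) x \<partial>I01) = 0" by (rule integral_eq_zero_AE)
  with i show False unfolding integral_indicator_cell[OF i] by simp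
qed

section \<open>The generator as a sum over transitions\<close>

definition hop :: "(nat \<Rightarrow> nat) \<Rightarrow> nat \<Rightarrow> nat \<Rightarrow> nat \<Rightarrow> nat" where
  "hop x k i = (\<lambda>j. x j + unit_vec i j - unit_vec k j)"

definition birth :: "(nat \<Rightarrow> nat) \<Rightarrow> nat \<Rightarrow> nat \<Rightarrow> nat" where
  "birth x k = (\<lambda>j. x j + unit_vec k j)"

definition death :: "(nat \<Rightarrow> nat) \<Rightarrow> nat \<Rightarrow> nat \<Rightarrow> nat" where
  "death x k = (\<lambda>j. x j - unit_vec k j)"

text \<open>A finite superset of the support of the rates. It may contain \<open>x\<close> itself,
  as for a hop from a node to itself, where increments vanish.\<close>

definition targets :: "nat \<Rightarrow> (nat \<Rightarrow> nat) \<Rightarrow> (nat \<Rightarrow> nat) set" where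
  "targets n x = (\<lambda>p. hop x (fst p) (snd p)) ` ({1..n} \<times> {1..n}) \<union> birth x ` {1..n} \<union> death x ` {1..n}"

lemma finite_targets: "finite (targets n x)"
  by (simp add: targets_def)

lemma targets_subset: "x \<in> configs n \<Longrightarrow> targets n x \<subseteq> configs n"
  by (auto simp: targets_def hop_def birth_def death_def PiE_def extensional_def)

lemma particle_rate_alt:
  "particle_rate n A ell b d x y =
     (\<Sum>p\<in>{1..n} \<times> {1..n}. if y = hop x (fst p) (snd p) then real (x (fst p)) * A (fst p) (snd p) / real n else 0) +
     (\<Sum>k\<in>{1..n}. if y = birth x k then ell * b (real (x k) / ell) else 0) +
     (\<Sum>k\<in>{1..n}. if y = death x k then ell * d (real (x k) / ell) else 0)"
  unfolding particle_rate_def hop_def birth_def death_def sum.cartesian_product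
  by (simp add: case_prod_beta')

lemma particle_rate_support:
  assumes "particle_rate n A ell b d x z \<noteq> 0"
  shows "z \<in> targets n x"
proof (rule ccontr)
  assume "z \<notin> targets n x"
  then have "\<forall>p\<in>{1..n} \<times> {1..n}. z \<noteq> hop x (fst p) (snd p)"
    "\<forall>k\<in>{1..n}. z \<noteq> birth x k" "\<forall>k\<in>{1..n}. z \<noteq> death x k"
    unfolding targets_def by blast+
  then have "(\<Sum>p\<in>{1..n} \<times> {1..n}. if z = hop x (fst p) (snd p) then real (x (fst p)) * A (fst p) (snd p) / real n else 0) = 0"
    "(\<Sum>k\<in>{1..n}. if z = birth x k then ell * b (real (x k) / ell) else 0) = 0"
    "(\<Sum>k\<in>{1..n}. if z = death x k then ell * d (real (x k) / ell) else 0) = 0"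
    by (intro sum.neutral ballI if_not_P; blast)+
  with assms show False unfolding particle_rate_alt by simp
qed

lemma particle_rate_finite_support: "finite {z \<in> configs n. particle_rate n A ell b d x z \<noteq> 0}"
  by (rule finite_subset[OF _ finite_targets[of n x]]) (auto dest: particle_rate_support)

text \<open>Several transitions may share a target, where their rates add up; exchanging the sums
  separates them again.\<close>

lemma sum_delta_mult:
  fixes r :: "'i \<Rightarrow> real"
  assumes "finite T" "finite I" "\<And>i. i \<in> I \<Longrightarrow> g i \<in> T"
  shows "(\<Sum>z\<in>T. (\<Sum>i\<in>I. if z = g i then r i else 0) * D z) = (\<Sum>i\<in>I. r i * D (g i))"
proof -
  have "(\<Sum>z\<in>T. (\<Sum>i\<in>I. if z = g i then r i else 0) * D z) = (\<Sum>i\<in>I. \<Sum>z\<in>T. if z = g i then r i * D z else 0)"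
    by (subst sum.swap) (auto simp: sum_distrib_right intro!: sum.cong)
  also have "\<dots> = (\<Sum>i\<in>I. r i * D (g i))"
    using assms by (intro sum.cong refl) (simp add: sum.delta)
  finally show ?thesis .
qed

text \<open>Enlarging the index set to \<open>targets\<close> changes nothing, since the increment
  is 0 at \<open>x\<close> and the rate is 0 off the support. The sum then splits transition by
  transition.\<close>

lemma particle_generator:
  assumes x: "x \<in> configs n"
  shows "(\<Sum>z | z \<in> configs n - {x} \<and> particle_rate n A ell b d x z \<noteq> 0.
            particle_rate n A ell b d x z * (\<phi> z - \<phi> x)) =
     (\<Sum>k\<in>{1..n}. \<Sum>i\<in>{1..n}. real (x k) * A k i / real n * (\<phi> (hop x k i) - \<phi> x)) +
     (\<Sum>k\<in>{1..n}. ell * b (real (x k) / ell) * (\<phi> (birth x k) - \<phi> x)) +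
     (\<Sum>k\<in>{1..n}. ell * d (real (x k) / ell) * (\<phi> (death x k) - \<phi> x))"
proof -
  let ?T = "targets n x" and ?D = "\<lambda>z. \<phi> z - \<phi> x"
  have "(\<Sum>z | z \<in> configs n - {x} \<and> particle_rate n A ell b d x z \<noteq> 0.
            particle_rate n A ell b d x z * ?D z) = (\<Sum>z\<in>?T. particle_rate n A ell b d x z * ?D z)"
  proof (rule sum.mono_neutral_left)
    show "finite ?T" by (rule finite_targets)
    show "{z. z \<in> configs n - {x} \<and> particle_rate n A ell b d x z \<noteq> 0} \<subseteq> ?T"
      using particle_rate_support by blast
    show "\<forall>z\<in>?T - {z. z \<in> configs n - {x} \<and> particle_rate n A ell b d x z \<noteq> 0}.
       particle_rate n A ell b d x z * ?D z = 0"
      using targets_subset[OF x] by auto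
  qed
  also have "\<dots> = (\<Sum>p\<in>{1..n} \<times> {1..n}. real (x (fst p)) * A (fst p) (snd p) / real n * ?D (hop x (fst p) (snd p))) +
     (\<Sum>k\<in>{1..n}. ell * b (real (x k) / ell) * ?D (birth x k)) +
     (\<Sum>k\<in>{1..n}. ell * d (real (x k) / ell) * ?D (death x k))"
  proof -
    have "(\<Sum>z\<in>?T. (\<Sum>p\<in>{1..n} \<times> {1..n}. if z = hop x (fst p) (snd p) then real (x (fst p)) * A (fst p) (snd p) / real n else 0) * ?D z) =
      (\<Sum>p\<in>{1..n} \<times> {1..n}. real (x (fst p)) * A (fst p) (snd p) / real n * ?D (hop x (fst p) (snd p)))"
      by (rule sum_delta_mult[OF finite_targets]) (auto simp: targets_def)
    moreover have "(\<Sum>z\<in>?T. (\<Sum>k\<in>{1..n}. if z = birth x k then ell * b (real (x k) / ell) else 0) * ?D z) =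
      (\<Sum>k\<in>{1..n}. ell * b (real (x k) / ell) * ?D (birth x k))"
      by (rule sum_delta_mult[OF finite_targets]) (auto simp: targets_def)
    moreover have "(\<Sum>z\<in>?T. (\<Sum>k\<in>{1..n}. if z = death x k then ell * d (real (x k) / ell) else 0) * ?D z) =
      (\<Sum>k\<in>{1..n}. ell * d (real (x k) / ell) * ?D (death x k))"
      by (rule sum_delta_mult[OF finite_targets]) (auto simp: targets_def)
    ultimately show ?thesis
      unfolding particle_rate_alt distrib_right sum.distrib by simp
  qed
  also have "(\<Sum>p\<in>{1..n} \<times> {1..n}. real (x (fst p)) * A (fst p) (snd p) / real n * ?D (hop x (fst p) (snd p))) =
     (\<Sum>k\<in>{1..n}. \<Sum>i\<in>{1..n}. real (x k) * A k i / real n * ?D (hop x k i))"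
    by (simp add: sum.cartesian_product case_prod_beta')
  finally show ?thesis .
qed

section \<open>The generator applied to the squared distance from a profile\<close>

context
  fixes n :: nat and A :: "nat \<Rightarrow> nat \<Rightarrow> real" and ell :: real and b d :: "real \<Rightarrow> real"
    and v :: "real \<Rightarrow> real" and U :: real and x :: "nat \<Rightarrow> nat"
  assumes n: "1 \<le> n" and graph: "graph_on n A" and Wn: "graphon (step_graphon n A)"
    and ell: "0 < ell" and d0: "d 0 = 0" and b0: "b 0 = 0" and v: "bounded_fun U v"
begin

abbreviation (input) "scaled z \<equiv> \<lambda>k. real (z k) / ell"
abbreviation (input) "err \<equiv> \<lambda>y. step_fun n (scaled x) y - v y"
abbreviation (input) "err_cell \<equiv> cell_integral n err"

lemma bounded_fun_err: "bounded_fun ((\<Sum>k\<in>{1..n}. \<bar>scaled x k\<bar>) + U) err"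
  by (rule bounded_fun_diff[OF bounded_fun_step v])

text \<open>The rate stays as a factor because it vanishes exactly where the increment formula could
  fail: at an empty node, where subtraction truncates, and for \<open>k = i\<close>, where
  \<open>A k k = 0\<close>. Two nodes change by \<open>1 / ell\<close>, hence the 2 in the quadratic
  term.\<close>

lemma hop_energy:
  assumes k: "k \<in> {1..n}" and i: "i \<in> {1..n}"
  shows "real (x k) * A k i / real n * (energy n v (scaled (hop x k i)) - energy n v (scaled x)) =
    real (x k) * A k i / real n * (2 / ell * (err_cell i - err_cell k) + 2 / (ell\<^sup>2 * real n))"
proof (cases "x k = 0 \<or> A k i = 0")
  case True then show ?thesis by auto
next
  case False
  then have "k \<noteq> i" using graph k by (auto simp: graph_on_def)
  let ?w = "\<lambda>j. (of_bool (j = i) - of_bool (j = k)) / ell"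
  have "energy n v (scaled (hop x k i)) = energy n v (\<lambda>j. scaled x j + ?w j)"
    using False ell by (intro energy_cong) (auto simp: hop_def of_nat_diff field_simps)
  then have "energy n v (scaled (hop x k i)) - energy n v (scaled x) =
     2 * (\<Sum>j\<in>{1..n}. ?w j * err_cell j) + (\<Sum>j\<in>{1..n}. (?w j)\<^sup>2) / real n"
    using energy_add[OF v, of n "scaled x" ?w] by simp
  also have "(\<Sum>j\<in>{1..n}. ?w j * err_cell j) = (\<Sum>j\<in>{1..n}. (if j = i then err_cell j / ell else 0) - (if j = k then err_cell j / ell else 0))"
    by (intro sum.cong) (auto simp: field_simps)
  also have "\<dots> = (err_cell i - err_cell k) / ell"
    using i k by (simp add: sum_subtractf diff_divide_distrib)
  also have "(\<Sum>j\<in>{1..n}. (?w j)\<^sup>2) = (\<Sum>j\<in>{1..n}. (if j = i then 1 / ell\<^sup>2 else 0) + (if j = k then 1 / ell\<^sup>2 else 0))"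
    using \<open>k \<noteq> i\<close> by (intro sum.cong) (auto simp: power_divide)
  also have "\<dots> = 2 / ell\<^sup>2" using i k by (simp add: sum.distrib)
  finally show ?thesis by (simp add: field_simps)
qed

lemma birth_energy:
  assumes k: "k \<in> {1..n}"
  shows "energy n v (scaled (birth x k)) - energy n v (scaled x) = 2 / ell * err_cell k + 1 / (ell\<^sup>2 * real n)"
proof -
  let ?w = "\<lambda>j. of_bool (j = k) / ell"
  have "energy n v (scaled (birth x k)) = energy n v (\<lambda>j. scaled x j + ?w j)"
    by (intro energy_cong) (auto simp: birth_def add_divide_distrib)
  then have "energy n v (scaled (birth x k)) - energy n v (scaled x) =
     2 * (\<Sum>j\<in>{1..n}. ?w j * err_cell j) + (\<Sum>j\<in>{1..n}. (?w j)\<^sup>2) / real n"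
    using energy_add[OF v, of n "scaled x" ?w] by simp
  also have "(\<Sum>j\<in>{1..n}. ?w j * err_cell j) = (\<Sum>j\<in>{1..n}. if j = k then err_cell j / ell else 0)"
    by (intro sum.cong) auto
  also have "(\<Sum>j\<in>{1..n}. (?w j)\<^sup>2) = (\<Sum>j\<in>{1..n}. if j = k then 1 / ell\<^sup>2 else 0)"
    by (intro sum.cong) (auto simp: power_divide)
  finally show ?thesis using k by simp
qed

text \<open>As for hops, truncated subtraction at an empty node is harmless because
  \<open>d 0 = 0\<close>.\<close>

lemma death_energy:
  assumes k: "k \<in> {1..n}"
  shows "ell * d (scaled x k) * (energy n v (scaled (death x k)) - energy n v (scaled x)) =
    ell * d (scaled x k) * (- 2 / ell * err_cell k + 1 / (ell\<^sup>2 * real n))"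
proof (cases "x k = 0")
  case True then show ?thesis using d0 by simp
next
  case False
  let ?w = "\<lambda>j. - of_bool (j = k) / ell"
  have "energy n v (scaled (death x k)) = energy n v (\<lambda>j. scaled x j + ?w j)"
    using False ell by (intro energy_cong) (auto simp: death_def of_nat_diff field_simps)
  then have "energy n v (scaled (death x k)) - energy n v (scaled x) =
     2 * (\<Sum>j\<in>{1..n}. ?w j * err_cell j) + (\<Sum>j\<in>{1..n}. (?w j)\<^sup>2) / real n"
    using energy_add[OF v, of n "scaled x" ?w] by simp
  also have "(\<Sum>j\<in>{1..n}. ?w j * err_cell j) = (\<Sum>j\<in>{1..n}. if j = k then - err_cell j / ell else 0)"
    by (intro sum.cong) auto
  also have "(\<Sum>j\<in>{1..n}. (?w j)\<^sup>2) = (\<Sum>j\<in>{1..n}. if j = k then 1 / ell\<^sup>2 else 0)"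
    by (intro sum.cong) (auto simp: power_divide)
  finally show ?thesis using k by simp
qed

text \<open>The linear parts of hops give the form of the step graphon, those of births and deaths
  the pairing with the reaction term. The quadratic parts collect in the last summand, which is
  \<open>1 / ell\<close> times an average of total rates over nodes.\<close>

lemma particle_generator_energy:
  assumes x: "x \<in> configs n"
  shows "(\<Sum>z | z \<in> configs n - {x} \<and> particle_rate n A ell b d x z \<noteq> 0.
            particle_rate n A ell b d x z * (energy n v (scaled z) - energy n v (scaled x))) =
     2 * dirichlet (step_graphon n A) (step_fun n (scaled x)) err
     + 2 * (\<integral>y. (b (step_fun n (scaled x) y) - d (step_fun n (scaled x) y)) * err y \<partial>I01)
     + ((\<Sum>k\<in>{1..n}. 2 * scaled x k * ((\<Sum>i\<in>{1..n}. A k i) / real n)) + (\<Sum>k\<in>{1..n}. b (scaled x k) + d (scaled x k))) / (ell * real n)"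
proof -
  define f where "f = scaled x"
  define e where "e = err_cell"
  note err = bounded_fun_err
  have xk: "real (x k) = ell * f k" for k using ell by (simp add: f_def)
  have W: "integrable I01_sq (\<lambda>(x, y). step_graphon n A x y)" by (rule graphon_integrable[OF Wn])
  have dir: "dirichlet (step_graphon n A) (step_fun n f) err =
     (\<Sum>k\<in>{1..n}. \<Sum>i\<in>{1..n}. f k * A k i / real n * (e i - e k))"
  proof -
    have "dirichlet (step_graphon n A) (step_fun n f) err =
      (\<Sum>k\<in>{1..n}. \<Sum>i\<in>{1..n}. A k i * (f k / real n) * e i) - (\<Sum>k\<in>{1..n}. \<Sum>i\<in>{1..n}. A k i * (f k * e k) * (1 / real n))"
      unfolding dirichlet_def weighted_step_graphon[OF W bounded_fun_step err]
        weighted_step_graphon[OF W bounded_fun_mult[OF bounded_fun_step err] bounded_fun_1]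
      by (intro arg_cong2[where f="(-)"] sum.cong refl)
         (simp_all add: cell_integral_step cell_integral_step_mult cell_integral_1 e_def)
    then show ?thesis by (simp add: sum_subtractf[symmetric] algebra_simps diff_divide_distrib)
  qed
  have react: "(\<integral>y. (b (step_fun n f y) - d (step_fun n f y)) * err y \<partial>I01) = (\<Sum>k\<in>{1..n}. (b (f k) - d (f k)) * e k)"
  proof -
    have "b (step_fun n f y) - d (step_fun n f y) = step_fun n (\<lambda>k. b (f k) - d (f k)) y" for y
      using step_fun_compose[of "\<lambda>r. b r - d r" n f] b0 d0 by auto
    then show ?thesis unfolding e_def by (simp only: integral_step_mult[OF err])
  qed
  have "(\<Sum>z | z \<in> configs n - {x} \<and> particle_rate n A ell b d x z \<noteq> 0.
            particle_rate n A ell b d x z * (energy n v (scaled z) - energy n v (scaled x))) =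
    (\<Sum>k\<in>{1..n}. \<Sum>i\<in>{1..n}. real (x k) * A k i / real n * (2 / ell * (e i - e k) + 2 / (ell\<^sup>2 * real n))) +
    (\<Sum>k\<in>{1..n}. ell * b (f k) * (2 / ell * e k + 1 / (ell\<^sup>2 * real n))) +
    (\<Sum>k\<in>{1..n}. ell * d (f k) * (- 2 / ell * e k + 1 / (ell\<^sup>2 * real n)))"
    unfolding particle_generator[OF x, where \<phi>="\<lambda>z. energy n v (scaled z)"] e_def f_def
    by (intro arg_cong2[where f="(+)"] sum.cong refl)
       (simp_all only: hop_energy birth_energy death_energy)
  also have "(\<Sum>k\<in>{1..n}. \<Sum>i\<in>{1..n}. real (x k) * A k i / real n * (2 / ell * (e i - e k) + 2 / (ell\<^sup>2 * real n))) =
     2 * (\<Sum>k\<in>{1..n}. \<Sum>i\<in>{1..n}. f k * A k i / real n * (e i - e k)) +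
     (\<Sum>k\<in>{1..n}. 2 * f k * ((\<Sum>i\<in>{1..n}. A k i) / real n)) / (ell * real n)"
    unfolding xk sum_distrib_left sum_divide_distrib sum.distrib[symmetric]
    by (intro sum.cong refl) (use ell n in \<open>simp add: field_simps power2_eq_square\<close>)
  also have "(\<Sum>k\<in>{1..n}. ell * b (f k) * (2 / ell * e k + 1 / (ell\<^sup>2 * real n))) =
     (\<Sum>k\<in>{1..n}. 2 * (b (f k) * e k) + b (f k) / (ell * real n))"
    by (intro sum.cong refl) (use ell n in \<open>simp add: field_simps power2_eq_square\<close>)
  also have "(\<Sum>k\<in>{1..n}. ell * d (f k) * (- 2 / ell * e k + 1 / (ell\<^sup>2 * real n))) =
     (\<Sum>k\<in>{1..n}. - 2 * (d (f k) * e k) + d (f k) / (ell * real n))"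
    by (intro sum.cong refl) (use ell n in \<open>simp add: field_simps power2_eq_square\<close>)
  also have "2 * (\<Sum>k\<in>{1..n}. \<Sum>i\<in>{1..n}. f k * A k i / real n * (e i - e k)) +
     (\<Sum>k\<in>{1..n}. 2 * f k * ((\<Sum>i\<in>{1..n}. A k i) / real n)) / (ell * real n) +
     (\<Sum>k\<in>{1..n}. 2 * (b (f k) * e k) + b (f k) / (ell * real n)) +
     (\<Sum>k\<in>{1..n}. - 2 * (d (f k) * e k) + d (f k) / (ell * real n)) =
     2 * (\<Sum>k\<in>{1..n}. \<Sum>i\<in>{1..n}. f k * A k i / real n * (e i - e k)) +
     2 * (\<Sum>k\<in>{1..n}. (b (f k) - d (f k)) * e k) +
     ((\<Sum>k\<in>{1..n}. 2 * f k * ((\<Sum>i\<in>{1..n}. A k i) / real n)) + (\<Sum>k\<in>{1..n}. b (f k) + d (f k))) / (ell * real n)"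
    by (simp add: sum.distrib sum_negf sum_subtractf left_diff_distrib add_divide_distrib
        flip: sum_distrib_left sum_divide_distrib)
  finally show ?thesis unfolding dir[symmetric] react[symmetric] unfolding f_def .
qed

end

section \<open>Drift bound for bounded profiles\<close>

lemma cut_norm_nonneg:
  assumes "integrable I01_sq (\<lambda>(x, y). V x y)"
  shows "0 \<le> cut_norm V"
  using weighted_le_cut_norm[OF assms, of "\<lambda>_. 0" "\<lambda>_. 0"] by (simp add: bounded_fun_def weighted_def case_prod_beta')

lemma bounded_fun_lipschitz_compose:
  assumes L: "L-lipschitz_on UNIV g" and g0: "g 0 = 0" and v: "bounded_fun U v"
  shows "bounded_fun (L * U) (\<lambda>x. g (v x))"
proof -
  have "continuous_on UNIV g" by (rule lipschitz_on_continuous_on[OF L])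
  then have "g \<in> borel_measurable borel" by (rule borel_measurable_continuous_onI)
  then have "(\<lambda>x. g (v x)) \<in> borel_measurable I01"
    using bounded_funD[OF v] by (rule measurable_compose[rotated])
  moreover have "\<bar>g (v x)\<bar> \<le> L * U" if "x \<in> {0<..<1}" for x
  proof -
    have "\<bar>g (v x)\<bar> \<le> L * \<bar>v x\<bar>" using lipschitz_onD[OF L, of "v x" 0] g0 by (simp add: dist_real_def)
    also have "\<dots> \<le> L * U" using bounded_fun_abs_le[OF v that] lipschitz_on_nonneg[OF L] by (rule mult_left_mono)
    finally show ?thesis .
  qed
  ultimately show ?thesis by (simp add: bounded_fun_def)
qed

lemma add_three_le:
  fixes a b c p r e l w :: real
  assumes "a - 2 * p \<le> e" "b - 2 * r \<le> l" "c \<le> w"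
  shows "a + b + c - 2 * (p + r) \<le> e + l + w"
  using assms by argo

text \<open>In the growth rate, 1 comes from Young's inequality in the consistency error,
  \<open>2 * L\<close> from the reaction term and \<open>(2 + L) / ell\<close> from the jump noise.
  The noise is linear in the mean particle density, which the energy itself controls up to
  \<open>1 + U\<close>.\<close>

lemma energy_drift_bound:
  fixes b d :: "real \<Rightarrow> real"
  assumes n: "1 \<le> n" and graph: "graph_on n A" and Wn: "graphon (step_graphon n A)" and W: "graphon W"
    and ell: "0 < ell" and b: "Lb-lipschitz_on UNIV b" "b 0 = 0" and d: "Ld-lipschitz_on UNIV d" "d 0 = 0"
    and U: "0 < U" and v: "bounded_fun U v" and x: "x \<in> configs n"
    and v'_meas: "v' \<in> borel_measurable I01"
    and v': "AE y in I01. v' y = diffusion W v y + (b (v y) - d (v y))"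
  defines "f \<equiv> \<lambda>k. real (x k) / ell" and "L \<equiv> Lb + Ld"
  shows "(\<Sum>z | z \<in> configs n - {x} \<and> particle_rate n A ell b d x z \<noteq> 0.
            particle_rate n A ell b d x z * (energy n v (\<lambda>k. real (z k) / ell) - energy n v f))
       - 2 * (\<integral>y. (step_fun n f y - v y) * v' y \<partial>I01)
     \<le> (1 + 2 * L + (2 + L) / ell) * energy n v f
       + (8 * U\<^sup>2 * cut_norm (\<lambda>x y. step_graphon n A x y - W x y) + (2 + L) * (1 + U) / ell)"
proof -
  define err where "err y = step_fun n f y - v y" for y
  define \<Phi> where "\<Phi> r = b r - d r" for r
  define a where "a = (\<Sum>k\<in>{1..n}. \<bar>f k\<bar>) + U"
  have L0: "0 \<le> L" using lipschitz_on_nonneg[OF b(1)] lipschitz_on_nonneg[OF d(1)] by (simp add: L_def)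
  have err: "bounded_fun a err"
    unfolding err_def[abs_def] a_def by (rule bounded_fun_diff[OF bounded_fun_step v])
  have f0: "0 \<le> f k" for k using ell by (simp add: f_def)
  have \<Phi>: "L-lipschitz_on UNIV \<Phi>"
    unfolding \<Phi>_def[abs_def] L_def by (rule lipschitz_on_diff[OF b(1) d(1)])
  have \<Phi>0: "\<Phi> 0 = 0" using b d by (simp add: \<Phi>_def)
  note \<Phi>v = bounded_fun_lipschitz_compose[OF \<Phi> \<Phi>0 v]
    and \<Phi>X = bounded_fun_lipschitz_compose[OF \<Phi> \<Phi>0 bounded_fun_step[where n=n and f=f]]
  have err2: "integrable I01 (\<lambda>y. (err y)\<^sup>2)"
    using integrable_bounded_fun[OF bounded_fun_mult[OF err err]] by (simp add: power2_eq_square)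
  have energy: "energy n v f = (\<integral>y. (err y)\<^sup>2 \<partial>I01)" by (simp add: energy_def err_def)
  have diff_int: "integrable I01 (\<lambda>y. err y * diffusion W v y)"
    by (rule dirichlet_eq_diffusion(2)[OF graphon_integrable[OF W] err v])
  have i1: "integrable I01 (\<lambda>y. err y * \<Phi> (v y))" "integrable I01 (\<lambda>y. \<Phi> (step_fun n f y) * err y)"
    by (rule integrable_bounded_fun[OF bounded_fun_mult[OF err \<Phi>v]] integrable_bounded_fun[OF bounded_fun_mult[OF \<Phi>X err]])+
  have time: "(\<integral>y. err y * v' y \<partial>I01) = (\<integral>y. err y * diffusion W v y \<partial>I01) + (\<integral>y. err y * \<Phi> (v y) \<partial>I01)"
  proof -
    have "(\<integral>y. err y * v' y \<partial>I01) = (\<integral>y. err y * diffusion W v y + err y * \<Phi> (v y) \<partial>I01)"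
    proof (rule Bochner_Integration.integral_cong_AE)
      note [measurable] = v'_meas bounded_funD[OF err]
      show "(\<lambda>y. err y * v' y) \<in> borel_measurable I01" by measurable
      show "(\<lambda>y. err y * diffusion W v y + err y * \<Phi> (v y)) \<in> borel_measurable I01"
        using diff_int i1 by auto
      show "AE y in I01. err y * v' y = err y * diffusion W v y + err y * \<Phi> (v y)"
        using v' by eventually_elim (simp add: \<Phi>_def distrib_left)
    qed
    also have "\<dots> = (\<integral>y. err y * diffusion W v y \<partial>I01) + (\<integral>y. err y * \<Phi> (v y) \<partial>I01)"
      using diff_int i1 by simp
    finally show ?thesis .
  qed
  have drift: "2 * dirichlet (step_graphon n A) (step_fun n f) err - 2 * (\<integral>y. err y * diffusion W v y \<partial>I01)
     \<le> energy n v f + 8 * U\<^sup>2 * cut_norm (\<lambda>x y. step_graphon n A x y - W x y)"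
    using drift_estimate[OF Wn W v U err] by (simp add: energy err_def)
  have react: "2 * (\<integral>y. \<Phi> (step_fun n f y) * err y \<partial>I01) - 2 * (\<integral>y. err y * \<Phi> (v y) \<partial>I01) \<le> 2 * L * energy n v f"
  proof -
    have "(\<integral>y. \<Phi> (step_fun n f y) * err y \<partial>I01) - (\<integral>y. err y * \<Phi> (v y) \<partial>I01) =
      (\<integral>y. \<Phi> (step_fun n f y) * err y - err y * \<Phi> (v y) \<partial>I01)" using i1 by simp
    also have "\<dots> \<le> (\<integral>y. L * (err y)\<^sup>2 \<partial>I01)"
    proof (rule integral_mono)
      fix y
      have "\<Phi> (step_fun n f y) * err y - err y * \<Phi> (v y) = (\<Phi> (step_fun n f y) - \<Phi> (v y)) * err y"
        by (simp add: algebra_simps)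
      also have "\<dots> \<le> \<bar>\<Phi> (step_fun n f y) - \<Phi> (v y)\<bar> * \<bar>err y\<bar>"
        by (metis abs_ge_self abs_mult)
      also have "\<dots> \<le> (L * \<bar>err y\<bar>) * \<bar>err y\<bar>"
        using lipschitz_onD[OF \<Phi>, of "step_fun n f y" "v y"]
        by (intro mult_right_mono) (auto simp: dist_real_def err_def)
      finally show "\<Phi> (step_fun n f y) * err y - err y * \<Phi> (v y) \<le> L * (err y)\<^sup>2"
        by (simp add: power2_eq_square)
    qed (use i1 err2 in auto)
    finally show ?thesis by (simp add: energy)
  qed
  have noise: "((\<Sum>k\<in>{1..n}. 2 * f k * ((\<Sum>i\<in>{1..n}. A k i) / real n)) + (\<Sum>k\<in>{1..n}. b (f k) + d (f k))) / (ell * real n)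
    \<le> (2 + L) / ell * (energy n v f + (1 + U))"
  proof -
    \<comment> \<open>Degrees at most 1 bound the hops; births and deaths grow at most linearly,
      since both rates vanish at 0.\<close>
    have "(\<Sum>k\<in>{1..n}. 2 * f k * ((\<Sum>i\<in>{1..n}. A k i) / real n)) + (\<Sum>k\<in>{1..n}. b (f k) + d (f k))
      \<le> (\<Sum>k\<in>{1..n}. 2 * f k * 1) + (\<Sum>k\<in>{1..n}. L * f k)"
    proof (intro add_mono sum_mono mult_left_mono step_graphon_degree[OF Wn])
      fix k
      have "b (f k) \<le> Lb * f k" "d (f k) \<le> Ld * f k"
        using lipschitz_onD[OF b(1), of "f k" 0] lipschitz_onD[OF d(1), of "f k" 0] b d f0[of k]
        by (auto simp: dist_real_def)
      then show "b (f k) + d (f k) \<le> L * f k" by (simp add: L_def distrib_right)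
    qed (use f0 in auto)
    also have "\<dots> = (2 + L) * (\<Sum>k\<in>{1..n}. f k)" by (simp add: sum_distrib_left sum.distrib distrib_right)
    finally have "((\<Sum>k\<in>{1..n}. 2 * f k * ((\<Sum>i\<in>{1..n}. A k i) / real n)) + (\<Sum>k\<in>{1..n}. b (f k) + d (f k))) / (ell * real n)
      \<le> (2 + L) * (\<Sum>k\<in>{1..n}. f k) / (ell * real n)"
      using ell by (intro divide_right_mono) auto
    also have "\<dots> = (2 + L) / ell * (\<integral>y. step_fun n f y \<partial>I01)"
      by (simp add: integral_step)
    also have "\<dots> \<le> (2 + L) / ell * (energy n v f + (1 + U))"
    proof (rule mult_left_mono)
      \<comment> \<open>The density is \<open>err\<close> plus the profile, and \<open>err\<close>
        is at most its square plus 1.\<close>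
      have "(\<integral>y. step_fun n f y \<partial>I01) \<le> (\<integral>y. (err y)\<^sup>2 + (1 + U) \<partial>I01)"
      proof (rule integral_mono)
        show "integrable I01 (step_fun n f)" by (rule integrable_bounded_fun[OF bounded_fun_step])
        show "integrable I01 (\<lambda>y. (err y)\<^sup>2 + (1 + U))" using err2 by simp
        fix y assume "y \<in> space I01"
        then have "\<bar>v y\<bar> \<le> U" using bounded_fun_abs_le[OF v] by simp
        moreover have "2 * err y \<le> (err y)\<^sup>2 + 1" using sum_squares_bound[of "err y" 1] by simp
        then have "err y \<le> (err y)\<^sup>2 + 1" using zero_le_power2[of "err y"] by linarith
        ultimately show "step_fun n f y \<le> (err y)\<^sup>2 + (1 + U)" by (simp add: err_def)
      qed
      also have "\<dots> = energy n v f + (1 + U)" using err2 I01.prob_space by (simp add: energy)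
      finally show "(\<integral>y. step_fun n f y \<partial>I01) \<le> energy n v f + (1 + U)" .
    qed (use L0 ell in auto)
    finally show ?thesis .
  qed
  have gen: "(\<Sum>z | z \<in> configs n - {x} \<and> particle_rate n A ell b d x z \<noteq> 0.
            particle_rate n A ell b d x z * (energy n v (\<lambda>k. real (z k) / ell) - energy n v f)) =
     2 * dirichlet (step_graphon n A) (step_fun n f) err
     + 2 * (\<integral>y. \<Phi> (step_fun n f y) * err y \<partial>I01)
     + ((\<Sum>k\<in>{1..n}. 2 * f k * ((\<Sum>i\<in>{1..n}. A k i) / real n)) + (\<Sum>k\<in>{1..n}. b (f k) + d (f k))) / (ell * real n)"
    using particle_generator_energy[where n=n and A=A and ell=ell and b=b and d=d and v=v and U=U and x=x, OF n graph Wn ell d(2) b(2) v x]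
    unfolding f_def err_def[abs_def] \<Phi>_def .
  have alg: "(1 + 2 * L + (2 + L) / ell) * energy n v f + (c + (2 + L) * (1 + U) / ell)
    = energy n v f + c + 2 * L * energy n v f + (2 + L) / ell * (energy n v f + (1 + U))" for c
    by (simp add: algebra_simps add_divide_distrib)
  have time': "(\<integral>y. (step_fun n f y - v y) * v' y \<partial>I01) = (\<integral>y. err y * v' y \<partial>I01)" by (simp add: err_def)
  show ?thesis
    unfolding gen alg time' time by (rule add_three_le[OF drift react noise])
qed

section \<open>Curves in \<open>L\<^sup>\<infinity>\<close>\<close>

definition ess_bounded :: "real \<Rightarrow> (real \<Rightarrow> real) \<Rightarrow> bool" where
  "ess_bounded C f \<longleftrightarrow> f \<in> borel_measurable I01 \<and> (AE x in I01. \<bar>f x\<bar> \<le> C)"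

lemma ess_bounded_nonneg:
  assumes "ess_bounded C f"
  shows "0 \<le> C"
proof (rule ccontr)
  assume neg: "\<not> 0 \<le> C"
  have "AE x in I01. \<bar>f x\<bar> \<le> C" using assms by (simp add: ess_bounded_def)
  then have "AE x in I01. False" by eventually_elim (use neg in linarith)
  then show False using I01.AE_False by simp
qed

lemma ess_bounded_mono: "ess_bounded C f \<Longrightarrow> C \<le> C' \<Longrightarrow> ess_bounded C' f"
  unfolding ess_bounded_def by (auto elim!: eventually_mono)

lemma Linf_ess_bounded:
  assumes "f \<in> Linf"
  shows "\<exists>C. ess_bounded C f"
proof -
  have m: "f \<in> borel_measurable I01" and fin: "Linf_norm f < \<infinity>" using assms by (auto simp: Linf_def)
  have le: "AE x in I01. ereal \<bar>f x\<bar> \<le> Linf_norm f"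
    unfolding Linf_norm_def by (rule esssup_AE)
  have "AE x in I01. \<bar>f x\<bar> \<le> real_of_ereal (Linf_norm f)"
    using le
  proof eventually_elim
    case (elim x)
    with fin show ?case by (cases "Linf_norm f") auto
  qed
  with m show ?thesis unfolding ess_bounded_def by blast
qed

lemma Linf_tendsto_0:
  assumes "((\<lambda>s. Linf_norm (g s)) \<longlongrightarrow> 0) F" "0 < \<epsilon>"
  shows "\<forall>\<^sub>F s in F. AE x in I01. \<bar>g s x\<bar> \<le> \<epsilon>"
proof -
  have "\<forall>\<^sub>F s in F. Linf_norm (g s) < ereal \<epsilon>"
    using assms by (intro order_tendstoD(2)[OF assms(1)]) simp
  then show ?thesis
  proof eventually_elim
    case (elim s)
    have le: "AE x in I01. ereal \<bar>g s x\<bar> \<le> Linf_norm (g s)"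
      unfolding Linf_norm_def by (rule esssup_AE)
    then show ?case
    proof eventually_elim
      case (elim x)
      then have "ereal \<bar>g s x\<bar> < ereal \<epsilon>" using \<open>Linf_norm (g s) < ereal \<epsilon>\<close> by (rule le_less_trans)
      then show ?case by simp
    qed
  qed
qed

lemma integral_ess_bounded:
  assumes "ess_bounded C f"
  shows "\<bar>\<integral>x. f x \<partial>I01\<bar> \<le> C" and "integrable I01 f"
proof -
  have m: "f \<in> borel_measurable I01" and le: "AE x in I01. \<bar>f x\<bar> \<le> C" using assms by (auto simp: ess_bounded_def)
  show int: "integrable I01 f"
    using le m by (intro I01.integrable_const_bound[where B=C]) auto
  have "(\<integral>x. f x \<partial>I01) \<le> C"
    using le by (intro I01.integral_le_const[OF int]) (auto elim: eventually_mono)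
  moreover have "- C \<le> (\<integral>x. f x \<partial>I01)"
    using le by (intro I01.integral_ge_const[OF int]) (auto elim: eventually_mono)
  ultimately show "\<bar>\<integral>x. f x \<partial>I01\<bar> \<le> C" by simp
qed

locale C1_curve =
  fixes T :: real and u u' :: "real \<Rightarrow> real \<Rightarrow> real"
  assumes T_pos: "0 < T" and C1: "C1_Linf T u u'"
begin

lemma u_bound: "t \<in> {0..T} \<Longrightarrow> \<exists>C. ess_bounded C (u t)"
  and u'_bound: "t \<in> {0..T} \<Longrightarrow> \<exists>C. ess_bounded C (u' t)"
  using C1 Linf_ess_bounded unfolding C1_Linf_def by blast+

lemma u_measurable: "t \<in> {0..T} \<Longrightarrow> u t \<in> borel_measurable I01"
  and u'_measurable: "t \<in> {0..T} \<Longrightarrow> u' t \<in> borel_measurable I01"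
  using u_bound u'_bound by (auto simp: ess_bounded_def)

lemma difference_quotient:
  assumes "t \<in> {0..T}" "0 < \<epsilon>"
  shows "\<forall>\<^sub>F s in at t within {0..T}. AE x in I01. \<bar>(u s x - u t x) / (s - t) - u' t x\<bar> \<le> \<epsilon>"
  using C1 assms unfolding C1_Linf_def by (intro Linf_tendsto_0) auto

text \<open>Near \<open>t\<close> the difference quotient is within 1 of the derivative, hence
  bounded by \<open>C' + 1\<close>, and time increments are at most \<open>T\<close>.\<close>

lemma locally_bounded:
  assumes t: "t \<in> {0..T}"
  shows "\<exists>C \<delta>. 0 < \<delta> \<and> (\<forall>s\<in>{0..T}. \<bar>s - t\<bar> < \<delta> \<longrightarrow> ess_bounded C (u s))"
proof -
  obtain C where C: "ess_bounded C (u t)" using u_bound[OF t] by blast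
  obtain C' where C': "ess_bounded C' (u' t)" using u'_bound[OF t] by blast
  obtain \<delta> where \<delta>: "0 < \<delta>" "\<And>s. s \<in> {0..T} \<Longrightarrow> s \<noteq> t \<Longrightarrow> dist s t < \<delta> \<Longrightarrow>
      AE x in I01. \<bar>(u s x - u t x) / (s - t) - u' t x\<bar> \<le> 1"
    using difference_quotient[OF t, of 1] unfolding eventually_at by auto
  have "ess_bounded (C + T * (C' + 1)) (u s)" if s: "s \<in> {0..T}" "\<bar>s - t\<bar> < \<delta>" for s
  proof (cases "s = t")
    case True
    have "0 \<le> T * (C' + 1)" using T_pos ess_bounded_nonneg[OF C'] by simp
    then show ?thesis using C True by (auto intro: ess_bounded_mono)
  next
    case False
    have d: "AE x in I01. \<bar>(u s x - u t x) / (s - t) - u' t x\<bar> \<le> 1"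
      using \<delta>(2)[OF s(1) False] s(2) by (simp add: dist_real_def)
    have c: "AE x in I01. \<bar>u t x\<bar> \<le> C" and c': "AE x in I01. \<bar>u' t x\<bar> \<le> C'"
      using C C' by (auto simp: ess_bounded_def)
    have "AE x in I01. \<bar>u s x\<bar> \<le> C + T * (C' + 1)"
      using d c c'
    proof eventually_elim
      case (elim x)
      then have "\<bar>(u s x - u t x) / (s - t)\<bar> \<le> C' + 1" by linarith
      moreover have "\<bar>s - t\<bar> \<le> T" using s t by auto
      ultimately have "\<bar>s - t\<bar> * \<bar>(u s x - u t x) / (s - t)\<bar> \<le> T * (C' + 1)"
        by (intro mult_mono) auto
      moreover have "\<bar>s - t\<bar> * \<bar>(u s x - u t x) / (s - t)\<bar> = \<bar>u s x - u t x\<bar>"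
        using False by (simp add: abs_divide)
      ultimately have "\<bar>u s x - u t x\<bar> \<le> T * (C' + 1)" by simp
      then show ?case using elim(2) by linarith
    qed
    then show ?thesis using u_measurable[OF s(1)] by (simp add: ess_bounded_def)
  qed
  then show ?thesis using \<delta>(1) by blast
qed

text \<open>Compactness of the time interval turns the local bounds into one. The sum over a finite
  subcover replaces a maximum, and the added 1 makes it positive.\<close>

lemma uniformly_bounded: "\<exists>U>0. \<forall>t\<in>{0..T}. ess_bounded U (u t)"
proof -
  have "\<forall>t\<in>{0..T}. \<exists>p. 0 < snd p \<and> (\<forall>s\<in>{0..T}. \<bar>s - t\<bar> < snd p \<longrightarrow> ess_bounded (fst p) (u s))"
    using locally_bounded by fastforce
  then obtain p where p: "\<And>t. t \<in> {0..T} \<Longrightarrow> 0 < snd (p t)"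
    "\<And>t s. t \<in> {0..T} \<Longrightarrow> s \<in> {0..T} \<Longrightarrow> \<bar>s - t\<bar> < snd (p t) \<Longrightarrow> ess_bounded (fst (p t)) (u s)"
    by metis
  obtain I where I: "I \<subseteq> {0..T}" "finite I" "{0..T} \<subseteq> (\<Union>t\<in>I. ball t (snd (p t)))"
  proof (rule compactE_image[of "{0..T}" "{0..T}" "\<lambda>t. ball t (snd (p t))"])
    show "{0..T} \<subseteq> (\<Union>t\<in>{0..T}. ball t (snd (p t)))" using p(1) by fastforce
  qed auto
  define U where "U = 1 + (\<Sum>t\<in>I. \<bar>fst (p t)\<bar>)"
  have "ess_bounded U (u s)" if s: "s \<in> {0..T}" for s
  proof -
    obtain t where t: "t \<in> I" "dist t s < snd (p t)" using I(3) s by auto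
    then have "ess_bounded (fst (p t)) (u s)" using p(2)[of t s] s I(1) by (auto simp: dist_real_def abs_minus_commute)
    moreover have "\<bar>fst (p t)\<bar> \<le> (\<Sum>t\<in>I. \<bar>fst (p t)\<bar>)" using t I(2) by (intro member_le_sum) auto
    ultimately show ?thesis by (elim ess_bounded_mono) (simp add: U_def)
  qed
  moreover have "0 < U" unfolding U_def by (intro add_pos_nonneg sum_nonneg) auto
  ultimately show ?thesis by blast
qed

text \<open>The defining limits are in the essential supremum norm, so the difference quotient of
  the integrand is estimated uniformly in \<open>x\<close> and no limit under the integral has to be
  justified.\<close>

lemma energy_has_derivative:
  assumes t: "t \<in> {0..T}"
  shows "((\<lambda>s. energy n (u s) f) has_real_derivative
     - 2 * (\<integral>x. (step_fun n f x - u t x) * u' t x \<partial>I01)) (at t within {0..T})"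
proof -
  define e where "e x = step_fun n f x - u t x" for x
  define Q where "Q s x = (u s x - u t x) / (s - t)" for s x
  obtain C where C: "ess_bounded C (u t)" using u_bound[OF t] by blast
  obtain C' where C': "ess_bounded C' (u' t)" using u'_bound[OF t] by blast
  define R where "R = (\<Sum>k\<in>{1..n}. \<bar>f k\<bar>) + C"
  have R0: "0 \<le> R" and C0: "0 \<le> C'" using ess_bounded_nonneg[OF C] ess_bounded_nonneg[OF C']
    by (auto simp: R_def sum_nonneg)
  have step_m: "step_fun n f \<in> borel_measurable I01" using bounded_fun_step[where n=n and f=f] by (simp add: bounded_fun_def)
  have step_le: "AE x in I01. \<bar>step_fun n f x\<bar> \<le> (\<Sum>k\<in>{1..n}. \<bar>f k\<bar>)"
    using bounded_fun_abs_le[OF bounded_fun_step[where n=n and f=f]] by (intro AE_I2) simp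
  note [measurable] = step_m u_measurable[OF t] u'_measurable[OF t]
  have e_le: "AE x in I01. \<bar>e x\<bar> \<le> R"
  proof -
    have "AE x in I01. \<bar>u t x\<bar> \<le> C" using C by (simp add: ess_bounded_def)
    with step_le show ?thesis by eventually_elim (simp add: e_def R_def)
  qed
  have c': "AE x in I01. \<bar>u' t x\<bar> \<le> C'" using C' by (simp add: ess_bounded_def)
  have [measurable]: "e \<in> borel_measurable I01" unfolding e_def[abs_def] by measurable
  have square_int: "integrable I01 (\<lambda>x. (step_fun n f x - u s x)\<^sup>2)" if s: "s \<in> {0..T}" for s
  proof -
    obtain Cs where Cs: "ess_bounded Cs (u s)" using u_bound[OF s] by blast
    note [measurable] = u_measurable[OF s]
    have "AE x in I01. \<bar>u s x\<bar> \<le> Cs" using Cs by (simp add: ess_bounded_def)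
    with step_le have "AE x in I01. \<bar>(step_fun n f x - u s x)\<^sup>2\<bar> \<le> ((\<Sum>k\<in>{1..n}. \<bar>f k\<bar>) + Cs)\<^sup>2"
    proof eventually_elim
      case (elim x)
      then have "\<bar>step_fun n f x - u s x\<bar> \<le> (\<Sum>k\<in>{1..n}. \<bar>f k\<bar>) + Cs" by linarith
      then have "\<bar>step_fun n f x - u s x\<bar>\<^sup>2 \<le> ((\<Sum>k\<in>{1..n}. \<bar>f k\<bar>) + Cs)\<^sup>2" by (rule power_mono) simp
      then show ?case by simp
    qed
    then show ?thesis by (intro integral_ess_bounded(2)) (simp add: ess_bounded_def)
  qed
  have prod_int: "integrable I01 (\<lambda>x. e x * u' t x)"
  proof (rule integral_ess_bounded(2))
    have "AE x in I01. \<bar>e x * u' t x\<bar> \<le> R * C'"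
      using e_le c' by eventually_elim (auto simp: abs_mult intro!: mult_mono R0)
    then show "ess_bounded (R * C') (\<lambda>x. e x * u' t x)" by (simp add: ess_bounded_def)
  qed
  have main: "\<bar>(energy n (u s) f - energy n (u t) f) / (s - t) - (- 2 * (\<integral>x. e x * u' t x \<partial>I01))\<bar>
      \<le> 2 * R * \<nu> + \<bar>s - t\<bar> * (C' + \<nu>)\<^sup>2"
    if s: "s \<in> {0..T}" "s \<noteq> t" and q: "AE x in I01. \<bar>Q s x - u' t x\<bar> \<le> \<nu>" for s \<nu>
  proof -
    note [measurable] = u_measurable[OF s(1)]
    define h where "h x = ((step_fun n f x - u s x)\<^sup>2 - (e x)\<^sup>2) / (s - t) + 2 * (e x * u' t x)" for x
    have eq: "(energy n (u s) f - energy n (u t) f) / (s - t) - (- 2 * (\<integral>x. e x * u' t x \<partial>I01)) = (\<integral>x. h x \<partial>I01)"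
      unfolding h_def energy_def using square_int[OF s(1)] square_int[OF t] prod_int by (simp add: e_def)
    have "AE x in I01. \<bar>h x\<bar> \<le> 2 * R * \<nu> + \<bar>s - t\<bar> * (C' + \<nu>)\<^sup>2"
      using q e_le c'
    proof eventually_elim
      case (elim x)
      \<comment> \<open>Expanding the square with \<open>u s = u t + (s - t) * Q s\<close> leaves
        one term linear in the error of the difference quotient and one carrying the factor
        \<open>s - t\<close>.\<close>
      have us: "step_fun n f x - u s x = e x - (s - t) * Q s x" using s(2) by (simp add: e_def Q_def)
      have "h x = 2 * e x * (u' t x - Q s x) + (s - t) * (Q s x)\<^sup>2"
        unfolding h_def us using s(2) by (simp add: power2_eq_square field_simps)
      then have "\<bar>h x\<bar> \<le> \<bar>2 * e x * (u' t x - Q s x)\<bar> + \<bar>(s - t) * (Q s x)\<^sup>2\<bar>" by simp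
      also have "\<dots> \<le> 2 * R * \<nu> + \<bar>s - t\<bar> * (C' + \<nu>)\<^sup>2"
      proof (rule add_mono)
        have "\<bar>e x\<bar> * \<bar>u' t x - Q s x\<bar> \<le> R * \<nu>" using elim R0 by (intro mult_mono) (auto simp: abs_minus_commute)
        then show "\<bar>2 * e x * (u' t x - Q s x)\<bar> \<le> 2 * R * \<nu>" by (simp add: abs_mult)
        have "\<bar>Q s x\<bar> \<le> C' + \<nu>" using elim by linarith
        then have "\<bar>Q s x\<bar>\<^sup>2 \<le> (C' + \<nu>)\<^sup>2" by (rule power_mono) simp
        then show "\<bar>(s - t) * (Q s x)\<^sup>2\<bar> \<le> \<bar>s - t\<bar> * (C' + \<nu>)\<^sup>2" by (simp add: abs_mult mult_left_mono)
      qed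
      finally show ?case .
    qed
    moreover have "h \<in> borel_measurable I01" unfolding h_def[abs_def] by measurable
    ultimately have "ess_bounded (2 * R * \<nu> + \<bar>s - t\<bar> * (C' + \<nu>)\<^sup>2) h"
      by (simp add: ess_bounded_def)
    then show ?thesis unfolding eq by (rule integral_ess_bounded(1))
  qed
  show ?thesis
    unfolding has_field_derivative_iff
  proof (rule tendstoI)
    fix \<epsilon> :: real assume \<epsilon>: "0 < \<epsilon>"
    \<comment> \<open>Chosen so that the linear term is at most half of \<open>\<epsilon>\<close>;
      the radius \<open>\<delta>\<close> below leaves a quarter for the quadratic one. The cap 1
      lets \<open>C' + 1\<close> bound the quotient, and \<open>R + 1\<close> avoids division by
      zero.\<close>
    define \<nu> where "\<nu> = min 1 (\<epsilon> / (4 * (R + 1)))"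
    have \<nu>: "0 < \<nu>" "\<nu> \<le> 1" using \<epsilon> R0 by (auto simp: \<nu>_def)
    have "2 * R * \<nu> \<le> 2 * (R + 1) * (\<epsilon> / (4 * (R + 1)))"
      using R0 \<nu> by (intro mult_mono) (auto simp: \<nu>_def)
    also have "\<dots> = \<epsilon> / 2" using R0 by (simp add: field_simps)
    finally have R\<nu>: "2 * R * \<nu> \<le> \<epsilon> / 2" .
    define \<delta> where "\<delta> = \<epsilon> / (4 * (C' + 1)\<^sup>2)"
    have \<delta>: "0 < \<delta>" using \<epsilon> C0 by (simp add: \<delta>_def)
    have "\<forall>\<^sub>F s in at t within {0..T}. s \<in> {0..T} \<and> s \<noteq> t \<and> dist s t < \<delta>"
      using \<delta> by (auto simp: eventually_at)
    with difference_quotient[OF t \<nu>(1)]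
    show "\<forall>\<^sub>F s in at t within {0..T}. dist ((energy n (u s) f - energy n (u t) f) / (s - t))
       (- 2 * (\<integral>x. (step_fun n f x - u t x) * u' t x \<partial>I01)) < \<epsilon>"
    proof eventually_elim
      case (elim s)
      have "\<bar>s - t\<bar> * (C' + \<nu>)\<^sup>2 \<le> \<delta> * (C' + 1)\<^sup>2"
        using elim(2) \<nu> C0 by (intro mult_mono power_mono) (auto simp: dist_real_def)
      also have "\<dots> = \<epsilon> / 4" using C0 by (simp add: \<delta>_def)
      finally have "\<bar>s - t\<bar> * (C' + \<nu>)\<^sup>2 \<le> \<epsilon> / 4" .
      moreover have "\<bar>(energy n (u s) f - energy n (u t) f) / (s - t) - (- 2 * (\<integral>x. e x * u' t x \<partial>I01))\<bar>
        \<le> 2 * R * \<nu> + \<bar>s - t\<bar> * (C' + \<nu>)\<^sup>2"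
        using elim by (intro main) (auto simp: Q_def)
      ultimately show ?case using R\<nu> \<epsilon> by (simp add: dist_real_def e_def)
    qed
  qed
qed

end

section \<open>From everywhere bounded to essentially bounded profiles\<close>

lemma energy_cong_AE:
  assumes "v \<in> borel_measurable I01" "w \<in> borel_measurable I01" "AE x in I01. v x = w x"
  shows "energy n v f = energy n w f"
  unfolding energy_def
proof (rule Bochner_Integration.integral_cong_AE)
  have [measurable]: "step_fun n f \<in> borel_measurable I01" 
    using bounded_fun_step[where n=n and f=f] by (simp add: bounded_fun_def)
  note [measurable] = assms(1,2)
  show "(\<lambda>x. (step_fun n f x - v x)\<^sup>2) \<in> borel_measurable I01"
    "(\<lambda>x. (step_fun n f x - w x)\<^sup>2) \<in> borel_measurable I01" by measurable
  show "AE x in I01. (step_fun n f x - v x)\<^sup>2 = (step_fun n f x - w x)\<^sup>2"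
    using assms(3) by eventually_elim simp
qed

lemma diffusion_cong_AE:
  assumes W: "graphon W" and v: "v \<in> borel_measurable I01" and w: "w \<in> borel_measurable I01"
    and eq: "AE x in I01. v x = w x"
  shows "AE x in I01. diffusion W v x = diffusion W w x"
  using eq AE_space
proof eventually_elim
  case (elim x)
  have "(\<lambda>(x, y). W x y) \<in> borel_measurable I01_sq"
    using graphon_integrable[OF W] by auto
  from measurable_Pair2[OF this elim(2)] have [measurable]: "W x \<in> borel_measurable I01" by simp
  note [measurable] = v w
  show ?case unfolding diffusion_def
  proof (rule Bochner_Integration.integral_cong_AE)
    show "AE y in I01. W x y * (v y - v x) = W x y * (w y - w x)"
      using eq by eventually_elim (simp add: elim)
  qed measurable
qed

text \<open>Truncating \<open>v\<close> at \<open>U\<close> and \<open>- U\<close> alters it on a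
  null set only and provides the everywhere bound; every quantity involved ignores null
  sets.\<close>

lemma energy_drift_bound_ess:
  fixes b d :: "real \<Rightarrow> real"
  assumes n: "1 \<le> n" and graph: "graph_on n A" and Wn: "graphon (step_graphon n A)" and W: "graphon W"
    and ell: "0 < ell" and b: "Lb-lipschitz_on UNIV b" "b 0 = 0" and d: "Ld-lipschitz_on UNIV d" "d 0 = 0"
    and U: "0 < U" and v: "ess_bounded U v" and x: "x \<in> configs n"
    and v'_meas: "v' \<in> borel_measurable I01"
    and v': "AE y in I01. v' y = diffusion W v y + (b (v y) - d (v y))"
  defines "f \<equiv> \<lambda>k. real (x k) / ell" and "L \<equiv> Lb + Ld"
  shows "(\<Sum>z | z \<in> configs n - {x} \<and> particle_rate n A ell b d x z \<noteq> 0.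
            particle_rate n A ell b d x z * (energy n v (\<lambda>k. real (z k) / ell) - energy n v f))
       - 2 * (\<integral>y. (step_fun n f y - v y) * v' y \<partial>I01)
     \<le> (1 + 2 * L + (2 + L) / ell) * energy n v f
       + (8 * U\<^sup>2 * cut_norm (\<lambda>x y. step_graphon n A x y - W x y) + (2 + L) * (1 + U) / ell)"
proof -
  define w where "w y = max (- U) (min U (v y))" for y
  have v_m[measurable]: "v \<in> borel_measurable I01" using v by (simp add: ess_bounded_def)
  have w_m[measurable]: "w \<in> borel_measurable I01" unfolding w_def[abs_def] by measurable
  have w: "bounded_fun U w" using w_m U by (auto simp: bounded_fun_def w_def)
  have "AE y in I01. \<bar>v y\<bar> \<le> U" using v by (simp add: ess_bounded_def)
  then have eq: "AE y in I01. v y = w y" by eventually_elim (auto simp: w_def)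
  have w': "AE y in I01. v' y = diffusion W w y + (b (w y) - d (w y))"
    using v' eq diffusion_cong_AE[OF W v_m w_m eq] by eventually_elim simp
  note en = energy_cong_AE[OF v_m w_m eq]
  have [measurable]: "step_fun n f \<in> borel_measurable I01" 
    using bounded_fun_step[where n=n and f=f] by (simp add: bounded_fun_def)
  note [measurable] = v'_meas
  have time: "(\<integral>y. (step_fun n f y - v y) * v' y \<partial>I01) = (\<integral>y. (step_fun n f y - w y) * v' y \<partial>I01)"
  proof (rule Bochner_Integration.integral_cong_AE)
    show "AE y in I01. (step_fun n f y - v y) * v' y = (step_fun n f y - w y) * v' y"
      using eq by eventually_elim simp
  qed measurable
  show ?thesis unfolding en time
    unfolding f_def L_def
    by (rule energy_drift_bound[OF n graph Wn W ell b d U w x v'_meas w'])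
qed

text \<open>Dynkin's formula up to the first jump, with a derivative required only at interior times
  because the curve is differentiable just one-sidedly at the ends of \<open>[0,T]\<close>.\<close>

lemma supersolution_from_generator:
  fixes G :: "real \<Rightarrow> 's \<Rightarrow> real"
  assumes xS: "x \<in> S" and fin: "finite {z\<in>S. q x z \<noteq> 0}"
    and cont: "\<And>z. z \<in> S \<Longrightarrow> continuous_on UNIV (\<lambda>t. G t z)" and R: "0 \<le> R"
    and der: "\<And>t. s < t \<Longrightarrow> t < s + R \<Longrightarrow> \<exists>G'. ((\<lambda>t. G t x) has_real_derivative G') (at t) \<and>
      G' + (\<Sum>z | z \<in> S - {x} \<and> q x z \<noteq> 0. q x z * (G t z - G t x)) \<le> 0"
  shows "exp (- exit_rate S q x * R) * G (s + R) x +
      integral {0..R} (\<lambda>r. exp (- exit_rate S q x * r) *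
        (\<Sum>z | z \<in> S - {x} \<and> q x z \<noteq> 0. q x z * G (s + r) z)) \<le> G s x"
proof -
  define c where "c = exit_rate S q x"
  define Z where "Z = {z. z \<in> S - {x} \<and> q x z \<noteq> 0}"
  define k where "k r = exp (- c * r) * (\<Sum>z\<in>Z. q x z * G (s + r) z)" for r
  \<comment> \<open>For nonnegative rates this is the expectation of \<open>G\<close> at the first
    jump or after time \<open>r\<close>, whichever is earlier. Since \<open>c\<close> is the sum of
    the rates, its derivative is \<open>exp (- c * r)\<close> times the time derivative plus
    generator of \<open>G\<close>.\<close>
  define \<phi> where "\<phi> r = exp (- c * r) * G (s + r) x + integral {0..r} k" for r
  have c: "c = (\<Sum>z\<in>Z. q x z)" unfolding c_def Z_def by (rule exit_rate_finite_support[of S q x, OF fin])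
  have k_cont: "continuous_on B k" for B
    unfolding k_def[abs_def] Z_def by (intro continuous_intros continuous_on_compose2[OF cont]) auto
  have "\<phi> R \<le> \<phi> 0"
  proof (rule DERIV_nonpos_imp_decreasing_open[OF R])
    have "continuous_on {0..R} (\<lambda>r. integral {0..r} k)"
      by (intro indefinite_integral_continuous_1 integrable_continuous_real k_cont)
    then show "continuous_on {0..R} \<phi>"
      unfolding \<phi>_def[abs_def] by (intro continuous_intros continuous_on_compose2[OF cont] xS) auto
    fix r assume r: "0 < r" "r < R"
    then obtain G' where G': "((\<lambda>t. G t x) has_real_derivative G') (at (s + r))"
      and le: "G' + (\<Sum>z\<in>Z. q x z * (G (s + r) z - G (s + r) x)) \<le> 0"
      using der[of "s + r"] unfolding Z_def by auto
    have "((\<lambda>r. integral {0..r} k) has_real_derivative k r) (at r within {0..R})"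
      using r by (intro integral_has_real_derivative k_cont) auto
    then have I: "((\<lambda>r. integral {0..r} k) has_real_derivative k r) (at r)"
      using r by (simp add: at_within_Icc_at)
    have "((\<lambda>r. G (s + r) x) has_real_derivative G' * 1) (at r)"
      by (rule DERIV_chain2[where f="\<lambda>t. G t x" and g="\<lambda>r. s + r", OF G']) (auto intro!: derivative_eq_intros)
    then have "(\<phi> has_real_derivative (exp (- c * r) * (- c) * G (s + r) x + G' * exp (- c * r) + k r)) (at r)"
      unfolding \<phi>_def[abs_def] by (auto intro!: derivative_eq_intros I)
    moreover have "exp (- c * r) * (- c) * G (s + r) x + G' * exp (- c * r) + k r =
       exp (- c * r) * (G' + (\<Sum>z\<in>Z. q x z * (G (s + r) z - G (s + r) x)))"
      by (simp add: k_def c algebra_simps sum_subtractf sum_distrib_left sum_distrib_right)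
    moreover have "\<dots> \<le> 0" using le by (simp add: mult_nonneg_nonpos)
    ultimately show "\<exists>y. (\<phi> has_real_derivative y) (at r) \<and> y \<le> 0" by auto
  qed
  then show ?thesis unfolding \<phi>_def k_def[abs_def] c_def Z_def by simp
qed

text \<open>In the discrete topology a path takes at most two values near a time, its value there
  and its left limit, apart from what lies outside a small neighbourhood; compactness leaves
  finitely many. This bounds the supremum over time.\<close>

lemma cadlag_path_finite_range:
  assumes "cadlag_path p" 
  shows "finite (p ` {0..T})"
proof -
  have "\<exists>\<delta>>0. finite (p ` ({t - \<delta><..<t + \<delta>} \<inter> {0..T}))" if t: "t \<in> {0..T}" for t
  proof -
    obtain \<delta>1 where \<delta>1: "0 < \<delta>1" "\<And>s. t < s \<Longrightarrow> s < t + \<delta>1 \<Longrightarrow> p s = p t"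
    proof -
      have "\<forall>\<^sub>F s in at_right t. p s = p t" using assms t by (auto simp: cadlag_path_def)
      then obtain b where b: "b > t" "\<And>s. t < s \<Longrightarrow> s < b \<Longrightarrow> p s = p t"
        unfolding eventually_at_right_field by auto
      show ?thesis by (rule that[of "b - t"]) (use b in auto)
    qed
    obtain \<delta>2 y where \<delta>2: "0 < \<delta>2" "\<And>s. 0 \<le> s \<Longrightarrow> t - \<delta>2 < s \<Longrightarrow> s < t \<Longrightarrow> p s = y"
    proof (cases "t = 0")
      case True
      show ?thesis by (rule that[of 1 undefined]) (use True in auto)
    next
      case False
      then have "\<exists>y. \<forall>\<^sub>F s in at_left t. p s = y" using assms t by (auto simp: cadlag_path_def)
      then obtain y b where b: "b < t" "\<And>s. b < s \<Longrightarrow> s < t \<Longrightarrow> p s = y"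
        unfolding eventually_at_left_field by auto
      show ?thesis by (rule that[of "t - b" y]) (use b in auto)
    qed
    have "p ` ({t - min \<delta>1 \<delta>2<..<t + min \<delta>1 \<delta>2} \<inter> {0..T}) \<subseteq> {p t, y}"
    proof
      fix z assume "z \<in> p ` ({t - min \<delta>1 \<delta>2<..<t + min \<delta>1 \<delta>2} \<inter> {0..T})"
      then obtain s where s: "z = p s" "t - min \<delta>1 \<delta>2 < s" "s < t + min \<delta>1 \<delta>2" "0 \<le> s" by auto
      show "z \<in> {p t, y}"
        using s \<delta>1(2)[of s] \<delta>2(2)[of s] by (cases s t rule: linorder_cases) auto
    qed
    then have "finite (p ` ({t - min \<delta>1 \<delta>2<..<t + min \<delta>1 \<delta>2} \<inter> {0..T}))"
      by (rule finite_subset) simp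
    then show ?thesis using \<delta>1(1) \<delta>2(1) by (intro exI[of _ "min \<delta>1 \<delta>2"]) auto
  qed
  then obtain \<delta> where \<delta>: "\<And>t. t \<in> {0..T} \<Longrightarrow> 0 < \<delta> t"
    "\<And>t. t \<in> {0..T} \<Longrightarrow> finite (p ` ({t - \<delta> t<..<t + \<delta> t} \<inter> {0..T}))" by metis
  obtain I where I: "I \<subseteq> {0..T}" "finite I" "{0..T} \<subseteq> (\<Union>t\<in>I. {t - \<delta> t<..<t + \<delta> t})"
  proof (rule compactE_image[of "{0..T}" "{0..T}" "\<lambda>t. {t - \<delta> t<..<t + \<delta> t}"])
    show "{0..T} \<subseteq> (\<Union>t\<in>{0..T}. {t - \<delta> t<..<t + \<delta> t})" using \<delta>(1) by fastforce
  qed auto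
  have "p ` {0..T} \<subseteq> (\<Union>t\<in>I. p ` ({t - \<delta> t<..<t + \<delta> t} \<inter> {0..T}))" using I(3) by blast
  moreover have "finite (\<Union>t\<in>I. p ` ({t - \<delta> t<..<t + \<delta> t} \<inter> {0..T}))"
    using I(1,2) \<delta>(2) by blast
  ultimately show ?thesis by (rule finite_subset)
qed

section \<open>Deviation from the solution\<close>

lemma L2_norm_scaled_process:
  "L2_norm (\<lambda>x. scaled_process n ell m t \<omega> x - v x) = sqrt (energy n v (\<lambda>k. real (m t \<omega> k) / ell))"
  by (simp add: L2_norm_def scaled_process_def energy_def)

lemma energy_nonneg: "0 \<le> energy n v f"
  by (simp add: energy_def)

text \<open>Right-continuity reduces suprema over \<open>[0,T]\<close> to rational times, except at the end point \<open>T\<close>.\<close>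

definition dense_times :: "real \<Rightarrow> real set" where
  "dense_times T = insert T (\<rat> \<inter> {0..T})"

lemma countable_dense_times: "countable (dense_times T)"
  by (simp add: dense_times_def countable_rat countable_Int1)

lemma dense_times_subset: "0 \<le> T \<Longrightarrow> dense_times T \<subseteq> {0..T}"
  by (auto simp: dense_times_def)

locale particle_path = C1_curve T u u' for T u u' +
  fixes M :: "'w measure" and n :: nat and ell :: real and m :: "real \<Rightarrow> 'w \<Rightarrow> nat \<Rightarrow> nat"
  assumes m_measurable: "\<And>t. 0 \<le> t \<Longrightarrow> m t \<in> measurable M (count_space (configs n))"
    and cadlag: "\<And>\<omega>. \<omega> \<in> space M \<Longrightarrow> cadlag_path (\<lambda>t. m t \<omega>)"
begin

definition deviation :: "real \<Rightarrow> 'w \<Rightarrow> real" where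
  "deviation t \<omega> = L2_norm (\<lambda>x. scaled_process n ell m t \<omega> x - u t x)"

lemma deviation_eq: "deviation t \<omega> = sqrt (energy n (u t) (\<lambda>k. real (m t \<omega> k) / ell))"
  by (simp add: deviation_def L2_norm_scaled_process)

lemma deviation_nonneg: "0 \<le> deviation t \<omega>"
  by (simp add: deviation_eq energy_nonneg)

lemma deviation_measurable: "0 \<le> t \<Longrightarrow> deviation t \<in> borel_measurable M"
  unfolding deviation_eq[abs_def] by (rule measurable_compose[OF m_measurable]) auto

lemma energy_continuous: "continuous_on {0..T} (\<lambda>t. energy n (u t) f)"
  by (rule DERIV_continuous_on[OF energy_has_derivative])

text \<open>A real \<open>SUP\<close> is meaningful only for a bounded family. Finitely many
  configurations occur up to \<open>T\<close>, and for each the energy is continuous in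
  time.\<close>

lemma deviation_bdd:
  assumes "\<omega> \<in> space M"
  shows "bdd_above ((\<lambda>t. deviation t \<omega>) ` {0..T})"
proof -
  define X where "X = (\<lambda>t. m t \<omega>) ` {0..T}"
  have fin: "finite X" unfolding X_def by (rule cadlag_path_finite_range[OF cadlag[OF assms]])
  have "\<exists>C. \<forall>t\<in>{0..T}. sqrt (energy n (u t) (\<lambda>k. real (x k) / ell)) \<le> C" for x
  proof -
    have "compact ((\<lambda>t. sqrt (energy n (u t) (\<lambda>k. real (x k) / ell))) ` {0..T})"
      by (intro compact_continuous_image continuous_on_real_sqrt energy_continuous) auto
    then have "bdd_above ((\<lambda>t. sqrt (energy n (u t) (\<lambda>k. real (x k) / ell))) ` {0..T})"
      by (intro bounded_imp_bdd_above compact_imp_bounded)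
    then show ?thesis unfolding bdd_above_def by auto
  qed
  then obtain C where C: "\<And>x t. t \<in> {0..T} \<Longrightarrow> sqrt (energy n (u t) (\<lambda>k. real (x k) / ell)) \<le> C x" by metis
  have "deviation t \<omega> \<le> (\<Sum>x\<in>X. \<bar>C x\<bar>)" if t: "t \<in> {0..T}" for t
  proof -
    have "m t \<omega> \<in> X" using t by (auto simp: X_def)
    then have "\<bar>C (m t \<omega>)\<bar> \<le> (\<Sum>x\<in>X. \<bar>C x\<bar>)" using fin by (intro member_le_sum) auto
    moreover have "deviation t \<omega> \<le> C (m t \<omega>)" unfolding deviation_eq by (rule C[OF t])
    ultimately show ?thesis by simp
  qed
  then show ?thesis by (intro bdd_aboveI2)
qed

text \<open>Just after \<open>t\<close> the configuration is frozen and the energy is continuous in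
  time, so a strict inequality survives up to some rational time.\<close>

lemma deviation_dense:
  assumes \<omega>: "\<omega> \<in> space M" and t: "t \<in> {0..T}" and a: "a < deviation t \<omega>"
  shows "\<exists>s\<in>dense_times T. a < deviation s \<omega>"
proof (cases "t = T")
  case True then show ?thesis using a by (auto simp: dense_times_def)
next
  case False
  with t have tT: "t < T" by auto
  let ?f = "\<lambda>k. real (m t \<omega> k) / ell"
  have "continuous_on {0..T} (\<lambda>s. sqrt (energy n (u s) ?f))"
    by (intro continuous_on_real_sqrt energy_continuous)
  then have "((\<lambda>s. sqrt (energy n (u s) ?f)) \<longlongrightarrow> deviation t \<omega>) (at t within {0..T})"
    using t by (simp add: continuous_on_def deviation_eq)
  then have "((\<lambda>s. sqrt (energy n (u s) ?f)) \<longlongrightarrow> deviation t \<omega>) (at t within {t..T})"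
    by (rule tendsto_within_subset) (use t in auto)
  moreover have "at t within {t..T} = at_right t" using tT by (rule at_within_Icc_at_right)
  ultimately have "\<forall>\<^sub>F s in at_right t. a < sqrt (energy n (u s) ?f)"
    using a by (auto dest: order_tendstoD(1))
  moreover have "\<forall>\<^sub>F s in at_right t. m s \<omega> = m t \<omega>"
    using cadlag[OF \<omega>] t by (auto simp: cadlag_path_def)
  ultimately have "\<forall>\<^sub>F s in at_right t. a < deviation s \<omega>"
    by eventually_elim (simp add: deviation_eq)
  then obtain b where b: "b > t" "\<And>s. t < s \<Longrightarrow> s < b \<Longrightarrow> a < deviation s \<omega>"
    unfolding eventually_at_right_field by auto
  obtain r where r: "r \<in> \<rat>" "t < r" "r < min b T" using Rats_dense_in_real[of t "min b T"] b tT by auto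
  then show ?thesis using b t by (intro bexI[of _ r]) (auto simp: dense_times_def)
qed

lemma less_SUP_deviation_iff:
  assumes "\<omega> \<in> space M"
  shows "a < (SUP t\<in>{0..T}. deviation t \<omega>) \<longleftrightarrow> (\<exists>t\<in>dense_times T. a < deviation t \<omega>)"
proof -
  have "a < (SUP t\<in>{0..T}. deviation t \<omega>) \<longleftrightarrow> (\<exists>t\<in>{0..T}. a < deviation t \<omega>)"
    using T_pos by (intro less_cSUP_iff deviation_bdd assms) auto
  also have "\<dots> \<longleftrightarrow> (\<exists>t\<in>dense_times T. a < deviation t \<omega>)"
    using deviation_dense[OF assms] dense_times_subset[of T] T_pos by (meson less_imp_le subsetD)
  finally show ?thesis .
qed

lemma SUP_deviation_measurable: "(\<lambda>\<omega>. SUP t\<in>{0..T}. deviation t \<omega>) \<in> borel_measurable M"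
proof (rule borel_measurableI_greater)
  fix a :: real
  have "{\<omega>\<in>space M. a < (SUP t\<in>{0..T}. deviation t \<omega>)} = (\<Union>t\<in>dense_times T. {\<omega>\<in>space M. a < deviation t \<omega>})"
    using less_SUP_deviation_iff by auto
  also have "\<dots> \<in> sets M"
  proof (rule sets.countable_UN''[OF countable_dense_times])
    fix t assume "t \<in> dense_times T"
    then have "0 \<le> t" using dense_times_subset[of T] T_pos by auto
    from deviation_measurable[OF this] have [measurable]: "deviation t \<in> borel_measurable M" .
    show "{\<omega>\<in>space M. a < deviation t \<omega>} \<in> sets M" by measurable
  qed
  finally show "{\<omega>\<in>space M. a < (SUP t\<in>{0..T}. deviation t \<omega>)} \<in> sets M" .
qed

lemma SUP_deviation_nonneg: "\<omega> \<in> space M \<Longrightarrow> 0 \<le> (SUP t\<in>{0..T}. deviation t \<omega>)"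
  using T_pos by (intro cSUP_upper2[where x=0] deviation_bdd deviation_nonneg) auto

end

text \<open>Nonnegative rates are known along the process, whereas the induction runs along the
  chain. As holding times are positive, the process sits in \<open>Y i\<close> at the time
  \<open>jump_time i\<close> whenever that time is finite, so every state up to the current one is
  visited.\<close>

lemma (in jump_chain) embedded_chain_good:
  assumes rep: "AE \<omega> in M. \<forall>t\<ge>0. \<exists>k. (\<Sum>i<k. \<tau> i \<omega>) \<le> ereal t \<and> ereal t < (\<Sum>i\<le>k. \<tau> i \<omega>) \<and> X t \<omega> = Y k \<omega>"
    and good: "AE \<omega> in M. \<forall>t\<ge>0. X t \<omega> \<in> good"
  shows "AE \<omega> in M. X 0 \<omega> = Y 0 \<omega> \<and> (\<forall>t\<ge>0. \<exists>k. jump_time k \<omega> \<le> ereal t \<and> ereal t < jump_time k \<omega> + \<tau> k \<omega> \<and>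
     X t \<omega> = Y k \<omega> \<and> (\<forall>i\<le>k. Y i \<omega> \<in> good))"
  using rep good holding_times_pos AE_space
proof eventually_elim
  case (elim \<omega>)
  have Suc_time: "(\<Sum>i\<le>k. \<tau> i \<omega>) = jump_time (Suc k) \<omega>" "jump_time (Suc k) \<omega> = jump_time k \<omega> + \<tau> k \<omega>" for k
    by (simp_all add: jump_time_def lessThan_Suc_atMost[symmetric])
  have mono: "jump_time j \<omega> \<le> jump_time k \<omega>" if "j \<le> k" for j k
    unfolding jump_time_def using that elim(4) by (intro sum_mono2) (auto intro: \<tau>_nonneg)
  have rep': "\<exists>k. jump_time k \<omega> \<le> ereal t \<and> ereal t < jump_time (Suc k) \<omega> \<and> X t \<omega> = Y k \<omega>" if "0 \<le> t" for t
    using elim(1) that unfolding Suc_time(1) jump_time_def[symmetric] by blast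
  have visit: "X t \<omega> = Y i \<omega>" if t: "0 \<le> t" "jump_time i \<omega> = ereal t" for i t
  proof -
    obtain k where k: "jump_time k \<omega> \<le> ereal t" "ereal t < jump_time (Suc k) \<omega>" "X t \<omega> = Y k \<omega>"
      using rep'[OF t(1)] by blast
    have "k = i"
    proof (cases k i rule: linorder_cases)
      case less
      then have "jump_time (Suc k) \<omega> \<le> jump_time i \<omega>" by (intro mono) simp
      with k t show ?thesis by simp
    next
      \<comment> \<open>A later index would force the holding interval of \<open>Y i\<close> to end
        by time \<open>t\<close>, at which it starts.\<close>
      case greater
      then have "jump_time (Suc i) \<omega> \<le> jump_time k \<omega>" by (intro mono) simp
      with k have "jump_time i \<omega> + \<tau> i \<omega> \<le> ereal t" unfolding Suc_time by simp
      moreover have "ereal t < ereal t + \<tau> i \<omega>" using elim(3) by (cases "\<tau> i \<omega>") (auto simp: zero_ereal_def dest: spec[of _ i])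
      ultimately show ?thesis using t by simp
    qed
    with k show ?thesis by simp
  qed
  have time_nonneg: "0 \<le> jump_time i \<omega>" for i
    unfolding jump_time_def using elim(4) by (intro sum_nonneg) (auto intro: \<tau>_nonneg)
  have "X 0 \<omega> = Y 0 \<omega>" by (rule visit) (auto simp: jump_time_def)
  moreover have "\<exists>k. jump_time k \<omega> \<le> ereal t \<and> ereal t < jump_time k \<omega> + \<tau> k \<omega> \<and>
     X t \<omega> = Y k \<omega> \<and> (\<forall>i\<le>k. Y i \<omega> \<in> good)" if t: "0 \<le> t" for t
  proof -
    obtain k where k: "jump_time k \<omega> \<le> ereal t" "ereal t < jump_time (Suc k) \<omega>" "X t \<omega> = Y k \<omega>"
      using rep'[OF t] by blast
    have "Y i \<omega> \<in> good" if "i \<le> k" for i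
    proof -
      have "jump_time i \<omega> \<le> ereal t" using mono[OF that] k(1) by simp
      then obtain r where r: "jump_time i \<omega> = ereal r" "0 \<le> r"
        using time_nonneg[of i] by (cases "jump_time i \<omega>") auto
      then show ?thesis using visit[OF r(2,1)] elim(2) by auto
    qed
    with k show ?thesis unfolding Suc_time by blast
  qed
  ultimately show ?case by blast
qed

section \<open>Probability bound for a fixed graph\<close>

lemma particle_rate_nonneg:
  assumes Wn: "graphon (step_graphon n A)" and ell: "0 < ell"
    and bd: "\<And>k. k \<in> {1..n} \<Longrightarrow> 0 \<le> b (real (x k) / ell) \<and> 0 \<le> d (real (x k) / ell)"
  shows "0 \<le> particle_rate n A ell b d x z"
  unfolding particle_rate_def
  using step_graphon_nonneg[OF Wn] bd ell
  by (intro add_nonneg_nonneg sum_nonneg) (auto intro!: mult_nonneg_nonneg divide_nonneg_nonneg)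

text \<open>A deviation above \<open>\<epsilon>\<close> requires either a bad start, the event
  \<open>H\<close>, or a crossing of \<open>lam\<close> by \<open>G\<close> after a start in
  \<open>B\<close>, the event \<open>E\<close>. The first probability is kept as it is; the second
  is at most the largest value of \<open>G 0\<close> on \<open>B\<close>, divided by
  \<open>lam\<close>.\<close>

lemma (in C1_curve) deviation_probability:
  fixes b d :: "real \<Rightarrow> real" and M :: "'w measure" and m :: "real \<Rightarrow> 'w \<Rightarrow> nat \<Rightarrow> nat"
  assumes n: "1 \<le> n" and graph: "graph_on n A" and Wn: "graphon (step_graphon n A)" and W: "graphon W"
    and ell: "1 \<le> ell" and b: "Lb-lipschitz_on UNIV b" "b 0 = 0" and d: "Ld-lipschitz_on UNIV d" "d 0 = 0"
    and U: "0 < U" and bound: "\<And>t. t \<in> {0..T} \<Longrightarrow> ess_bounded U (u t)"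
    and eq: "\<And>t. t \<in> {0..T} \<Longrightarrow> AE x in I01. u' t x = diffusion W (u t) x + (b (u t x) - d (u t x))"
    and u0_meas: "u0 \<in> borel_measurable I01" and u0: "AE x in I01. u 0 x = u0 x"
    and process: "particle_process M n A ell b d m"
    and \<epsilon>: "0 < \<epsilon>" and \<eta>: "0 \<le> \<eta>"
  defines "L \<equiv> Lb + Ld" and "K \<equiv> 3 + 3 * (Lb + Ld)"
    and "\<delta> \<equiv> 8 * U\<^sup>2 * cut_norm (\<lambda>x y. step_graphon n A x y - W x y) + (2 + (Lb + Ld)) * (1 + U) / ell"
  shows "(\<lambda>\<omega>. SUP t\<in>{0..T}. L2_norm (\<lambda>x. scaled_process n ell m t \<omega> x - u t x)) \<in> borel_measurable M"
    and "measure M {\<omega>\<in>space M. \<epsilon> < \<bar>SUP t\<in>{0..T}. L2_norm (\<lambda>x. scaled_process n ell m t \<omega> x - u t x)\<bar>} \<le>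
      measure M {\<omega>\<in>space M. \<eta> < \<bar>L2_norm (\<lambda>x. scaled_process n ell m 0 \<omega> x - u0 x)\<bar>} +
      (\<eta>\<^sup>2 + \<delta> * T) / (exp (- K * T) * \<epsilon>\<^sup>2)"
proof -
  define S where "S = configs n"
  define q where "q = particle_rate n A ell b d"
  have mjp: "markov_jump_process M S q m" and bd_AE: "AE \<omega> in M. \<forall>t\<ge>0. \<forall>k\<in>{1..n}.
        0 \<le> b (real (m t \<omega> k) / ell) \<and> 0 \<le> d (real (m t \<omega> k) / ell)"
    using process by (auto simp: particle_process_def S_def q_def)
  interpret prob_space M using mjp by (simp add: markov_jump_process_def)
  obtain Y \<tau> where jh: "jump_hold M S q Y \<tau>" and rep: "AE \<omega> in M. \<forall>t\<ge>0. \<exists>k. (\<Sum>i<k. \<tau> i \<omega>) \<le> ereal t \<and>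
      ereal t < (\<Sum>i\<le>k. \<tau> i \<omega>) \<and> m t \<omega> = Y k \<omega>"
    using mjp by (auto simp: markov_jump_process_def)
  interpret particle_path T u u' M n ell m
    using mjp by unfold_locales (auto simp: markov_jump_process_def S_def)
  show "(\<lambda>\<omega>. SUP t\<in>{0..T}. L2_norm (\<lambda>x. scaled_process n ell m t \<omega> x - u t x)) \<in> borel_measurable M"
    using SUP_deviation_measurable unfolding deviation_def .
  have cS: "countable S" unfolding S_def by (intro countable_PiE) auto
  interpret J: jump_chain M S q Y \<tau>
    using jh cS particle_rate_finite_support[of n A ell b d] by unfold_locales (auto simp: S_def q_def)
  define good where "good = {x\<in>S. \<forall>k\<in>{1..n}. 0 \<le> b (real (x k) / ell) \<and> 0 \<le> d (real (x k) / ell)}"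
  define sc where "sc x k = real (x k) / ell" for x :: "nat \<Rightarrow> nat" and k
  \<comment> \<open>The curve \<open>u\<close> is controlled only on \<open>[0,T]\<close>, while
    \<open>G\<close> has to be continuous on the whole line; outside it is extended by its values at
    the end points.\<close>
  define clamp where "clamp t = max 0 (min T t)" for t
  define F where "F t x = energy n (u t) (sc x)" for t x
  define G where "G t x = exp (- K * clamp t) * F (clamp t) x + \<delta> * (T - clamp t)" for t x
  have L0: "0 \<le> L" using lipschitz_on_nonneg[OF b(1)] lipschitz_on_nonneg[OF d(1)] by (simp add: L_def)
  have K0: "0 \<le> K" using L0 by (simp add: K_def L_def)
  have cut0: "0 \<le> cut_norm (\<lambda>x y. step_graphon n A x y - W x y)"
    using Bochner_Integration.integrable_diff[OF graphon_integrable[OF Wn] graphon_integrable[OF W]]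
    by (intro cut_norm_nonneg) (simp add: case_prod_beta')
  have \<delta>0: "0 \<le> \<delta>" using cut0 U L0 ell by (auto simp: \<delta>_def L_def intro!: add_nonneg_nonneg mult_nonneg_nonneg divide_nonneg_nonneg)
  have F0: "0 \<le> F t x" for t x by (simp add: F_def energy_nonneg)
  have clamp: "clamp t \<in> {0..T}" for t using T_pos by (auto simp: clamp_def)
  have F_cont: "continuous_on {0..T} (\<lambda>t. F t x)" for x unfolding F_def by (rule energy_continuous)
  have clamp_cont: "continuous_on UNIV clamp" unfolding clamp_def[abs_def] by (intro continuous_intros)
  have drift: "(\<Sum>z | z \<in> S - {x} \<and> q x z \<noteq> 0. q x z * (F t z - F t x))
       - 2 * (\<integral>y. (step_fun n (sc x) y - u t y) * u' t y \<partial>I01) \<le> K * F t x + \<delta>"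
    if x: "x \<in> S" and t: "t \<in> {0..T}" for x t
  proof -
    have "(\<Sum>z | z \<in> S - {x} \<and> q x z \<noteq> 0. q x z * (F t z - F t x))
       - 2 * (\<integral>y. (step_fun n (sc x) y - u t y) * u' t y \<partial>I01) \<le> (1 + 2 * L + (2 + L) / ell) * F t x + \<delta>"
      using energy_drift_bound_ess[OF n graph Wn W _ b d U bound[OF t] _ u'_measurable[OF t] eq[OF t], of ell x] x ell
      unfolding S_def q_def F_def sc_def[abs_def] L_def \<delta>_def by simp
    \<comment> \<open>With \<open>ell\<close> at least 1 the growth rate is bounded independently of
      \<open>n\<close> by \<open>3 + 3 * L\<close>, which is \<open>K\<close>.\<close>
    also have "(1 + 2 * L + (2 + L) / ell) * F t x \<le> K * F t x"
    proof (rule mult_right_mono)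
      have "(2 + L) / ell \<le> (2 + L) / 1" using L0 ell by (intro divide_left_mono) auto
      then show "1 + 2 * L + (2 + L) / ell \<le> K" by (simp add: K_def L_def)
    qed (rule F0)
    finally show ?thesis by simp
  qed
  have G_der: "\<exists>G'. ((\<lambda>t. G t x) has_real_derivative G') (at t) \<and>
      G' + (\<Sum>z | z \<in> S - {x} \<and> q x z \<noteq> 0. q x z * (G t z - G t x)) \<le> 0"
    if x: "x \<in> S" and t: "0 < t" "t < T" for x t
  proof -
    define I where "I = (\<integral>y. (step_fun n (sc x) y - u t y) * u' t y \<partial>I01)"
    have "((\<lambda>t. F t x) has_real_derivative - 2 * I) (at t within {0..T})"
      unfolding F_def I_def using t by (intro energy_has_derivative) auto
    then have F_der: "((\<lambda>t. F t x) has_real_derivative - 2 * I) (at t)"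
      using t by (simp add: at_within_Icc_at)
    have "((\<lambda>t. exp (- K * t) * F t x + \<delta> * (T - t)) has_real_derivative
       (exp (- K * t) * (- K * F t x - 2 * I) - \<delta>)) (at t)"
      by (auto intro!: derivative_eq_intros F_der simp: algebra_simps)
    then have "((\<lambda>t. G t x) has_real_derivative (exp (- K * t) * (- K * F t x - 2 * I) - \<delta>)) (at t)"
    proof (rule has_field_derivative_transform_within_open[where S="{0<..<T}"])
      fix s assume "s \<in> {0<..<T}"
      then have "clamp s = s" by (auto simp: clamp_def)
      then show "exp (- K * s) * F s x + \<delta> * (T - s) = G s x" by (simp add: G_def)
    qed (use t in auto)
    moreover have "exp (- K * t) * (- K * F t x - 2 * I) - \<delta> +
       (\<Sum>z | z \<in> S - {x} \<and> q x z \<noteq> 0. q x z * (G t z - G t x)) \<le> 0"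
    proof -
      have ct: "clamp t = t" using t by (auto simp: clamp_def)
      have "(\<Sum>z | z \<in> S - {x} \<and> q x z \<noteq> 0. q x z * (G t z - G t x)) =
        exp (- K * t) * (\<Sum>z | z \<in> S - {x} \<and> q x z \<noteq> 0. q x z * (F t z - F t x))"
        unfolding sum_distrib_left by (intro sum.cong refl) (simp add: G_def ct algebra_simps)
      then have "exp (- K * t) * (- K * F t x - 2 * I) - \<delta> +
        (\<Sum>z | z \<in> S - {x} \<and> q x z \<noteq> 0. q x z * (G t z - G t x)) =
        exp (- K * t) * (((\<Sum>z | z \<in> S - {x} \<and> q x z \<noteq> 0. q x z * (F t z - F t x)) - 2 * I) - K * F t x) - \<delta>"
        by (simp add: algebra_simps)
      \<comment> \<open>The growth of the energy is absorbed by the exponential weight. What remains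
        of the inhomogeneity is damped by a factor at most 1, so the slope \<open>- \<delta>\<close>
        of the linear term compensates it.\<close>
      also have "\<dots> \<le> exp (- K * t) * \<delta> - \<delta>"
        using drift[OF x, of t] t by (intro diff_right_mono mult_left_mono) (auto simp: I_def)
      also have "\<dots> \<le> 0"
        using K0 t \<delta>0 mult_right_mono[of "exp (- K * t)" 1 \<delta>] by simp
      finally show ?thesis .
    qed
    ultimately show ?thesis by blast
  qed
  have G_cont: "continuous_on UNIV (\<lambda>t. G t x)" for x
    unfolding G_def by (intro continuous_intros clamp_cont continuous_on_compose2[OF F_cont clamp_cont]) (use clamp in auto)
  \<comment> \<open>The smallest value on \<open>[0,T]\<close> of the exponential weight times the
    squared threshold: an energy above \<open>\<epsilon>\<close> squared at any time pushes
    \<open>G\<close> above this level.\<close>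
  define lam where "lam = exp (- K * T) * \<epsilon>\<^sup>2"
  have lam: "0 < lam" using \<epsilon> by (simp add: lam_def)
  interpret Sup: supersolution M S q Y \<tau> good G T "dense_times T" lam
  proof unfold_locales
    show "good \<subseteq> S" by (auto simp: good_def)
    show "0 \<le> q x z" if "x \<in> good" for x z
      unfolding q_def using that ell by (intro particle_rate_nonneg[OF Wn]) (auto simp: good_def)
    show "0 \<le> G t x" for t x
      unfolding G_def using F0 \<delta>0 clamp[of t] by (intro add_nonneg_nonneg mult_nonneg_nonneg) auto
    show "continuous_on UNIV (\<lambda>t. G t x)" for x by (rule G_cont)
    show "exp (- exit_rate S q x * R) * G (s + R) x +
      integral {0..R} (\<lambda>r. exp (- exit_rate S q x * r) *
        (\<Sum>z | z \<in> S - {x} \<and> q x z \<noteq> 0. q x z * G (s + r) z)) \<le> G s x"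
      if "x \<in> good" "0 \<le> s" "0 \<le> R" "s + R \<le> T" for x s R
      using that J.finite_support[of x]
      by (intro supersolution_from_generator G_cont G_der) (auto simp: good_def)
    show "countable (dense_times T)" by (rule countable_dense_times)
    show "dense_times T \<subseteq> {0..T}" using T_pos by (intro dense_times_subset) simp
    show "0 < lam" by (rule lam)
  qed
  define B where "B = {x. F 0 x \<le> \<eta>\<^sup>2}"
  define E where "E = {\<omega>\<in>space M. Y 0 \<omega> \<in> B \<and> (\<exists>j. (\<forall>i\<le>j. Y i \<omega> \<in> good) \<and>
     Sup.crosses (Y j \<omega>) (J.jump_time j \<omega>) (\<tau> j \<omega>))}"
  have E_le: "prob E \<le> (\<eta>\<^sup>2 + \<delta> * T) / lam"
    unfolding E_def
  proof (rule Sup.maximal_inequality)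
    show "G 0 x \<le> \<eta>\<^sup>2 + \<delta> * T" if "x \<in> B" for x
      using that T_pos by (simp add: B_def G_def clamp_def)
    show "0 \<le> \<eta>\<^sup>2 + \<delta> * T" using \<delta>0 T_pos by simp
  qed (use T_pos in simp)
  have E_sets: "E \<in> events"
  proof -
    have "E = {\<omega>\<in>space M. Y 0 \<omega> \<in> B \<and> (\<exists>j. (\<forall>i\<in>{..j}. Y i \<omega> \<in> good) \<and>
     Sup.crosses (Y j \<omega>) (J.jump_time j \<omega>) (\<tau> j \<omega>))}" by (auto simp: E_def)
    also have "\<dots> \<in> events"
      using Sup.crosses_Y_measurable Sup.Y_compose_measurable[of "\<lambda>y. y \<in> B" 0] Sup.Y_compose_measurable[of "\<lambda>y. y \<in> good"]
      by measurable
    finally show ?thesis .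
  qed
  define H where "H = {\<omega>\<in>space M. \<eta> < \<bar>L2_norm (\<lambda>x. scaled_process n ell m 0 \<omega> x - u0 x)\<bar>}"
  have F0_u0: "F 0 x = energy n u0 (sc x)" for x
    unfolding F_def using u_measurable[of 0] T_pos u0 u0_meas by (intro energy_cong_AE) auto
  have H_eq: "H = {\<omega>\<in>space M. m 0 \<omega> \<notin> B}"
  proof -
    have "\<eta> < \<bar>L2_norm (\<lambda>x. scaled_process n ell m 0 \<omega> x - u0 x)\<bar> \<longleftrightarrow> m 0 \<omega> \<notin> B" for \<omega>
    proof -
      have "\<bar>L2_norm (\<lambda>x. scaled_process n ell m 0 \<omega> x - u0 x)\<bar> = sqrt (F 0 (m 0 \<omega>))"
        unfolding L2_norm_scaled_process F0_u0 sc_def[abs_def] by (simp add: energy_nonneg)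
      moreover have "\<eta> < sqrt (F 0 (m 0 \<omega>)) \<longleftrightarrow> \<eta>\<^sup>2 < F 0 (m 0 \<omega>)"
        using \<eta> by (metis F0 not_le real_le_lsqrt real_sqrt_le_iff real_sqrt_abs abs_of_nonneg)
      ultimately show ?thesis by (simp add: B_def not_le)
    qed
    then show ?thesis by (simp add: H_def)
  qed
  have H_sets: "H \<in> events"
  proof -
    have "(\<lambda>\<omega>. m 0 \<omega> \<notin> B) \<in> measurable M (count_space UNIV)"
      by (rule measurable_compose[OF m_measurable]) auto
    then show ?thesis unfolding H_eq by measurable
  qed
  have good_AE: "AE \<omega> in M. \<forall>t\<ge>0. m t \<omega> \<in> good"
    using bd_AE AE_space
  proof eventually_elim
    case (elim \<omega>)
    have "m t \<omega> \<in> S" if "0 \<le> t" for t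
      using measurable_space[OF m_measurable[OF that] elim(2)] by (simp add: S_def)
    then show ?case using elim by (auto simp: good_def)
  qed
  define Z where "Z = {\<omega>\<in>space M. \<epsilon> < \<bar>SUP t\<in>{0..T}. deviation t \<omega>\<bar>}"
  have "AE \<omega> in M. \<omega> \<in> Z \<longrightarrow> \<omega> \<in> H \<union> E"
    using J.embedded_chain_good[OF rep good_AE] AE_space
  proof eventually_elim
    case (elim \<omega>)
    show ?case
    proof
      assume Z: "\<omega> \<in> Z"
      show "\<omega> \<in> H \<union> E"
      proof (cases "m 0 \<omega> \<in> B")
        case True
        have "\<epsilon> < (SUP t\<in>{0..T}. deviation t \<omega>)" using Z SUP_deviation_nonneg[OF elim(2)] by (simp add: Z_def)
        then obtain t where t: "t \<in> dense_times T" "\<epsilon> < deviation t \<omega>" using less_SUP_deviation_iff[OF elim(2)] by blast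
        have t0: "0 \<le> t" "t \<le> T" using t(1) dense_times_subset[of T] T_pos by auto
        obtain k where k: "J.jump_time k \<omega> \<le> ereal t" "ereal t < J.jump_time k \<omega> + \<tau> k \<omega>"
          "m t \<omega> = Y k \<omega>" "\<forall>i\<le>k. Y i \<omega> \<in> good" using elim(1) t0(1) by blast
        have "\<epsilon>\<^sup>2 < (deviation t \<omega>)\<^sup>2" using t(2) \<epsilon> by (intro power_strict_mono) auto
        also have "(deviation t \<omega>)\<^sup>2 = F t (m t \<omega>)"
          unfolding deviation_eq F_def sc_def[abs_def] by (simp add: energy_nonneg)
        finally have F_gt: "\<epsilon>\<^sup>2 < F t (Y k \<omega>)" by (simp add: k(3))
        have ct: "clamp t = t" using t0 by (auto simp: clamp_def)
        have "lam \<le> exp (- K * t) * \<epsilon>\<^sup>2"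
          unfolding lam_def using K0 t0 by (intro mult_right_mono) (auto intro: mult_left_mono)
        also have "\<dots> < exp (- K * t) * F t (Y k \<omega>)" using F_gt by simp
        also have "\<dots> \<le> G t (Y k \<omega>)" using \<delta>0 t0 by (simp add: G_def ct)
        finally have "Sup.crosses (Y k \<omega>) (J.jump_time k \<omega>) (\<tau> k \<omega>)"
          unfolding Sup.crosses_def using k t(1) by blast
        then show ?thesis using k(4) True elim by (auto simp: E_def)
      next
        case False then show ?thesis using elim(2) by (simp add: H_eq)
      qed
    qed
  qed
  then have "prob Z \<le> prob (H \<union> E)"
    using H_sets E_sets by (intro finite_measure_mono_AE) auto
  also have "\<dots> \<le> prob H + prob E"
    using H_sets E_sets by (rule measure_subadditive) auto
  also have "\<dots> \<le> prob H + (\<eta>\<^sup>2 + \<delta> * T) / lam" using E_le by simp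
  finally show "prob {\<omega>\<in>space M. \<epsilon> < \<bar>SUP t\<in>{0..T}. L2_norm (\<lambda>x. scaled_process n ell m t \<omega> x - u t x)\<bar>} \<le>
      prob {\<omega>\<in>space M. \<eta> < \<bar>L2_norm (\<lambda>x. scaled_process n ell m 0 \<omega> x - u0 x)\<bar>} +
      (\<eta>\<^sup>2 + \<delta> * T) / (exp (- K * T) * \<epsilon>\<^sup>2)"
    unfolding Z_def deviation_def H_def lam_def .
qed

theorem theorem4p2:
  fixes T :: real
    and A :: "nat \<Rightarrow> nat \<Rightarrow> nat \<Rightarrow> real"
    and W :: "real \<Rightarrow> real \<Rightarrow> real"
    and b d \<Phi> u0 :: "real \<Rightarrow> real"
    and u :: "real \<Rightarrow> real \<Rightarrow> real"
    and ell :: "nat \<Rightarrow> real"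
    and M :: "nat \<Rightarrow> 'w measure"
    and m :: "nat \<Rightarrow> real \<Rightarrow> 'w \<Rightarrow> nat \<Rightarrow> nat"
  assumes "T > 0"
    and "\<And>n. n \<ge> 1 \<Longrightarrow> graph_on n (A n)"
    and "\<And>n. n \<ge> 1 \<Longrightarrow> graphon (step_graphon n (A n))"
    and "graphon W"
    and "(\<lambda>n. cut_norm (\<lambda>x y. step_graphon n (A n) x y - W x y)) \<longlonglongrightarrow> 0"
    and "\<exists>L. L-lipschitz_on UNIV b" and "\<exists>L. L-lipschitz_on UNIV d"
    and "b 0 = 0" and "d 0 = 0"
    and "\<Phi> = (\<lambda>x. b x - d x)"
    and "u0 \<in> Linf"
    and "rd_solution T W \<Phi> u0 u"
    and "\<And>n. n \<ge> 1 \<Longrightarrow> ell n > 0"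
    and "\<And>n. n \<ge> 1 \<Longrightarrow> particle_process (M n) n (A n) (ell n) b d (m n)"
    and "tendsto_0_in_prob M (\<lambda>n \<omega>. L2_norm (\<lambda>x. scaled_process n (ell n) (m n) 0 \<omega> x - u0 x))"
    and "filterlim ell at_top sequentially"
  shows "tendsto_0_in_prob M
    (\<lambda>n \<omega>. SUP t\<in>{0..T}. L2_norm (\<lambda>x. scaled_process n (ell n) (m n) t \<omega> x - u t x))"
proof -
  obtain Lb Ld where Lb: "Lb-lipschitz_on UNIV b" and Ld: "Ld-lipschitz_on UNIV d" using assms(6,7) by blast
  obtain u' where C1: "C1_Linf T u u'"
    and eq: "\<And>t. t \<in> {0..T} \<Longrightarrow> AE x in I01. u' t x = diffusion W (u t) x + (b (u t x) - d (u t x))"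
    and init: "AE x in I01. u 0 x = u0 x"
    using assms(12) unfolding rd_solution_def assms(10) by blast
  have u0_meas: "u0 \<in> borel_measurable I01" using assms(11) by (simp add: Linf_def)
  interpret C1_curve T u u' by unfold_locales (rule assms(1), rule C1)
  obtain U where U: "0 < U" "\<And>t. t \<in> {0..T} \<Longrightarrow> ess_bounded U (u t)" using uniformly_bounded by blast
  define Z where "Z n \<omega> = (SUP t\<in>{0..T}. L2_norm (\<lambda>x. scaled_process n (ell n) (m n) t \<omega> x - u t x))" for n \<omega>
  define Z0 where "Z0 n \<omega> = L2_norm (\<lambda>x. scaled_process n (ell n) (m n) 0 \<omega> x - u0 x)" for n \<omega>
  define K where "K = 3 + 3 * (Lb + Ld)"
  define \<delta> where "\<delta> n = 8 * U\<^sup>2 * cut_norm (\<lambda>x y. step_graphon n (A n) x y - W x y) + (2 + (Lb + Ld)) * (1 + U) / ell n" for n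
  \<comment> \<open>The bound for a fixed graph needs a node and \<open>ell\<close> at least 1; both
    hold eventually.\<close>
  have large: "\<forall>\<^sub>F n in sequentially. 1 \<le> n \<and> 1 \<le> ell n"
    using assms(16) by (intro eventually_conj eventually_ge_at_top) (simp add: filterlim_at_top)
  have \<delta>_lim: "\<delta> \<longlonglongrightarrow> 0"
  proof -
    have "(\<lambda>n. (2 + (Lb + Ld)) * (1 + U) / ell n) \<longlonglongrightarrow> 0"
      by (rule real_tendsto_divide_at_top[OF tendsto_const assms(16)])
    moreover have "(\<lambda>n. 8 * U\<^sup>2 * cut_norm (\<lambda>x y. step_graphon n (A n) x y - W x y)) \<longlonglongrightarrow> 8 * U\<^sup>2 * 0"
      by (intro tendsto_mult tendsto_const assms(5))
    ultimately show ?thesis unfolding \<delta>_def[abs_def] using tendsto_add by fastforce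
  qed
  have meas: "\<forall>\<^sub>F n in sequentially. Z n \<in> borel_measurable (M n)"
    using large
  proof eventually_elim
    case (elim n)
    show ?case unfolding Z_def[abs_def]
      by (rule deviation_probability(1)[OF _ assms(2) assms(3) assms(4) _ Lb assms(8) Ld assms(9) U eq u0_meas init assms(14) zero_less_one order_refl])
        (use elim in auto)
  qed
  have bound: "\<forall>\<^sub>F n in sequentially. measure (M n) {\<omega>\<in>space (M n). \<epsilon> < \<bar>Z n \<omega>\<bar>} \<le>
      measure (M n) {\<omega>\<in>space (M n). \<eta> < \<bar>Z0 n \<omega>\<bar>} + (\<eta>\<^sup>2 + \<delta> n * T) / (exp (- K * T) * \<epsilon>\<^sup>2)"
    if "0 < \<epsilon>" "0 \<le> \<eta>" for \<epsilon> \<eta>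
    using large
  proof eventually_elim
    case (elim n)
    show ?case unfolding Z_def Z0_def K_def \<delta>_def
      by (rule deviation_probability(2)[OF _ assms(2) assms(3) assms(4) _ Lb assms(8) Ld assms(9) U eq u0_meas init assms(14) that])
        (use elim in auto)
  qed
  have "(\<lambda>n. measure (M n) {\<omega>\<in>space (M n). \<epsilon> < \<bar>Z n \<omega>\<bar>}) \<longlonglongrightarrow> 0" if \<epsilon>: "0 < \<epsilon>" for \<epsilon>
  proof (rule tendstoI)
    fix r :: real assume r: "0 < r"
    define lam where "lam = exp (- K * T) * \<epsilon>\<^sup>2"
    have lam: "0 < lam" using \<epsilon> by (simp add: lam_def)
    \<comment> \<open>Splits \<open>r\<close> into thirds: the square of \<open>\<eta>\<close>
      divided by \<open>lam\<close> is one third exactly, and the initial deviation and the error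
      \<open>\<delta>\<close> each stay below a third for large \<open>n\<close>.\<close>
    define \<eta> where "\<eta> = sqrt (r * lam / 3)"
    have \<eta>: "0 < \<eta>" "\<eta>\<^sup>2 = r * lam / 3" using r lam by (auto simp: \<eta>_def)
    have "(\<lambda>n. measure (M n) {\<omega>\<in>space (M n). \<eta> < \<bar>Z0 n \<omega>\<bar>}) \<longlonglongrightarrow> 0"
      using assms(15) \<eta>(1) unfolding tendsto_0_in_prob_def Z0_def by blast
    then have e1: "\<forall>\<^sub>F n in sequentially. measure (M n) {\<omega>\<in>space (M n). \<eta> < \<bar>Z0 n \<omega>\<bar>} < r / 3"
      using r by (intro order_tendstoD(2)) auto
    have "(\<lambda>n. \<delta> n * T / lam) \<longlonglongrightarrow> 0 * T / lam"
      by (intro tendsto_intros \<delta>_lim) (use lam in auto)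
    then have e2: "\<forall>\<^sub>F n in sequentially. \<delta> n * T / lam < r / 3"
      using r by (intro order_tendstoD(2)) auto
    show "\<forall>\<^sub>F n in sequentially. dist (measure (M n) {\<omega>\<in>space (M n). \<epsilon> < \<bar>Z n \<omega>\<bar>}) 0 < r"
      using e1 e2 bound[OF \<epsilon> less_imp_le[OF \<eta>(1)]]
    proof eventually_elim
      case (elim n)
      have "(\<eta>\<^sup>2 + \<delta> n * T) / lam = r / 3 + \<delta> n * T / lam"
        using lam by (simp add: \<eta>(2) add_divide_distrib)
      then show ?case using elim unfolding lam_def[symmetric] by (simp add: dist_real_def)
    qed
  qed
  with meas show ?thesis unfolding tendsto_0_in_prob_def Z_def[abs_def] by blast
qed

end
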